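(* For constant $k$, the following algorithm runs in polynomial time and outputs a hitting set $\mathcal{H}\subseteq\mathbb{F}^n$ of size $n^{O(k)}\cdot s^{O(k^3)}$ for the class of low-degree unmixed $\Sigma\Pi\Sigma\Pi(k)$ circuits of size $s$ in $n$ variables: construct a set $U\subseteq\mathbb{F}$ of size $n^3+1$, and output $\mathcal{H}:=\mathcal{S}_{k,s^{5k^2+2}}\big((U^q)^k\times U^k\big)$. That is, for every nonzero polynomial $P$ computed by such a circuit, there is $a\in\mathcal{H}$ with $P(a)\neq0$.
   Context: $\mathbb{F}$ is a field with sufficiently many elements. A $\Sigma\Pi\Sigma\Pi(k)$ circuit of size $s$ computes $C=\sum_{i=1}^k\prod_{j}f_{ij}$ with each $f_{ij}$ having at most $s$ monomials; it is low degree if it computes a polynomial of degree at most $\mathrm{poly}(n)$, and unmixed if each summand is $f_{i1}(x_1)\cdots f_{in}(x_n)$ with $f_{ij}$ univariate in $x_j$ given in sparse representation. A hitting set for a class is a set $\mathcal{H}\subseteq\mathbb{F}^n$ such that each nonzero polynomial in the class is nonzero at some point of $\mathcal{H}$. A generator for a class of $n$-variate polynomials is a polynomial map $\mathcal{G}:\mathbb{F}^q\to\mathbb{F}^n$ with $P(\mathcal{G})\not\equiv0$ for every nonzero $P$ in the class. For each $m$, $\mathcal{L}_m=(\mathcal{L}^1_m,\dots,\mathcal{L}^n_m):\mathbb{F}^q\to\mathbb{F}^n$ is a fixed generator (constructible in polynomial time) for $m$-sparse low-degree $n$-variate polynomials, with individual degrees of each component at most $n-1$ and $q=O(\log_n m)$;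 here $q$ is the one for $m=s^{5k^2+2}$. Fix distinct $c_0,\dots,c_n\in\mathbb{F}$; $W_i(z)$ ($i\in[n]$) is the degree-$n$ polynomial with $W_i(c_j)=1$ for $j\ge i$ and $0$ for $j<i$. Define $\mathcal{S}^i_{0,m}\equiv0$ and for $l\ge1$: $\mathcal{S}^i_{l,m}(\vec{y}_1,\dots,\vec{y}_l,z_1,\dots,z_l):=\mathcal{S}^i_{l-1,m}(\vec{y}_1,\dots,\vec{y}_{l-1},z_1,\dots,z_{l-1})W_i(z_l)+\mathcal{L}^i_m(\vec{y}_l)(1-W_i(z_l))$, with $\vec{y}_j\in\mathbb{F}^q$, $z_j\in\mathbb{F}$, and $\mathcal{S}_{l,m}:=(\mathcal{S}^1_{l,m},\dots,\mathcal{S}^n_{l,m}):\mathbb{F}^{ql+l}\to\mathbb{F}^n$.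
   Formalization: The set U has size max(n^3, n·d)+1, where d = poly(n) bounds the degree of the computed polynomials; this equals n^3+1 when d ≤ n^2. For larger polynomial degree bounds, n^3+1 elements do not suffice in general. *)

theory Defs
  imports
    "HOL-Library.Poly_Mapping"
    "HOL-Library.Monad_Syntax"
    "HOL-Computational_Algebra.Polynomial"
    Complex_Main
begin

section \<open>Multivariate polynomials\<close>

text \<open>Polynomials are finitely supported maps from exponent vectors to coefficients; the
  polynomial variables are numbered from 0, so \<open>\<F>[x_1, ..., x_n]\<close> uses the variables \<open>{..<n}\<close>.\<close>

type_synonym 'a mpoly = "(nat \<Rightarrow>\<^sub>0 nat) \<Rightarrow>\<^sub>0 'a"

definition vars :: "'a::zero mpoly \<Rightarrow> nat set" where
  "vars p = (\<Union>\<mu>\<in>Poly_Mapping.keys p. Poly_Mapping.keys \<mu>)"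

definition num_monomials :: "'a::zero mpoly \<Rightarrow> nat" where
  "num_monomials p = card (Poly_Mapping.keys p)"

definition total_degree :: "'a::zero mpoly \<Rightarrow> nat" where
  "total_degree p = Max (insert 0
     ((\<lambda>\<mu>. \<Sum>i\<in>Poly_Mapping.keys \<mu>. Poly_Mapping.lookup \<mu> i) ` Poly_Mapping.keys p))"

definition degree_in :: "nat \<Rightarrow> 'a::zero mpoly \<Rightarrow> nat" where
  "degree_in i p = Max (insert 0 ((\<lambda>\<mu>. Poly_Mapping.lookup \<mu> i) ` Poly_Mapping.keys p))"

definition peval :: "(nat \<Rightarrow> 'a::comm_ring_1) \<Rightarrow> 'a mpoly \<Rightarrow> 'a" where
  "peval x p = (\<Sum>\<mu>\<in>Poly_Mapping.keys p.
     Poly_Mapping.lookup p \<mu> * (\<Prod>i\<in>Poly_Mapping.keys \<mu>. x i ^ Poly_Mapping.lookup \<mu> i))"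

text \<open>Formal composition: over a finite field \<open>psubst G p = 0\<close> is stronger than vanishing of
  \<open>p \<circ> G\<close> as a function.\<close>

definition psubst :: "(nat \<Rightarrow> 'a::comm_ring_1 mpoly) \<Rightarrow> 'a mpoly \<Rightarrow> 'a mpoly" where
  "psubst G p = (\<Sum>\<mu>\<in>Poly_Mapping.keys p.
     Poly_Mapping.single 0 (Poly_Mapping.lookup p \<mu>) *
       (\<Prod>i\<in>Poly_Mapping.keys \<mu>. G i ^ Poly_Mapping.lookup \<mu> i))"


section \<open>Circuits, hitting sets and generators\<close>

text \<open>A depth-4 circuit lists, for each of its summands, the factors \<open>f_i1, f_i2, ...\<close>, each in
  sparse representation.\<close>

type_synonym 'a circuit = "'a mpoly list list"

definition computed_poly :: "'a::comm_ring_1 circuit \<Rightarrow> 'a mpoly" where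
  "computed_poly \<Phi> = (\<Sum>fs\<leftarrow>\<Phi>. prod_list fs)"

definition SPSP_circuit :: "nat \<Rightarrow> nat \<Rightarrow> 'a::comm_ring_1 circuit \<Rightarrow> bool" where
  "SPSP_circuit k s \<Phi> \<longleftrightarrow> length \<Phi> = k \<and> (\<forall>fs\<in>set \<Phi>. \<forall>f\<in>set fs. num_monomials f \<le> s)"

definition unmixed :: "nat \<Rightarrow> 'a::comm_ring_1 circuit \<Rightarrow> bool" where
  "unmixed n \<Phi> \<longleftrightarrow> (\<forall>fs\<in>set \<Phi>. length fs = n \<and> (\<forall>j<n. vars (fs ! j) \<subseteq> {j}))"

text \<open>As for the class of low-degree circuits, the bound is on the degree of the computed
  polynomial, not on the degrees of the \<open>f_ij\<close>.\<close>

definition unmixed_class :: "nat \<Rightarrow> nat \<Rightarrow> nat \<Rightarrow> nat \<Rightarrow> 'a::comm_ring_1 mpoly set" where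
  "unmixed_class n k s d =
     {computed_poly \<Phi> | \<Phi>. SPSP_circuit k s \<Phi> \<and> unmixed n \<Phi> \<and> total_degree (computed_poly \<Phi>) \<le> d}"

definition sparse_class :: "nat \<Rightarrow> nat \<Rightarrow> nat \<Rightarrow> 'a::zero mpoly set" where
  "sparse_class n m d = {p. vars p \<subseteq> {..<n} \<and> num_monomials p \<le> m \<and> total_degree p \<le> d}"

definition hitting_set :: "nat \<Rightarrow> 'a::comm_ring_1 mpoly set \<Rightarrow> 'a list set \<Rightarrow> bool" where
  "hitting_set n \<C> H \<longleftrightarrow> H \<subseteq> {a. length a = n} \<and> (\<forall>p\<in>\<C>. p \<noteq> 0 \<longrightarrow> (\<exists>a\<in>H. peval ((!) a) p \<noteq> 0))"

definition generator ::
    "nat \<Rightarrow> nat \<Rightarrow> 'a::comm_ring_1 mpoly set \<Rightarrow> (nat \<Rightarrow> 'a mpoly) \<Rightarrow> bool" where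
  "generator q n \<C> G \<longleftrightarrow> (\<forall>i<n. vars (G i) \<subseteq> {..<q}) \<and> (\<forall>p\<in>\<C>. p \<noteq> 0 \<longrightarrow> psubst G p \<noteq> 0)"


section \<open>The generator S and the hitting set\<close>

text \<open>Component \<open>i < n\<close> is component \<open>i + 1\<close> in one-based numbering: \<open>W i\<close> is 1 at
  \<open>c (i + 1), ..., c n\<close> and 0 at \<open>c 0, ..., c i\<close>.\<close>

definition switch_polys :: "nat \<Rightarrow> (nat \<Rightarrow> 'a::field) \<Rightarrow> (nat \<Rightarrow> 'a poly) \<Rightarrow> bool" where
  "switch_polys n c W \<longleftrightarrow>
     (\<forall>i<n. degree (W i) \<le> n \<and> (\<forall>j\<le>n. poly (W i) (c j) = (if i < j then 1 else 0)))"

text \<open>The value of component \<open>i\<close> of \<open>S_l\<close> at the point \<open>(y_1, ..., y_l, z_1, ..., z_l)\<close>; the lists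
  \<open>ys\<close> and \<open>zs\<close> may be longer than \<open>l\<close>, and \<open>y_(l+1)\<close> is \<open>ys ! l\<close>.\<close>

primrec S_gen :: "(nat \<Rightarrow> 'a::field poly) \<Rightarrow> (nat \<Rightarrow> 'a mpoly) \<Rightarrow> nat \<Rightarrow> nat \<Rightarrow>
    'a list list \<Rightarrow> 'a list \<Rightarrow> 'a" where
  "S_gen W L 0 i ys zs = 0"
| "S_gen W L (Suc l) i ys zs =
     S_gen W L l i ys zs * poly (W i) (zs ! l)
     + peval ((!) (ys ! l)) (L i) * (1 - poly (W i) (zs ! l))"

definition tuples :: "'b set \<Rightarrow> nat \<Rightarrow> 'b list set" where
  "tuples A r = {xs. length xs = r \<and> set xs \<subseteq> A}"

definition S_image :: "(nat \<Rightarrow> 'a::field poly) \<Rightarrow> (nat \<Rightarrow> 'a mpoly) \<Rightarrow> nat \<Rightarrow> nat \<Rightarrow> nat \<Rightarrow>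
    'a set \<Rightarrow> 'a list set" where
  "S_image W L n q k U =
     (\<lambda>(ys, zs). map (\<lambda>i. S_gen W L k i ys zs) [0..<n]) ` (tuples (tuples U q) k \<times> tuples U k)"


section \<open>The algorithm and its running time\<close>

text \<open>Programs return their result together with a step count. Following the convention of
  the \<open>time_fun\<close> framework of HOL-Library, every call of a program function costs one step (its
  \<open>tick\<close>), which pays for the boundedly many primitive operations performed in that call:
  field operations and equality tests, arithmetic on natural numbers, list constructors and
  destructors, and requests for one element of a given sequence of field elements.\<close>

datatype 'b timed = Timed (result: 'b) (steps: nat)

definition tick :: "'b \<Rightarrow> 'b timed" where
  "tick x = Timed x 1"

definition bind_t :: "'b timed \<Rightarrow> ('b \<Rightarrow> 'c timed) \<Rightarrow> 'c timed" where
  "bind_t p f = Timed (result (f (result p))) (steps p + steps (f (result p)))"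

adhoc_overloading Monad_Syntax.bind \<rightleftharpoons> bind_t

primrec map_t :: "('b \<Rightarrow> 'c timed) \<Rightarrow> 'b list \<Rightarrow> 'c list timed" where
  "map_t f [] = tick []"
| "map_t f (x # xs) = do { y \<leftarrow> f x; ys \<leftarrow> map_t f xs; tick (y # ys) }"

primrec sum_t :: "('b \<Rightarrow> 'a::field timed) \<Rightarrow> 'b list \<Rightarrow> 'a timed" where
  "sum_t f [] = tick 0"
| "sum_t f (x # xs) = do { a \<leftarrow> f x; b \<leftarrow> sum_t f xs; tick (a + b) }"

primrec prod_t :: "('b \<Rightarrow> 'a::field timed) \<Rightarrow> 'b list \<Rightarrow> 'a timed" where
  "prod_t f [] = tick 1"
| "prod_t f (x # xs) = do { a \<leftarrow> f x; b \<leftarrow> prod_t f xs; tick (a * b) }"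

primrec append_t :: "'b list \<Rightarrow> 'b list \<Rightarrow> 'b list timed" where
  "append_t [] ys = tick ys"
| "append_t (x # xs) ys = do { zs \<leftarrow> append_t xs ys; tick (x # zs) }"

primrec concat_map_t :: "('b \<Rightarrow> 'c list timed) \<Rightarrow> 'b list \<Rightarrow> 'c list timed" where
  "concat_map_t f [] = tick []"
| "concat_map_t f (x # xs) = do { ys \<leftarrow> f x; zs \<leftarrow> concat_map_t f xs; append_t ys zs }"

primrec power_t :: "'b::monoid_mult \<Rightarrow> nat \<Rightarrow> 'b timed" where
  "power_t x 0 = tick 1"
| "power_t x (Suc e) = do { y \<leftarrow> power_t x e; tick (x * y) }"

text \<open>The list \<open>[f i, ..., f (i + r - 1)]\<close>.\<close>

primrec enum_t :: "(nat \<Rightarrow> 'a) \<Rightarrow> nat \<Rightarrow> nat \<Rightarrow> 'a list timed" where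
  "enum_t f i 0 = tick []"
| "enum_t f i (Suc r) = do { xs \<leftarrow> enum_t f (i + 1) r; tick (f i # xs) }"

primrec tuples_t :: "'a list \<Rightarrow> nat \<Rightarrow> 'a list list timed" where
  "tuples_t us 0 = tick [[]]"
| "tuples_t us (Suc q) =
     do { yss \<leftarrow> tuples_t us q; concat_map_t (\<lambda>u. map_t (\<lambda>ys. tick (u # ys)) yss) us }"

text \<open>Polynomials are handed to the algorithm as the list of their nonzero coefficients with the
  corresponding exponent vectors of length \<open>q\<close>.\<close>

type_synonym 'a sparse = "('a \<times> nat list) list"

definition sparse_rep :: "nat \<Rightarrow> 'a::comm_ring_1 sparse \<Rightarrow> 'a mpoly \<Rightarrow> bool" where
  "sparse_rep q t p \<longleftrightarrow>
     distinct (map snd t) \<and> (\<forall>(a, es)\<in>set t. a \<noteq> 0 \<and> length es = q) \<and>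
     p = (\<Sum>(a, es)\<leftarrow>t. Poly_Mapping.single (Poly_Mapping.nth es) a)"

fun monomial_t :: "nat list \<Rightarrow> 'a::field list \<Rightarrow> 'a timed" where
  "monomial_t (e # es) (y # ys) =
     do { a \<leftarrow> power_t y e; b \<leftarrow> monomial_t es ys; tick (a * b) }"
| "monomial_t _ _ = tick 1"

definition sparse_eval_t :: "'a::field sparse \<Rightarrow> 'a list \<Rightarrow> 'a timed" where
  "sparse_eval_t t y = sum_t (\<lambda>(a, es). do { b \<leftarrow> monomial_t es y; tick (a * b) }) t"

text \<open>The value at \<open>z\<close> of the polynomial that is 1 at the nodes \<open>ds\<close> and 0 at the remaining nodes
  of \<open>cs\<close>, by Lagrange interpolation.\<close>

definition switch_t :: "'a::field list \<Rightarrow> 'a list \<Rightarrow> 'a \<Rightarrow> 'a timed" where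
  "switch_t cs ds z =
     sum_t (\<lambda>c. prod_t (\<lambda>c'. tick (if c' = c then 1 else (z - c') / (c - c'))) cs) ds"

text \<open>One step of the recursion defining S, for all components: \<open>vs\<close> is the value of \<open>S_(l-1)\<close>,
  \<open>ts\<close> represents \<open>L\<close>. Component \<open>i\<close> is computed with \<open>ds = [c (i + 1), ..., c n]\<close>.\<close>

fun S_step_t :: "'a::field list \<Rightarrow> 'a list \<Rightarrow> 'a \<Rightarrow> 'a list \<Rightarrow> 'a sparse list \<Rightarrow> 'a list \<Rightarrow>
    'a list timed" where
  "S_step_t cs ds z y (t # ts) (v # vs) =
     do { w \<leftarrow> switch_t cs ds z;
          a \<leftarrow> sparse_eval_t t y;
          r \<leftarrow> S_step_t cs (tl ds) z y ts vs;
          tick ((v * w + a * (1 - w)) # r) }"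
| "S_step_t cs ds z y _ _ = tick []"

text \<open>The values of \<open>S_l\<close> at all points whose \<open>y\<close>-blocks are from \<open>yss\<close> and whose \<open>z\<close>-entries are
  from \<open>us\<close>.\<close>

primrec S_points_t :: "'a::field list \<Rightarrow> 'a sparse list \<Rightarrow> 'a list list \<Rightarrow> 'a list \<Rightarrow> nat \<Rightarrow>
    'a list list timed" where
  "S_points_t cs ts yss us 0 = do { v \<leftarrow> map_t (\<lambda>_. tick 0) ts; tick [v] }"
| "S_points_t cs ts yss us (Suc l) =
     do { vss \<leftarrow> S_points_t cs ts yss us l;
          concat_map_t (\<lambda>vs. concat_map_t (\<lambda>y. map_t (\<lambda>z. S_step_t cs (tl cs) z y ts vs) us) yss) vss }"

text \<open>The size of the set \<open>U\<close> for polynomials of degree at most \<open>d\<close>. It is \<open>n ^ 3 + 1\<close> whenever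
  \<open>d \<le> n ^ 2\<close>. Composing with S multiplies degrees in a single variable by up to \<open>n\<close>, so that
  \<open>n * d + 1\<close> elements are needed for larger \<open>d\<close>.\<close>

definition U_size :: "nat \<Rightarrow> nat \<Rightarrow> nat" where
  "U_size n d = max (n ^ 3) (n * d) + 1"

text \<open>The algorithm. \<open>L_alg m\<close> constructs the components of \<open>L_m\<close> and the number \<open>q\<close> of their
  variables; \<open>u\<close> and \<open>c\<close> provide distinct field elements.\<close>

definition hitting_set_t :: "(nat \<Rightarrow> (nat \<times> 'a::field sparse list) timed) \<Rightarrow> (nat \<Rightarrow> 'a) \<Rightarrow> (nat \<Rightarrow> 'a) \<Rightarrow>
    nat \<Rightarrow> nat \<Rightarrow> nat \<Rightarrow> nat \<Rightarrow> 'a list list timed" where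
  "hitting_set_t L_alg u c n k s d =
     do { m \<leftarrow> power_t s (5 * k ^ 2 + 2);
          (q, ts) \<leftarrow> L_alg m;
          us \<leftarrow> enum_t u 0 (U_size n d);
          cs \<leftarrow> enum_t c 0 (n + 1);
          yss \<leftarrow> tuples_t us q;
          S_points_t cs ts yss us k }"

end

theory Submission
  imports Defs "HOL-Library.FuncSet"
begin

text \<open>Setting the outermost \<open>z\<close> to \<open>c j\<close> feeds the first \<open>j\<close> variables from the generator with
  one layer less and the remaining ones from a fresh copy of L. For \<open>s \<ge> 2\<close> this allows an
  induction on the top fan-in: if \<open>j\<close> is the first position from which on all summands are
  proportional, then suitable coefficients with respect to the variables from \<open>j - 1\<close> on combine to a
  nonzero polynomial of smaller fan-in in the variables before \<open>j - 1\<close>. Evaluating these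
  by induction leaves a univariate polynomial with at most \<open>k s\<close> monomials times
  \<open>s\<close>-sparse univariate factors, all of low degree since their product is, and L hits each
  factor. Position by position the value of a \<open>z\<close> is then moved from a node into \<open>U\<close> by counting
  roots.

  For \<open>s = 1\<close> we have \<open>m = 1\<close>, and L may be constant, so that it does not hit the univariate
  factor. But then the polynomial is a sum of at most \<open>k\<close> monomials. With equal blocks
  \<open>y\<close>, component \<open>i\<close> of S is \<open>L i\<close> at \<open>y\<close> times 1 minus the product of the \<open>W i (z l)\<close>, and two
  of the layers suffice to halve the number of monomials.\<close>

section \<open>Polynomial functions of one variable\<close>

text \<open>Only the computed polynomial has low degree: the \<open>f_ij\<close> may have large
  degrees that cancel in the sum, so their degrees cannot enter a root count. Degree control is put
  on exponent tuples instead: if the combined coefficient of a tuple is nonzero, its entries add up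
  to at most \<open>d\<close>. This survives linear combinations of coefficients in trailing
  variables, and it bounds the degrees of the final univariate factors, whose leading coefficients
  multiply to a nonzero coefficient. The field may be finite, so proportionality is a condition on
  coefficients rather than on values, and roots are counted along one entry at a time. A switch has
  degree at most \<open>n\<close> in \<open>z\<close>, so total degree \<open>d\<close> becomes
  \<open>n * d\<close>; this is the origin of \<open>n * d < card U\<close>. The same bound serves
  the blocks \<open>y\<close>, as components of L have individual degrees at most
  \<open>n - 1\<close>. The nodes \<open>c j\<close> may lie outside \<open>U\<close>; they certify
  that a polynomial in \<open>z\<close> is nonzero.\<close>

definition poly_fun :: "nat \<Rightarrow> ('a::field \<Rightarrow> 'a) \<Rightarrow> bool" where
  "poly_fun D f \<longleftrightarrow> (\<exists>p. degree p \<le> D \<and> (\<forall>t. f t = poly p t))"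

lemma poly_fun_poly: "degree p \<le> D \<Longrightarrow> poly_fun D (poly p)"
  by (auto simp: poly_fun_def)

lemma poly_fun_mono: "poly_fun D f \<Longrightarrow> D \<le> E \<Longrightarrow> poly_fun E f"
  by (auto simp: poly_fun_def intro: order_trans)

lemma poly_fun_const: "poly_fun D (\<lambda>_. a)"
  unfolding poly_fun_def by (intro exI[of _ "[:a:]"]) auto

lemma poly_fun_add: "poly_fun D f \<Longrightarrow> poly_fun D g \<Longrightarrow> poly_fun D (\<lambda>t. f t + g t)"
  unfolding poly_fun_def by (metis degree_add_le poly_add)

lemma poly_fun_diff: "poly_fun D f \<Longrightarrow> poly_fun D g \<Longrightarrow> poly_fun D (\<lambda>t. f t - g t)"
  unfolding poly_fun_def by (metis degree_diff_le poly_diff)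

lemma poly_fun_mult: "poly_fun D f \<Longrightarrow> poly_fun E g \<Longrightarrow> poly_fun (D + E) (\<lambda>t. f t * g t)"
  unfolding poly_fun_def by (metis degree_mult_le poly_mult add_mono order_trans)

lemma poly_fun_cmult: "poly_fun D f \<Longrightarrow> poly_fun D (\<lambda>t. a * f t)"
  using poly_fun_mult[OF poly_fun_const[of 0 a]] by simp

lemma poly_fun_power: "poly_fun D f \<Longrightarrow> poly_fun (D * e) (\<lambda>t. f t ^ e)"
  by (induction e) (auto intro: poly_fun_const poly_fun_mult)

lemma poly_fun_sum: "(\<And>i. i \<in> I \<Longrightarrow> poly_fun D (f i)) \<Longrightarrow> poly_fun D (\<lambda>t. \<Sum>i\<in>I. f i t)"
  by (induction I rule: infinite_finite_induct) (auto intro: poly_fun_const poly_fun_add)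

lemma poly_fun_prod:
  "(\<And>i. i \<in> I \<Longrightarrow> poly_fun (D i) (f i)) \<Longrightarrow> poly_fun (\<Sum>i\<in>I. D i) (\<lambda>t. \<Prod>i\<in>I. f i t)"
  by (induction I rule: infinite_finite_induct) (auto intro: poly_fun_const poly_fun_mult)

lemma poly_fun_monomial:
  assumes "\<And>i. i \<in> I \<Longrightarrow> poly_fun n (x i)" "(\<Sum>i\<in>I. e i) \<le> d"
  shows "poly_fun (n * d) (\<lambda>t. \<Prod>i\<in>I. x i t ^ e i)"
proof (rule poly_fun_mono)
  show "poly_fun (\<Sum>i\<in>I. n * e i) (\<lambda>t. \<Prod>i\<in>I. x i t ^ e i)"
    by (rule poly_fun_prod) (auto intro: poly_fun_power assms)
  show "(\<Sum>i\<in>I. n * e i) \<le> n * d"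
    using assms(2) by (simp flip: sum_distrib_left)
qed

lemma poly_nonzero_point:
  fixes p :: "'a::field poly"
  assumes "p \<noteq> 0" "finite U" "degree p < card U"
  obtains t where "t \<in> U" "poly p t \<noteq> 0"
proof -
  have "\<not> U \<subseteq> {t. poly p t = 0}"
    using card_mono[OF poly_roots_finite, of p U] card_poly_roots_bound[of p] assms by linarith
  then show thesis using that by blast
qed

text \<open>Over a small field the representing polynomial is not determined by \<open>f\<close>,
  but any representative is nonzero once \<open>f\<close> has a nonzero value. The point
  \<open>a\<close> may lie outside \<open>U\<close>; in applications it is a node.\<close>

lemma poly_fun_nonzero:
  assumes "poly_fun D f" "f a \<noteq> 0" "finite U" "D < card U"
  obtains t where "t \<in> U" "f t \<noteq> 0"
proof -
  obtain p where p: "degree p \<le> D" "\<And>t. f t = poly p t"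
    using assms(1) by (auto simp: poly_fun_def)
  have "p \<noteq> 0" using p assms(2) by auto
  then obtain t where "t \<in> U" "poly p t \<noteq> 0"
    using poly_nonzero_point[of p U] p(1) assms(3,4) by auto
  then show thesis using that p(2) by simp
qed

text \<open>The two witnesses may be different points: the representing polynomials are nonzero, so
  their product is, and the roots of the product are counted.\<close>

lemma poly_fun_nonzero2:
  assumes "poly_fun D f" "f a \<noteq> 0" "poly_fun E g" "g b \<noteq> 0" "finite U" "D + E < card U"
  obtains t where "t \<in> U" "f t \<noteq> 0" "g t \<noteq> 0"
proof -
  obtain p where p: "degree p \<le> D" "\<And>t. f t = poly p t"
    using assms(1) by (auto simp: poly_fun_def)
  obtain r where r: "degree r \<le> E" "\<And>t. g t = poly r t"
    using assms(3) by (auto simp: poly_fun_def)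
  have "p * r \<noteq> 0" using p r assms(2,4) by auto
  moreover have "degree (p * r) \<le> D + E" using degree_mult_le[of p r] p(1) r(1) by linarith
  ultimately obtain t where "t \<in> U" "poly (p * r) t \<noteq> 0"
    using poly_nonzero_point[of "p * r" U] assms(5,6) by auto
  then show thesis using that p(2) r(2) by auto
qed

text \<open>Entries are moved into \<open>U\<close> one by one, the heads of both witnesses being
  replaced by a common \<open>t\<close>. Later restrictions mix entries from \<open>U\<close> with
  entries of a witness, hence the degree bounds for arbitrary surrounding lists.\<close>

lemma list_fun_nonzero2:
  fixes f g :: "'a::field list \<Rightarrow> 'a"
  assumes "\<And>xs ys. length xs + length ys < N \<Longrightarrow> poly_fun D (\<lambda>t. f (xs @ t # ys))"
    and "\<And>xs ys. length xs + length ys < N \<Longrightarrow> poly_fun E (\<lambda>t. g (xs @ t # ys))"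
    and "f xs \<noteq> 0" "length xs = N" "g ys \<noteq> 0" "length ys = N" "finite U" "D + E < card U"
  shows "\<exists>zs. length zs = N \<and> set zs \<subseteq> U \<and> f zs \<noteq> 0 \<and> g zs \<noteq> 0"
  using assms
proof (induction N arbitrary: f g xs ys)
  case 0
  then show ?case by auto
next
  case (Suc N)
  obtain a xs' where xs: "xs = a # xs'" "length xs' = N" using Suc.prems(4) by (cases xs) auto
  obtain b ys' where ys: "ys = b # ys'" "length ys' = N" using Suc.prems(6) by (cases ys) auto
  obtain t where t: "t \<in> U" "f (t # xs') \<noteq> 0" "g (t # ys') \<noteq> 0"
    using poly_fun_nonzero2[of D "\<lambda>t. f (t # xs')" a E "\<lambda>t. g (t # ys')" b U]
      Suc.prems(1)[of "[]" xs'] Suc.prems(2)[of "[]" ys'] Suc.prems(3,5,7,8) xs ys by auto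
  have "\<exists>zs. length zs = N \<and> set zs \<subseteq> U \<and> f (t # zs) \<noteq> 0 \<and> g (t # zs) \<noteq> 0"
  proof (rule Suc.IH[where f = "\<lambda>zs. f (t # zs)" and g = "\<lambda>zs. g (t # zs)" and xs = xs' and ys = ys'])
    fix us vs :: "'a list" assume "length us + length vs < N"
    then show "poly_fun D (\<lambda>r. f (t # us @ r # vs))" "poly_fun E (\<lambda>r. g (t # us @ r # vs))"
      using Suc.prems(1)[of "t # us" vs] Suc.prems(2)[of "t # us" vs] by auto
  qed (use t xs ys Suc.prems in auto)
  then obtain zs where "length zs = N" "set zs \<subseteq> U" "f (t # zs) \<noteq> 0" "g (t # zs) \<noteq> 0" by blast
  then show ?case using t by (intro exI[of _ "t # zs"]) auto
qed


section \<open>Multivariate polynomials\<close>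

lemma peval_superset:
  assumes "finite A" "Poly_Mapping.keys p \<subseteq> A"
  shows "peval x p = (\<Sum>\<mu>\<in>A. Poly_Mapping.lookup p \<mu> *
    (\<Prod>i\<in>Poly_Mapping.keys \<mu>. x i ^ Poly_Mapping.lookup \<mu> i))"
  unfolding peval_def using assms
  by (intro sum.mono_neutral_left) (auto simp: not_in_keys_iff_lookup_eq_zero)

lemma peval_add: "peval x (p + r) = peval x p + peval x r"
proof -
  let ?A = "Poly_Mapping.keys p \<union> Poly_Mapping.keys r"
  have "Poly_Mapping.keys (p + r) \<subseteq> ?A" by (rule keys_add)
  then show ?thesis
    using peval_superset[of ?A p x] peval_superset[of ?A r x] peval_superset[of ?A "p + r" x]
    by (simp add: lookup_add distrib_right sum.distrib)
qed

lemma peval_0 [simp]: "peval x 0 = 0"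
  by (simp add: peval_def)

lemma peval_sum: "peval x (\<Sum>i\<in>I. f i) = (\<Sum>i\<in>I. peval x (f i))"
  by (induction I rule: infinite_finite_induct) (auto simp: peval_add)

lemma monomial_superset:
  fixes x :: "nat \<Rightarrow> 'a::comm_semiring_1"
  assumes "finite A" "Poly_Mapping.keys \<mu> \<subseteq> A"
  shows "(\<Prod>i\<in>Poly_Mapping.keys \<mu>. x i ^ Poly_Mapping.lookup \<mu> i)
    = (\<Prod>i\<in>A. x i ^ Poly_Mapping.lookup \<mu> i)"
  using assms by (intro prod.mono_neutral_left) (auto simp: not_in_keys_iff_lookup_eq_zero)

lemma monomial_add:
  fixes x :: "nat \<Rightarrow> 'a::comm_semiring_1"
  shows "(\<Prod>i\<in>Poly_Mapping.keys (\<mu> + \<nu>). x i ^ Poly_Mapping.lookup (\<mu> + \<nu>) i)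
    = (\<Prod>i\<in>Poly_Mapping.keys \<mu>. x i ^ Poly_Mapping.lookup \<mu> i) *
      (\<Prod>i\<in>Poly_Mapping.keys \<nu>. x i ^ Poly_Mapping.lookup \<nu> i)"
proof -
  let ?A = "Poly_Mapping.keys \<mu> \<union> Poly_Mapping.keys \<nu>"
  have "Poly_Mapping.keys (\<mu> + \<nu>) \<subseteq> ?A" by (rule keys_add)
  then show ?thesis
    by (subst (1 2 3) monomial_superset[of ?A]) (auto simp: lookup_add power_add prod.distrib)
qed

lemma peval_single:
  "peval x (Poly_Mapping.single \<mu> a)
    = a * (\<Prod>i\<in>Poly_Mapping.keys \<mu>. x i ^ Poly_Mapping.lookup \<mu> i)"
  by (simp add: peval_def)

lemma sum_single_lookup:
  assumes "finite A" "Poly_Mapping.keys p \<subseteq> A"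
  shows "(\<Sum>\<mu>\<in>A. Poly_Mapping.single \<mu> (Poly_Mapping.lookup p \<mu>)) = p"
proof (rule poly_mapping_eqI)
  fix \<nu>
  show "Poly_Mapping.lookup (\<Sum>\<mu>\<in>A. Poly_Mapping.single \<mu> (Poly_Mapping.lookup p \<mu>)) \<nu>
    = Poly_Mapping.lookup p \<nu>"
    using assms by (auto simp: lookup_sum lookup_single when_def sum.delta in_keys_iff)
qed

lemma peval_mult: "peval x (p * r) = peval x p * peval x r"
proof -
  have "p * r = (\<Sum>\<mu>\<in>Poly_Mapping.keys p. Poly_Mapping.single \<mu> (Poly_Mapping.lookup p \<mu>)) *
      (\<Sum>\<mu>\<in>Poly_Mapping.keys r. Poly_Mapping.single \<mu> (Poly_Mapping.lookup r \<mu>))"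
    by (simp add: sum_single_lookup)
  then have "peval x (p * r) = (\<Sum>\<mu>\<in>Poly_Mapping.keys p. \<Sum>\<nu>\<in>Poly_Mapping.keys r. peval x
      (Poly_Mapping.single (\<mu> + \<nu>) (Poly_Mapping.lookup p \<mu> * Poly_Mapping.lookup r \<nu>)))"
    by (simp add: sum_product peval_sum mult_single)
  then show ?thesis
    unfolding peval_def[of x p] peval_def[of x r] sum_product
    by (simp add: peval_single monomial_add mult_ac)
qed

lemma peval_1 [simp]: "peval x 1 = 1"
  using peval_single[of x 0 1] by simp

lemma peval_power: "peval x (p ^ e) = peval x p ^ e"
  by (induction e) (auto simp: peval_mult)

lemma peval_prod: "peval x (\<Prod>i\<in>I. f i) = (\<Prod>i\<in>I. peval x (f i))"
  by (induction I rule: infinite_finite_induct) (auto simp: peval_mult)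

lemma peval_sum_list: "peval x (sum_list ps) = sum_list (map (peval x) ps)"
  by (induction ps) (auto simp: peval_add)

section \<open>Degrees and variables of sums, products and powers\<close>

lemma degree_in_le_iff: "degree_in v p \<le> D \<longleftrightarrow> (\<forall>\<mu>\<in>Poly_Mapping.keys p. Poly_Mapping.lookup \<mu> v \<le> D)"
  unfolding degree_in_def by (subst Max_le_iff) auto

lemma degree_in_mult: "degree_in v p \<le> D \<Longrightarrow> degree_in v r \<le> E \<Longrightarrow> degree_in v (p * r) \<le> D + E"
  unfolding degree_in_le_iff using keys_mult[of p r] by (fastforce simp: lookup_add intro: add_mono)

lemma degree_in_single_0: "degree_in v (Poly_Mapping.single 0 a) \<le> D"
  unfolding degree_in_le_iff by auto

lemma degree_in_1 [simp]: "degree_in v (1::'a::zero_neq_one mpoly) = 0"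
  using degree_in_le_iff[of v "1::'a mpoly" 0] by auto

lemma degree_in_power:
  fixes p :: "'a::comm_semiring_1 mpoly"
  shows "degree_in v p \<le> D \<Longrightarrow> degree_in v (p ^ e) \<le> D * e"
  by (induction e) (auto intro: degree_in_mult)

lemma degree_in_prod:
  fixes f :: "'i \<Rightarrow> 'a::comm_semiring_1 mpoly"
  shows "(\<And>i. i \<in> I \<Longrightarrow> degree_in v (f i) \<le> D i) \<Longrightarrow> degree_in v (\<Prod>i\<in>I. f i) \<le> (\<Sum>i\<in>I. D i)"
  by (induction I rule: infinite_finite_induct) (auto intro: degree_in_mult)

lemma keys_sum_subset: "Poly_Mapping.keys (\<Sum>i\<in>I. f i) \<subseteq> (\<Union>i\<in>I. Poly_Mapping.keys (f i))"
proof (induction I rule: infinite_finite_induct)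
  case (insert i I)
  then show ?case using keys_add[of "f i" "\<Sum>i\<in>I. f i"] by auto
qed auto

lemma degree_in_sum:
  "(\<And>i. i \<in> I \<Longrightarrow> degree_in v (f i) \<le> D) \<Longrightarrow> degree_in v (\<Sum>i\<in>I. f i) \<le> D"
  using keys_sum_subset[of f I] unfolding degree_in_le_iff by blast

lemma total_degree_le_iff: "total_degree p \<le> d \<longleftrightarrow>
  (\<forall>\<mu>\<in>Poly_Mapping.keys p. (\<Sum>i\<in>Poly_Mapping.keys \<mu>. Poly_Mapping.lookup \<mu> i) \<le> d)"
  unfolding total_degree_def by (subst Max_le_iff) auto

lemma vars_mult: "vars (p * r) \<subseteq> vars p \<union> vars r"
proof
  fix i assume "i \<in> vars (p * r)"
  then obtain \<mu> where \<mu>: "\<mu> \<in> Poly_Mapping.keys (p * r)" "i \<in> Poly_Mapping.keys \<mu>"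
    by (auto simp: vars_def)
  then obtain a b where "\<mu> = a + b" "a \<in> Poly_Mapping.keys p" "b \<in> Poly_Mapping.keys r"
    using keys_mult[of p r] by blast
  then show "i \<in> vars p \<union> vars r"
    using \<mu>(2) keys_add[of a b] by (auto simp: vars_def)
qed

lemma vars_1 [simp]: "vars (1::'a::zero_neq_one mpoly) = {}"
  by (simp add: vars_def)

lemma vars_single_0 [simp]: "vars (Poly_Mapping.single 0 a) = {}"
  by (simp add: vars_def)

lemma vars_power:
  fixes p :: "'a::comm_semiring_1 mpoly"
  shows "vars (p ^ e) \<subseteq> vars p"
  by (induction e) (use vars_mult in auto)

lemma vars_prod:
  fixes f :: "'i \<Rightarrow> 'a::comm_semiring_1 mpoly"
  shows "vars (\<Prod>i\<in>I. f i) \<subseteq> (\<Union>i\<in>I. vars (f i))"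
proof (induction I rule: infinite_finite_induct)
  case (insert i I)
  then show ?case using vars_mult[of "f i" "\<Prod>i\<in>I. f i"] by auto
qed auto

lemma vars_sum: "vars (\<Sum>i\<in>I. f i) \<subseteq> (\<Union>i\<in>I. vars (f i))"
  using keys_sum_subset[of f I] unfolding vars_def by blast

text \<open>Induction on the number of variables: the terms sharing the exponent of
  \<open>\<kappa>0\<close> in the last variable form one coefficient with respect to it, and the
  induction hypothesis fixes the other entries so that this coefficient survives. Injectivity says
  that different indices carry different monomials.\<close>

lemma exponents_nonzero_point:
  fixes a :: "'k \<Rightarrow> 'a::field" and e :: "'k \<Rightarrow> nat \<Rightarrow> nat"
  assumes "finite K" "inj_on (\<lambda>\<kappa>. restrict (e \<kappa>) {..<q}) K" "\<kappa>0 \<in> K" "a \<kappa>0 \<noteq> 0"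
    and "\<And>\<kappa> i. \<kappa> \<in> K \<Longrightarrow> i < q \<Longrightarrow> e \<kappa> i \<le> D" and "finite U" "D < card U"
  shows "\<exists>y\<in>tuples U q. (\<Sum>\<kappa>\<in>K. a \<kappa> * (\<Prod>i<q. y ! i ^ e \<kappa> i)) \<noteq> 0"
  using assms(1-5)
proof (induction q arbitrary: K)
  case 0
  have "K = {\<kappa>0}"
    using 0 by (auto simp: inj_on_def)
  then show ?case using 0 by (auto simp: tuples_def)
next
  case (Suc q)
  define K' where "K' = {\<kappa>\<in>K. e \<kappa> q = e \<kappa>0 q}"
  have "\<exists>y\<in>tuples U q. (\<Sum>\<kappa>\<in>K'. a \<kappa> * (\<Prod>i<q. y ! i ^ e \<kappa> i)) \<noteq> 0"
  proof (rule Suc.IH)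
    show "inj_on (\<lambda>\<kappa>. restrict (e \<kappa>) {..<q}) K'"
    proof (rule inj_onI)
      fix \<kappa> \<eta> assume *: "\<kappa> \<in> K'" "\<eta> \<in> K'" and eq: "restrict (e \<kappa>) {..<q} = restrict (e \<eta>) {..<q}"
      have "restrict (e \<kappa>) {..<Suc q} = restrict (e \<eta>) {..<Suc q}"
      proof
        fix i
        show "restrict (e \<kappa>) {..<Suc q} i = restrict (e \<eta>) {..<Suc q} i"
          using fun_cong[OF eq, of i] * by (auto simp: restrict_def K'_def less_Suc_eq split: if_splits)
      qed
      then show "\<kappa> = \<eta>" using inj_onD[OF Suc.prems(2), of \<kappa> \<eta>] * by (simp add: K'_def)
    qed
  qed (use Suc.prems in \<open>auto simp: K'_def\<close>)
  then obtain y where y: "y \<in> tuples U q" "(\<Sum>\<kappa>\<in>K'. a \<kappa> * (\<Prod>i<q. y ! i ^ e \<kappa> i)) \<noteq> 0" by blast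
  have len: "length y = q" using y(1) by (simp add: tuples_def)
  define p where "p = (\<Sum>\<kappa>\<in>K. monom (a \<kappa> * (\<Prod>i<q. y ! i ^ e \<kappa> i)) (e \<kappa> q))"
  have "coeff p (e \<kappa>0 q) = (\<Sum>\<kappa>\<in>K'. a \<kappa> * (\<Prod>i<q. y ! i ^ e \<kappa> i))"
    unfolding p_def coeff_sum K'_def coeff_monom using Suc.prems(1)
    by (subst sum.inter_filter) (auto intro: sum.cong)
  then have "p \<noteq> 0" using y(2) by auto
  have "degree p \<le> D"
    unfolding p_def using Suc.prems(1,5)
    by (intro degree_sum_le) (auto intro: order_trans[OF degree_monom_le])
  then obtain t where t: "t \<in> U" "poly p t \<noteq> 0"
    using poly_nonzero_point[OF \<open>p \<noteq> 0\<close> assms(6)] assms(7) by auto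
  have "poly p t = (\<Sum>\<kappa>\<in>K. a \<kappa> * (\<Prod>i<Suc q. (y @ [t]) ! i ^ e \<kappa> i))"
    unfolding p_def poly_sum poly_monom using len by (simp add: nth_append mult.assoc)
  then show ?case
    using t y(1) by (intro bexI[of _ "y @ [t]"]) (auto simp: tuples_def)
qed

lemma mpoly_nonzero_point:
  fixes p :: "'a::field mpoly"
  assumes "p \<noteq> 0" "vars p \<subseteq> {..<q}" "\<And>v. v < q \<Longrightarrow> degree_in v p \<le> D" "finite U" "D < card U"
  shows "\<exists>y\<in>tuples U q. peval ((!) y) p \<noteq> 0"
proof -
  obtain \<mu> where \<mu>: "\<mu> \<in> Poly_Mapping.keys p" using assms(1) by (metis all_not_in_conv keys_eq_empty)
  have keys: "Poly_Mapping.keys \<nu> \<subseteq> {..<q}" if "\<nu> \<in> Poly_Mapping.keys p" for \<nu>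
    using assms(2) that by (auto simp: vars_def)
  have "\<exists>y\<in>tuples U q. (\<Sum>\<nu>\<in>Poly_Mapping.keys p. Poly_Mapping.lookup p \<nu> *
      (\<Prod>i<q. y ! i ^ Poly_Mapping.lookup \<nu> i)) \<noteq> 0"
  proof (rule exponents_nonzero_point)
    show "inj_on (\<lambda>\<nu>. restrict (Poly_Mapping.lookup \<nu>) {..<q}) (Poly_Mapping.keys p)"
    proof (rule inj_onI)
      fix \<nu> \<rho> assume *: "\<nu> \<in> Poly_Mapping.keys p" "\<rho> \<in> Poly_Mapping.keys p"
        and eq: "restrict (Poly_Mapping.lookup \<nu>) {..<q} = restrict (Poly_Mapping.lookup \<rho>) {..<q}"
      show "\<nu> = \<rho>"
      proof (rule poly_mapping_eqI)
        fix i
        show "Poly_Mapping.lookup \<nu> i = Poly_Mapping.lookup \<rho> i"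
        proof (cases "i < q")
          case True
          then show ?thesis using fun_cong[OF eq, of i] by simp
        next
          case False
          then have "i \<notin> Poly_Mapping.keys \<nu>" "i \<notin> Poly_Mapping.keys \<rho>" using keys * by blast+
          then show ?thesis by (simp add: in_keys_iff)
        qed
      qed
    qed
  qed (use \<mu> assms in \<open>auto simp: in_keys_iff degree_in_le_iff\<close>)
  then show ?thesis
    unfolding peval_def by (simp add: monomial_superset[OF finite_lessThan[of q] keys])
qed

section \<open>Univariate polynomials as elements of the multivariate ring\<close>

definition embed_poly :: "nat \<Rightarrow> 'a::zero poly \<Rightarrow> 'a mpoly" where
  "embed_poly t g = Abs_poly_mapping (\<lambda>\<mu>. if Poly_Mapping.keys \<mu> \<subseteq> {t} then coeff g (Poly_Mapping.lookup \<mu> t) else 0)"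

lemma keys_subset_singleton:
  fixes \<mu> :: "'b \<Rightarrow>\<^sub>0 'c::zero"
  shows "Poly_Mapping.keys \<mu> \<subseteq> {t} \<longleftrightarrow> (\<exists>e. \<mu> = Poly_Mapping.single t e)"
proof
  assume *: "Poly_Mapping.keys \<mu> \<subseteq> {t}"
  have "\<mu> = Poly_Mapping.single t (Poly_Mapping.lookup \<mu> t)"
    using * by (intro poly_mapping_eqI) (auto simp: lookup_single when_def in_keys_iff)
  then show "\<exists>e. \<mu> = Poly_Mapping.single t e" by blast
qed (auto split: if_splits)

lemma single_eq_single_iff: "Poly_Mapping.single t e = Poly_Mapping.single t e' \<longleftrightarrow> e = e'"
  by (metis lookup_single_eq)

lemma lookup_embed_poly: "Poly_Mapping.lookup (embed_poly t g) \<mu>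
    = (if Poly_Mapping.keys \<mu> \<subseteq> {t} then coeff g (Poly_Mapping.lookup \<mu> t) else 0)"
proof -
  have "finite {\<mu>. (if Poly_Mapping.keys \<mu> \<subseteq> {t} then coeff g (Poly_Mapping.lookup \<mu> t) else 0) \<noteq> 0}"
  proof (rule finite_subset)
    show "{\<mu>. (if Poly_Mapping.keys \<mu> \<subseteq> {t} then coeff g (Poly_Mapping.lookup \<mu> t) else 0) \<noteq> 0}
      \<subseteq> Poly_Mapping.single t ` {..degree g}"
      by (auto simp: keys_subset_singleton le_degree split: if_splits)
  qed auto
  then show ?thesis unfolding embed_poly_def by (subst lookup_Abs_poly_mapping) auto
qed

lemma keys_embed_poly: "Poly_Mapping.keys (embed_poly t g) = Poly_Mapping.single t ` {e. coeff g e \<noteq> 0}"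
proof -
  have "\<mu> \<in> Poly_Mapping.keys (embed_poly t g) \<longleftrightarrow> \<mu> \<in> Poly_Mapping.single t ` {e. coeff g e \<noteq> 0}" for \<mu>
    unfolding in_keys_iff lookup_embed_poly
  proof (cases "Poly_Mapping.keys \<mu> \<subseteq> {t}")
    case True
    then obtain e where "\<mu> = Poly_Mapping.single t e" by (auto simp: keys_subset_singleton)
    then show "((if Poly_Mapping.keys \<mu> \<subseteq> {t} then coeff g (Poly_Mapping.lookup \<mu> t) else 0) \<noteq> 0)
      \<longleftrightarrow> \<mu> \<in> Poly_Mapping.single t ` {e. coeff g e \<noteq> 0}"
      by (auto simp del: keys_single simp: single_eq_single_iff keys_subset_singleton)
  qed (auto simp del: keys_single simp: keys_subset_singleton)
  then show ?thesis by blast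
qed

lemma inj_on_single: "inj_on (Poly_Mapping.single t) A"
  by (auto simp: inj_on_def single_eq_single_iff)

lemma embed_poly_in_sparse_class:
  assumes "t < n" "card {e. coeff g e \<noteq> 0} \<le> m" "degree g \<le> d"
  shows "embed_poly t g \<in> sparse_class n m d"
proof -
  have "(\<Sum>i\<in>Poly_Mapping.keys (Poly_Mapping.single t e). Poly_Mapping.lookup (Poly_Mapping.single t e) i) \<le> d"
    if "coeff g e \<noteq> 0" for e
    using le_degree[OF that] assms(3) by simp
  then show ?thesis
    using assms(1,2) unfolding sparse_class_def total_degree_le_iff num_monomials_def vars_def
    by (auto simp: keys_embed_poly card_image[OF inj_on_single] split: if_splits)
qed

lemma embed_poly_eq_0_iff: "embed_poly t g = 0 \<longleftrightarrow> g = 0"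
proof -
  have "embed_poly t g = 0 \<longleftrightarrow> Poly_Mapping.keys (embed_poly t g) = {}" by simp
  also have "\<dots> \<longleftrightarrow> g = 0" unfolding keys_embed_poly by (auto simp: poly_eq_iff)
  finally show ?thesis .
qed

lemma psubst_embed_poly:
  "psubst G (embed_poly t g) = (\<Sum>e\<in>{e. coeff g e \<noteq> 0}. Poly_Mapping.single 0 (coeff g e) * G t ^ e)"
proof -
  have "psubst G (embed_poly t g) = (\<Sum>e\<in>{e. coeff g e \<noteq> 0}. Poly_Mapping.single 0 (coeff g e) *
      (\<Prod>i\<in>Poly_Mapping.keys (Poly_Mapping.single t e). G i ^ Poly_Mapping.lookup (Poly_Mapping.single t e) i))"
    unfolding psubst_def keys_embed_poly
    by (subst sum.reindex[OF inj_on_single]) (auto simp: lookup_embed_poly intro!: sum.cong split: if_splits)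
  then show ?thesis by (auto intro!: sum.cong)
qed

lemma peval_psubst_embed_poly:
  fixes g :: "'a::comm_ring_1 poly"
  shows "peval y (psubst G (embed_poly t g)) = poly g (peval y (G t))"
proof -
  have "{e. coeff g e \<noteq> 0} \<subseteq> {..degree g}" by (auto simp: le_degree)
  then have "(\<Sum>e\<in>{e. coeff g e \<noteq> 0}. coeff g e * peval y (G t) ^ e)
    = (\<Sum>e\<le>degree g. coeff g e * peval y (G t) ^ e)"
    by (intro sum.mono_neutral_left) auto
  then show ?thesis
    by (simp add: psubst_embed_poly peval_sum peval_mult peval_power peval_single poly_altdef)
qed

lemma degree_in_psubst_embed_poly:
  fixes g :: "'a::comm_ring_1 poly"
  assumes "degree_in v (G t) \<le> D"
  shows "degree_in v (psubst G (embed_poly t g)) \<le> D * degree g"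
  unfolding psubst_embed_poly
proof (rule degree_in_sum)
  fix e assume "e \<in> {e. coeff g e \<noteq> 0}"
  then have "D * e \<le> D * degree g" by (auto simp: le_degree)
  then show "degree_in v (Poly_Mapping.single 0 (coeff g e) * G t ^ e) \<le> D * degree g"
    using degree_in_mult[OF degree_in_single_0[of v _ 0] degree_in_power[OF assms]]
    by (metis add_0 order_trans)
qed

lemma vars_psubst_embed_poly: "vars (psubst G (embed_poly t g)) \<subseteq> vars (G t)"
proof -
  have "vars (Poly_Mapping.single 0 (coeff g e) * G t ^ e) \<subseteq> vars (G t)" for e
    using vars_mult[of "Poly_Mapping.single 0 (coeff g e)" "G t ^ e"] vars_power[of "G t" e] by auto
  then show ?thesis
    unfolding psubst_embed_poly
    using vars_sum[of "\<lambda>e. Poly_Mapping.single 0 (coeff g e) * G t ^ e" "{e. coeff g e \<noteq> 0}"] by blast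
qed

text \<open>The product need not be sparse, so the generator is applied to each factor separately.
  The formal compositions are nonzero, and so is their product, as there are no zero divisors; one
  grid point \<open>y\<close> then serves all factors.\<close>

lemma generator_hits_product:
  fixes L :: "nat \<Rightarrow> 'a::field mpoly" and g :: "nat \<Rightarrow> 'a poly"
  assumes gen: "generator q n (sparse_class n m d) L"
    and L_degree: "\<And>i t. i < n \<Longrightarrow> t < q \<Longrightarrow> degree_in t (L i) \<le> D"
    and T: "T \<subseteq> {..<n}" "\<And>t. t \<in> T \<Longrightarrow> g t \<noteq> 0" "\<And>t. t \<in> T \<Longrightarrow> card {e. coeff (g t) e \<noteq> 0} \<le> m"
      "\<And>t. t \<in> T \<Longrightarrow> degree (g t) \<le> d"
    and U: "finite U" "D * (\<Sum>t\<in>T. degree (g t)) < card U"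
  shows "\<exists>y\<in>tuples U q. \<forall>t\<in>T. poly (g t) (peval ((!) y) (L t)) \<noteq> 0"
proof -
  have fin: "finite T" using T(1) finite_subset by blast
  let ?p = "\<Prod>t\<in>T. psubst L (embed_poly t (g t))"
  have "psubst L (embed_poly t (g t)) \<noteq> 0" if "t \<in> T" for t
    using gen embed_poly_in_sparse_class[of t n "g t" m d] T that
    by (auto simp: generator_def embed_poly_eq_0_iff)
  then have nz: "?p \<noteq> 0" using fin by simp
  have "vars ?p \<subseteq> {..<q}"
    using vars_prod[of "\<lambda>t. psubst L (embed_poly t (g t))" T] vars_psubst_embed_poly gen T(1)
    unfolding generator_def by blast
  moreover have "degree_in v ?p \<le> D * (\<Sum>t\<in>T. degree (g t))" if "v < q" for v
    unfolding sum_distrib_left using T(1) that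
    by (intro degree_in_prod degree_in_psubst_embed_poly L_degree) auto
  ultimately obtain y where "y \<in> tuples U q" "peval ((!) y) ?p \<noteq> 0"
    using mpoly_nonzero_point[OF nz] U by blast
  then show ?thesis using fin by (auto simp: peval_prod peval_psubst_embed_poly)
qed

section \<open>Sums of products of univariate polynomials\<close>

lemma poly_as_sum:
  fixes p :: "'a::comm_ring_1 poly"
  assumes "degree p \<le> N"
  shows "poly p x = (\<Sum>e\<le>N. coeff p e * x ^ e)"
  unfolding poly_altdef using assms
  by (intro sum.mono_neutral_left) (auto simp: coeff_eq_0)

lemma prod_poly_expand:
  fixes f :: "nat \<Rightarrow> 'a::comm_ring_1 poly"
  assumes "finite T" "\<And>t. t \<in> T \<Longrightarrow> degree (f t) \<le> N"
  shows "(\<Prod>t\<in>T. poly (f t) (x t)) =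
    (\<Sum>\<kappa>\<in>PiE T (\<lambda>_. {..N}). (\<Prod>t\<in>T. coeff (f t) (\<kappa> t)) * (\<Prod>t\<in>T. x t ^ \<kappa> t))"
proof -
  have "(\<Prod>t\<in>T. poly (f t) (x t)) = (\<Prod>t\<in>T. \<Sum>e\<le>N. coeff (f t) e * x t ^ e)"
    using assms(2) by (intro prod.cong refl) (simp add: poly_as_sum)
  also have "\<dots> = (\<Sum>\<kappa>\<in>PiE T (\<lambda>_. {..N}). \<Prod>t\<in>T. coeff (f t) (\<kappa> t) * x t ^ \<kappa> t)"
    using assms(1) by (intro prod_sum_PiE) auto
  finally show ?thesis by (simp add: prod.distrib)
qed

lemma sum_prod_poly_expand:
  fixes F :: "'i \<Rightarrow> nat \<Rightarrow> 'a::comm_ring_1 poly"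
  assumes "finite T" "\<And>i t. i \<in> I \<Longrightarrow> t \<in> T \<Longrightarrow> degree (F i t) \<le> N"
  shows "(\<Sum>i\<in>I. \<alpha> i * (\<Prod>t\<in>T. poly (F i t) (x t))) =
    (\<Sum>\<kappa>\<in>PiE T (\<lambda>_. {..N}). (\<Sum>i\<in>I. \<alpha> i * (\<Prod>t\<in>T. coeff (F i t) (\<kappa> t))) * (\<Prod>t\<in>T. x t ^ \<kappa> t))"
  using assms
  by (simp add: prod_poly_expand[where N = N] sum_distrib_left sum_distrib_right mult.assoc sum.swap[of _ I])

text \<open>\<open>N\<close> merely gives all summands one finite box of exponents to expand over;
  no root count depends on it.\<close>

lemma degree_bound_exists:
  fixes F :: "'i \<Rightarrow> nat \<Rightarrow> 'a::zero poly"
  assumes "finite T" "finite I"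
  obtains N where "\<And>i t. i \<in> I \<Longrightarrow> t \<in> T \<Longrightarrow> degree (F i t) \<le> N"
proof -
  have "finite ((\<lambda>(i, t). degree (F i t)) ` (I \<times> T))" using assms by auto
  then obtain N where "\<forall>x\<in>(\<lambda>(i, t). degree (F i t)) ` (I \<times> T). x \<le> N"
    using finite_nat_set_iff_bounded_le by auto
  then show thesis by (intro that[of N]) auto
qed

text \<open>Leads from a nonzero value back to an exponent tuple, where degree hypotheses are
  available.\<close>

lemma sum_prod_nonzero_coeff:
  fixes F :: "'i \<Rightarrow> nat \<Rightarrow> 'a::comm_ring_1 poly"
  assumes "finite T" "finite I" "(\<Sum>i\<in>I. \<alpha> i * (\<Prod>t\<in>T. poly (F i t) (x t))) \<noteq> 0"
  obtains \<kappa> where "(\<Sum>i\<in>I. \<alpha> i * (\<Prod>t\<in>T. coeff (F i t) (\<kappa> t))) \<noteq> 0"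
proof -
  obtain N where N: "\<And>i t. i \<in> I \<Longrightarrow> t \<in> T \<Longrightarrow> degree (F i t) \<le> N"
    using degree_bound_exists[OF assms(1,2)] by blast
  have "(\<Sum>\<kappa>\<in>PiE T (\<lambda>_. {..N}). (\<Sum>i\<in>I. \<alpha> i * (\<Prod>t\<in>T. coeff (F i t) (\<kappa> t))) * (\<Prod>t\<in>T. x t ^ \<kappa> t)) \<noteq> 0"
    using assms(3) sum_prod_poly_expand[OF assms(1) N, where \<alpha> = \<alpha> and x = x] by simp
  then obtain \<kappa> where "(\<Sum>i\<in>I. \<alpha> i * (\<Prod>t\<in>T. coeff (F i t) (\<kappa> t))) * (\<Prod>t\<in>T. x t ^ \<kappa> t) \<noteq> 0"
    by (rule sum.not_neutral_contains_not_neutral)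
  then show thesis by (intro that[of \<kappa>]) auto
qed

text \<open>Both products expand over the same box of exponents. The converse can fail over a finite
  field.\<close>

lemma prod_poly_proportional:
  fixes f g :: "nat \<Rightarrow> 'a::comm_ring_1 poly"
  assumes "finite T" "\<And>\<kappa>. (\<Prod>t\<in>T. coeff (f t) (\<kappa> t)) = \<theta> * (\<Prod>t\<in>T. coeff (g t) (\<kappa> t))"
  shows "(\<Prod>t\<in>T. poly (f t) (x t)) = \<theta> * (\<Prod>t\<in>T. poly (g t) (x t))"
proof -
  obtain N where N: "\<And>i t. i \<in> {f, g} \<Longrightarrow> t \<in> T \<Longrightarrow> degree (i t) \<le> N"
    using degree_bound_exists[OF assms(1), of "{f, g}" "\<lambda>i. i"] by auto
  have "\<And>t. t \<in> T \<Longrightarrow> degree (f t) \<le> N" "\<And>t. t \<in> T \<Longrightarrow> degree (g t) \<le> N" using N by auto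
  then show ?thesis
    using prod_poly_expand[OF assms(1), of f N x] prod_poly_expand[OF assms(1), of g N x]
    by (simp add: assms(2) sum_distrib_left mult.assoc)
qed

text \<open>Factors of large degree may cancel in the sum. Expanding first and collecting by
  exponent tuple leaves only tuples with nonzero combined coefficient, and each of these contributes
  degree at most \<open>n * d\<close> in \<open>z\<close>.\<close>

lemma poly_fun_sum_prod:
  fixes F :: "'i \<Rightarrow> nat \<Rightarrow> 'a::field poly"
  assumes "finite T" "finite I" "\<And>t. t \<in> T \<Longrightarrow> poly_fun n (x t)"
    and "\<And>\<kappa>. (\<Sum>i\<in>I. \<alpha> i * (\<Prod>t\<in>T. coeff (F i t) (\<kappa> t))) \<noteq> 0 \<Longrightarrow> (\<Sum>t\<in>T. \<kappa> t) \<le> d"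
  shows "poly_fun (n * d) (\<lambda>z. \<Sum>i\<in>I. \<alpha> i * (\<Prod>t\<in>T. poly (F i t) (x t z)))"
proof -
  obtain N where N: "\<And>i t. i \<in> I \<Longrightarrow> t \<in> T \<Longrightarrow> degree (F i t) \<le> N"
    using degree_bound_exists[OF assms(1,2)] by blast
  have "poly_fun (n * d) (\<lambda>z. (\<Sum>i\<in>I. \<alpha> i * (\<Prod>t\<in>T. coeff (F i t) (\<kappa> t))) * (\<Prod>t\<in>T. x t z ^ \<kappa> t))" for \<kappa>
  proof (cases "(\<Sum>i\<in>I. \<alpha> i * (\<Prod>t\<in>T. coeff (F i t) (\<kappa> t))) = 0")
    case True
    then show ?thesis using poly_fun_const[of "n * d" 0] by simp
  next
    case False
    then show ?thesis using assms(3,4) by (intro poly_fun_cmult poly_fun_monomial) auto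
  qed
  moreover have "(\<Sum>i\<in>I. \<alpha> i * (\<Prod>t\<in>T. poly (F i t) (x t z))) =
    (\<Sum>\<kappa>\<in>PiE T (\<lambda>_. {..N}). (\<Sum>i\<in>I. \<alpha> i * (\<Prod>t\<in>T. coeff (F i t) (\<kappa> t))) * (\<Prod>t\<in>T. x t z ^ \<kappa> t))" for z
    by (rule sum_prod_poly_expand[OF assms(1) N])
  ultimately show ?thesis by (simp add: poly_fun_sum)
qed


section \<open>The generator S\<close>

lemma S_gen_append:
  "l \<le> length ys \<Longrightarrow> l \<le> length zs \<Longrightarrow> S_gen W L l i (ys @ ys') (zs @ zs') = S_gen W L l i ys zs"
  by (induction l) (auto simp: nth_append)

lemma S_gen_snoc:
  "length ys = l \<Longrightarrow> length zs = l \<Longrightarrow> S_gen W L (Suc l) i (ys @ [y]) (zs @ [z]) =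
    S_gen W L l i ys zs * poly (W i) z + peval ((!) y) (L i) * (1 - poly (W i) z)"
  by (simp add: S_gen_append nth_append)

locale S_generator =
  fixes n q m d :: nat and c :: "nat \<Rightarrow> 'a::field" and W :: "nat \<Rightarrow> 'a poly"
    and L :: "nat \<Rightarrow> 'a mpoly" and U :: "'a set"
  assumes gen: "generator q n (sparse_class n m d) L"
    and L_degree: "\<And>i t. i < n \<Longrightarrow> t < q \<Longrightarrow> degree_in t (L i) \<le> n - 1"
    and W: "switch_polys n c W"
    and U: "finite U" "n * d < card U"
begin

lemma degree_W: "i < n \<Longrightarrow> degree (W i) \<le> n"
  using W by (auto simp: switch_polys_def)

lemma W_node: "i < n \<Longrightarrow> j \<le> n \<Longrightarrow> poly (W i) (c j) = (if i < j then 1 else 0)"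
  using W by (auto simp: switch_polys_def)

lemma poly_fun_W: "i < n \<Longrightarrow> poly_fun n (poly (W i))"
  by (simp add: poly_fun_poly degree_W)

text \<open>The hypothesis \<open>nz\<close> is the value at \<open>z = c j\<close>, where
  \<open>W t\<close> is 1 for \<open>t < j\<close> and 0 otherwise; \<open>deg\<close> bounds the
  number of bad \<open>z\<close>.\<close>

lemma S_gen_extend:
  fixes F :: "'i \<Rightarrow> nat \<Rightarrow> 'a poly"
  assumes "ys \<in> tuples (tuples U q) l" "zs \<in> tuples U l" "y \<in> tuples U q" "n' \<le> n" "j \<le> n" "finite I"
    and deg: "\<And>\<kappa>. (\<Sum>i\<in>I. \<alpha> i * (\<Prod>t<n'. coeff (F i t) (\<kappa> t))) \<noteq> 0 \<Longrightarrow> (\<Sum>t<n'. \<kappa> t) \<le> d"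
    and nz: "(\<Sum>i\<in>I. \<alpha> i * (\<Prod>t<n'. poly (F i t)
      (if t < j then S_gen W L l t ys zs else peval ((!) y) (L t)))) \<noteq> 0"
  shows "\<exists>ys\<in>tuples (tuples U q) (Suc l). \<exists>zs\<in>tuples U (Suc l).
    (\<Sum>i\<in>I. \<alpha> i * (\<Prod>t<n'. poly (F i t) (S_gen W L (Suc l) t ys zs))) \<noteq> 0"
proof -
  define V where "V z = (\<Sum>i\<in>I. \<alpha> i * (\<Prod>t<n'. poly (F i t)
    (S_gen W L l t ys zs * poly (W t) z + peval ((!) y) (L t) * (1 - poly (W t) z))))" for z
  have "V (c j) \<noteq> 0"
  proof -
    have "V (c j) = (\<Sum>i\<in>I. \<alpha> i * (\<Prod>t<n'. poly (F i t)
      (if t < j then S_gen W L l t ys zs else peval ((!) y) (L t))))"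
      unfolding V_def using assms(4,5) by (intro sum.cong prod.cong arg_cong2[of _ _ _ _ "(*)"]) (auto simp: W_node)
    then show ?thesis using nz by simp
  qed
  moreover have "poly_fun (n * d) V"
    unfolding V_def
  proof (rule poly_fun_sum_prod[OF _ \<open>finite I\<close> _ deg])
    fix t assume "t \<in> {..<n'}"
    then have "poly_fun n (poly (W t))" using assms(4) by (simp add: poly_fun_W)
    then show "poly_fun n (\<lambda>z. S_gen W L l t ys zs * poly (W t) z + peval ((!) y) (L t) * (1 - poly (W t) z))"
      by (intro poly_fun_add poly_fun_cmult poly_fun_diff poly_fun_const)
  qed auto
  ultimately obtain z where z: "z \<in> U" "V z \<noteq> 0" using poly_fun_nonzero U by blast
  have len: "length ys = l" "length zs = l" using assms(1,2) by (auto simp: tuples_def)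
  show ?thesis
    using z assms(1-3)
    by (intro bexI[of _ "ys @ [y]"] bexI[of _ "zs @ [z]"])
      (auto simp: V_def S_gen_snoc[OF len] tuples_def simp del: S_gen.simps)
qed

text \<open>The bound on the sum of the degrees serves twice: each factor lies in the class that
  \<open>L\<close> generates for, and the composed product has individual degrees at most
  \<open>(n - 1) * d\<close>, less than \<open>card U\<close>.\<close>

lemma L_hits_product:
  assumes T: "T \<subseteq> {..<n}" "\<And>t. t \<in> T \<Longrightarrow> G t \<noteq> 0" "\<And>t. t \<in> T \<Longrightarrow> card {e. coeff (G t) e \<noteq> 0} \<le> m"
    and deg: "(\<Sum>t\<in>T. degree (G t)) \<le> d"
  shows "\<exists>y\<in>tuples U q. \<forall>t\<in>T. poly (G t) (peval ((!) y) (L t)) \<noteq> 0"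
proof (rule generator_hits_product[OF gen L_degree T _ U(1)])
  have fin: "finite T" using T(1) finite_subset by blast
  show "degree (G t) \<le> d" if "t \<in> T" for t
    using member_le_sum[OF that, of "\<lambda>t. degree (G t)"] fin deg by auto
  have "(n - 1) * (\<Sum>t\<in>T. degree (G t)) \<le> n * d" using deg by (intro mult_mono) auto
  then show "(n - 1) * (\<Sum>t\<in>T. degree (G t)) < card U" using U(2) by linarith
qed auto

text \<open>The weights \<open>\<alpha>\<close> and the length \<open>n'\<close> vary in the
  induction: taking coefficients in trailing variables turns factors into weights and shortens the
  products, so combinations of coefficients keep this shape with the same \<open>F\<close>. The
  bound \<open>k * s \<le> m\<close> is for \<open>g\<close> below, which mixes up to
  \<open>k\<close> of the \<open>F i t\<close>.\<close>

lemma S_gen_hits_sum_prod: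
  fixes F :: "'i \<Rightarrow> nat \<Rightarrow> 'a poly"
  assumes sparse: "\<And>i t. card {e. coeff (F i t) e \<noteq> 0} \<le> s" and "k * s \<le> m"
    and "finite I" "card I \<le> k" "n' \<le> n"
    and "\<exists>\<kappa>. (\<Sum>i\<in>I. \<alpha> i * (\<Prod>t<n'. coeff (F i t) (\<kappa> t))) \<noteq> 0"
    and "\<And>\<kappa>. (\<Sum>i\<in>I. \<alpha> i * (\<Prod>t<n'. coeff (F i t) (\<kappa> t))) \<noteq> 0 \<Longrightarrow> (\<Sum>t<n'. \<kappa> t) \<le> d"
  shows "\<exists>ys\<in>tuples (tuples U q) k. \<exists>zs\<in>tuples U k.
    (\<Sum>i\<in>I. \<alpha> i * (\<Prod>t<n'. poly (F i t) (S_gen W L k t ys zs))) \<noteq> 0"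
  using assms(2-7)
proof (induction k arbitrary: I \<alpha> n')
  case 0
  then show ?case by auto
next
  case (Suc k)
  note fin =\<open>finite I\<close> and deg = Suc.prems(6)
  obtain \<kappa>0 where \<kappa>0: "(\<Sum>i\<in>I. \<alpha> i * (\<Prod>t<n'. coeff (F i t) (\<kappa>0 t))) \<noteq> 0"
    using Suc.prems(5) by blast
  \<comment> \<open>\<open>R j i \<nu>\<close> is the coefficient at \<open>\<nu>\<close> of the
    tail of summand \<open>i\<close> in the variables from \<open>j\<close> on.
    \<open>proportional j\<close> makes all tails scalar multiples of one of them; scalars may be
    0.\<close>
  define R where "R j i \<nu> = (\<Prod>t=j..<n'. coeff (F i t) (\<nu> t))" for j i and \<nu> :: "nat \<Rightarrow> nat"
  define proportional where "proportional j \<longleftrightarrow> (\<exists>i1\<in>I. \<exists>\<rho>. \<forall>i\<in>I. \<forall>\<nu>. R j i \<nu> = \<rho> i * R j i1 \<nu>)" for j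
  have m: "s \<le> m" "card I * s \<le> m"
    using Suc.prems(1,3) mult_le_mono1[OF Suc.prems(3), of s] by auto
  have "I \<noteq> {}" using \<kappa>0 by auto
  then have "proportional n'" by (auto simp: proportional_def R_def intro!: exI[of _ "\<lambda>_. 1"])
  define j where "j = (LEAST j. proportional j)"
  have j: "proportional j" "j \<le> n'" "\<And>j'. j' < j \<Longrightarrow> \<not> proportional j'"
    unfolding j_def using \<open>proportional n'\<close> by (auto intro: LeastI Least_le dest: not_less_Least)
  obtain i1 \<rho> where i1: "i1 \<in> I" and \<rho>: "\<And>i \<nu>. i \<in> I \<Longrightarrow> R j i \<nu> = \<rho> i * R j i1 \<nu>"
    using j(1) by (auto simp: proportional_def)
  show ?case
  proof (cases j)
    case 0
    \<comment> \<open>The sum is now a scalar \<open>\<beta>\<close> times one product of univariate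
      polynomials, so the node \<open>c 0\<close>, which feeds every variable from the new block,
      suffices.\<close>
    define \<beta> where "\<beta> = (\<Sum>i\<in>I. \<alpha> i * \<rho> i)"
    have prop0: "(\<Prod>t<n'. coeff (F i t) (\<nu> t)) = \<rho> i * (\<Prod>t<n'. coeff (F i1 t) (\<nu> t))"
      if "i \<in> I" for i \<nu>
      using \<rho>[OF that, of \<nu>] 0 by (simp add: R_def lessThan_atLeast0)
    have coeff: "(\<Sum>i\<in>I. \<alpha> i * (\<Prod>t<n'. coeff (F i t) (\<nu> t))) = \<beta> * (\<Prod>t<n'. coeff (F i1 t) (\<nu> t))" for \<nu>
      by (simp add: prop0 \<beta>_def sum_distrib_right mult.assoc)
    have \<beta>: "\<beta> \<noteq> 0" and nz: "\<And>t. t < n' \<Longrightarrow> F i1 t \<noteq> 0"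
      using \<kappa>0 unfolding coeff by force+
    \<comment> \<open>The leading coefficients multiply to a nonzero coefficient of the whole sum,
      so \<open>deg\<close> at the tuple of leading exponents bounds the sum of the degrees.\<close>
    have "\<exists>y\<in>tuples U q. \<forall>t\<in>{..<n'}. poly (F i1 t) (peval ((!) y) (L t)) \<noteq> 0"
      using nz \<beta> deg[of "\<lambda>t. degree (F i1 t)"] \<open>n' \<le> n\<close> sparse m
      by (intro L_hits_product) (auto simp: coeff intro: order_trans)
    then obtain y where y: "y \<in> tuples U q" "\<And>t. t < n' \<Longrightarrow> poly (F i1 t) (peval ((!) y) (L t)) \<noteq> 0"
      by auto
    have "(\<Sum>i\<in>I. \<alpha> i * (\<Prod>t<n'. poly (F i t) (peval ((!) y) (L t))))
      = \<beta> * (\<Prod>t<n'. poly (F i1 t) (peval ((!) y) (L t)))"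
      by (simp add: prod_poly_proportional[OF _ prop0] \<beta>_def sum_distrib_right mult.assoc)
    then have "(\<Sum>i\<in>I. \<alpha> i * (\<Prod>t<n'. poly (F i t) (peval ((!) y) (L t)))) \<noteq> 0"
      using \<beta> y(2) by simp
    \<comment> \<open>At the node \<open>c 0\<close> the inner layers do not influence the value, so
      any filling works.\<close>
    moreover obtain u where "u \<in> U" using U by fastforce
    then have "replicate k y \<in> tuples (tuples U q) k" "replicate k u \<in> tuples U k"
      using y(1) by (auto simp: tuples_def)
    ultimately show ?thesis
      using S_gen_extend[where j = 0, OF _ _ y(1) \<open>n' \<le> n\<close> _ fin deg] by simp
  next
    case (Suc j')
    \<comment> \<open>By minimality of \<open>j\<close> the tails from \<open>j'\<close> on are not
      proportional, whereas those from \<open>j' + 1\<close> on are.\<close>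
    then have "\<not> proportional j'" "j' < n'" using j by auto
    define A where "A i \<mu> = (\<Prod>t<j'. coeff (F i t) (\<mu> t))" for i and \<mu> :: "nat \<Rightarrow> nat"
    define join where "join \<mu> \<nu> t = (if t < j' then \<mu> t else \<nu> t)" for \<mu> \<nu> :: "nat \<Rightarrow> nat" and t
    have split: "{..<n'} = {..<j'} \<union> {j'..<n'}" "{..<j'} \<inter> {j'..<n'} = {}" using \<open>j' < n'\<close> by auto
    have coeff: "(\<Sum>i\<in>I. \<alpha> i * (\<Prod>t<n'. coeff (F i t) (join \<mu> \<nu> t))) = (\<Sum>i\<in>I. \<alpha> i * (A i \<mu> * R j' i \<nu>))" for \<mu> \<nu>
      unfolding split(1) A_def R_def join_def
      by (subst prod.union_disjoint) (auto intro!: sum.cong prod.cong arg_cong2[of _ _ _ _ "(*)"])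
    have deg': "(\<Sum>t<j'. \<mu> t) + (\<Sum>t=j'..<n'. \<nu> t) \<le> d" if "(\<Sum>i\<in>I. \<alpha> i * (A i \<mu> * R j' i \<nu>)) \<noteq> 0" for \<mu> \<nu>
    proof -
      have "(\<Sum>t<n'. join \<mu> \<nu> t) = (\<Sum>t<j'. \<mu> t) + (\<Sum>t=j'..<n'. \<nu> t)"
        unfolding split(1) join_def by (subst sum.union_disjoint) (auto intro!: sum.cong arg_cong2[of _ _ _ _ "(+)"])
      then show ?thesis using deg[of "join \<mu> \<nu>"] that by (simp add: coeff)
    qed
    have \<kappa>0': "(\<Sum>i\<in>I. \<alpha> i * (A i \<kappa>0 * R j' i \<kappa>0)) \<noteq> 0"
      using \<kappa>0 coeff[of \<kappa>0 \<kappa>0] by (simp add: join_def)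
    \<comment> \<open>Elimination: a combination of the coefficients at \<open>\<nu>\<close> and
      \<open>\<kappa>0\<close> in the variables from \<open>j'\<close> on that annihilates summand
      \<open>i2\<close> but leaves a nonzero polynomial in the variables before
      \<open>j'\<close>.\<close>
    have "\<exists>i2\<in>I. \<exists>\<nu> \<theta> \<mu>. R j' i2 \<nu> - \<theta> * R j' i2 \<kappa>0 = 0 \<and>
        (\<Sum>i\<in>I. \<alpha> i * (R j' i \<nu> - \<theta> * R j' i \<kappa>0) * A i \<mu>) \<noteq> 0"
    proof (cases "\<exists>i2\<in>I. R j' i2 \<kappa>0 = 0")
      case True
      then obtain i2 where "i2 \<in> I" "R j' i2 \<kappa>0 = 0" by blast
      \<comment> \<open>The coefficient at \<open>\<kappa>0\<close> alone already lacks summand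
        \<open>i2\<close>.\<close>
      then show ?thesis
        using \<kappa>0' by (intro bexI[of _ i2] exI[of _ \<kappa>0] exI[of _ 0]) (auto simp: mult_ac)
    next
      case False
      define \<theta> where "\<theta> \<nu> i = R j' i \<nu> / R j' i \<kappa>0" for \<nu> i
      obtain i2 \<nu> where i2: "i2 \<in> I" "R j' i2 \<nu> \<noteq> R j' i2 \<kappa>0 / R j' i1 \<kappa>0 * R j' i1 \<nu>"
        using \<open>\<not> proportional j'\<close> i1 unfolding proportional_def by meson
      have ne: "\<theta> \<nu> i1 - \<theta> \<nu> i2 \<noteq> 0"
        using i2 i1 False by (auto simp: \<theta>_def field_simps)
      \<comment> \<open>\<open>X i\<close> is the result of eliminating summand \<open>i\<close>,
        read off at \<open>\<kappa>0\<close>. As the ratios of \<open>i1\<close> and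
        \<open>i2\<close> differ, \<open>X i2 - X i1\<close> is a nonzero multiple of the nonzero
        full coefficient, so one of the two eliminations leaves something.\<close>
      define X where "X i = (\<Sum>i'\<in>I. \<alpha> i' * (R j' i' \<nu> - \<theta> \<nu> i * R j' i' \<kappa>0) * A i' \<kappa>0)" for i
      have "X i2 - X i1 = (\<theta> \<nu> i1 - \<theta> \<nu> i2) * (\<Sum>i\<in>I. \<alpha> i * (A i \<kappa>0 * R j' i \<kappa>0))"
        unfolding X_def sum_subtractf[symmetric] sum_distrib_left
        by (intro sum.cong refl) (simp add: algebra_simps)
      then have "X i1 \<noteq> 0 \<or> X i2 \<noteq> 0" using \<kappa>0' ne by auto
      moreover have "R j' i \<nu> - \<theta> \<nu> i * R j' i \<kappa>0 = 0" if "i \<in> I" for i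
        using False that by (auto simp: \<theta>_def)
      ultimately show ?thesis using i1 i2(1) unfolding X_def by blast
    qed
    then obtain i2 \<nu> \<theta> \<mu> where i2: "i2 \<in> I" "R j' i2 \<nu> - \<theta> * R j' i2 \<kappa>0 = 0"
      "(\<Sum>i\<in>I. \<alpha> i * (R j' i \<nu> - \<theta> * R j' i \<kappa>0) * A i \<mu>) \<noteq> 0" by blast
    define \<alpha>' where "\<alpha>' i = \<alpha> i * (R j' i \<nu> - \<theta> * R j' i \<kappa>0)" for i
    \<comment> \<open>If the reduced sum is nonzero, so is one of the two sums on the right; this
      links degrees and nonvanishing to the original sum.\<close>
    have remove: "(\<Sum>i\<in>I - {i2}. \<alpha>' i * B i) = (\<Sum>i\<in>I. \<alpha> i * (B i * R j' i \<nu>)) - \<theta> * (\<Sum>i\<in>I. \<alpha> i * (B i * R j' i \<kappa>0))" for B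
    proof -
      have "(\<Sum>i\<in>I - {i2}. \<alpha>' i * B i) = (\<Sum>i\<in>I. \<alpha>' i * B i)"
        using i2 fin by (intro sum.mono_neutral_left) (auto simp: \<alpha>'_def)
      then show ?thesis
        unfolding \<alpha>'_def by (simp add: algebra_simps sum_subtractf sum_distrib_left)
    qed
    have "\<exists>ys\<in>tuples (tuples U q) k. \<exists>zs\<in>tuples U k.
      (\<Sum>i\<in>I - {i2}. \<alpha>' i * (\<Prod>t<j'. poly (F i t) (S_gen W L k t ys zs))) \<noteq> 0"
    proof (rule Suc.IH)
      have "(\<Sum>i\<in>I - {i2}. \<alpha>' i * A i \<mu>) = (\<Sum>i\<in>I. \<alpha>' i * A i \<mu>)"
        using i2 fin by (intro sum.mono_neutral_left) (auto simp: \<alpha>'_def)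
      then show "\<exists>\<kappa>. (\<Sum>i\<in>I - {i2}. \<alpha>' i * (\<Prod>t<j'. coeff (F i t) (\<kappa> t))) \<noteq> 0"
        using i2(3) unfolding \<alpha>'_def A_def by (intro exI[of _ \<mu>]) (simp only: not_False_eq_True)
      show "(\<Sum>t<j'. \<kappa> t) \<le> d" if "(\<Sum>i\<in>I - {i2}. \<alpha>' i * (\<Prod>t<j'. coeff (F i t) (\<kappa> t))) \<noteq> 0" for \<kappa>
        using that deg'[of \<kappa> \<nu>] deg'[of \<kappa> \<kappa>0] unfolding A_def[symmetric] remove by fastforce
    qed (use Suc.prems i2 fin \<open>j' < n'\<close> in auto)
    then obtain ys zs where ys: "ys \<in> tuples (tuples U q) k" and zs: "zs \<in> tuples U k"
      and nz: "(\<Sum>i\<in>I - {i2}. \<alpha>' i * (\<Prod>t<j'. poly (F i t) (S_gen W L k t ys zs))) \<noteq> 0" by blast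
    define a where "a i = (\<Prod>t<j'. poly (F i t) (S_gen W L k t ys zs))" for i
    \<comment> \<open>With the first \<open>j'\<close> variables at the values found, the rest
      factors as \<open>g\<close> in variable \<open>j'\<close> times the tail of \<open>i1\<close>;
      \<open>\<rho>\<close> absorbs the proportionality.\<close>
    define g where "g = (\<Sum>i\<in>I. smult (\<alpha> i * a i * \<rho> i) (F i j'))"
    define G where "G t = (if t = j' then g else F i1 t)" for t
    have T: "{j'..<n'} = insert j' {j..<n'}" "j' \<notin> {j..<n'}" using \<open>j' < n'\<close> Suc by auto
    have R_Suc: "R j' i \<nu> = coeff (F i j') (\<nu> j') * (\<rho> i * R j i1 \<nu>)" if "i \<in> I" for i \<nu>
      using \<rho>[OF that, of \<nu>] T unfolding R_def by simp
    have G: "(\<Sum>i\<in>I. \<alpha> i * (a i * R j' i \<nu>)) = (\<Prod>t=j'..<n'. coeff (G t) (\<nu> t))" for \<nu>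
    proof -
      have "(\<Prod>t=j'..<n'. coeff (G t) (\<nu> t)) = coeff g (\<nu> j') * R j i1 \<nu>"
        using T unfolding R_def G_def by (auto intro!: prod.cong)
      then show ?thesis
        by (simp add: R_Suc g_def coeff_sum sum_distrib_left mult_ac)
    qed
    obtain \<nu>1 where "(\<Sum>i\<in>I. \<alpha> i * (a i * R j' i \<nu>1)) \<noteq> 0"
      using nz unfolding a_def[symmetric] remove by fastforce
    then have G_nz: "G t \<noteq> 0" if "t \<in> {j'..<n'}" for t
      using that unfolding G by force
    \<comment> \<open>The tuple of leading exponents has a nonzero coefficient after the prefix is
      evaluated. Expanding the prefix values yields a prefix exponent \<open>\<mu>\<close> with
      nonzero coefficient before evaluation, and \<open>deg'\<close> bounds both parts
      together.\<close>
    have G_deg: "(\<Sum>t=j'..<n'. degree (G t)) \<le> d"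
    proof -
      have "(\<Sum>i\<in>I. \<alpha> i * (a i * R j' i (\<lambda>t. degree (G t)))) \<noteq> 0"
        unfolding G using G_nz by simp
      then have "(\<Sum>i\<in>I. (\<alpha> i * R j' i (\<lambda>t. degree (G t))) * a i) \<noteq> 0" by (simp add: mult_ac)
      then obtain \<mu> where "(\<Sum>i\<in>I. (\<alpha> i * R j' i (\<lambda>t. degree (G t))) * A i \<mu>) \<noteq> 0"

        unfolding a_def A_def by (rule sum_prod_nonzero_coeff[OF finite_lessThan fin])
      then show ?thesis using deg'[of \<mu> "\<lambda>t. degree (G t)"] by (simp add: mult_ac)
    qed
    have "card {e. coeff g e \<noteq> 0} \<le> card I * s"
    proof -
      have "{e. coeff g e \<noteq> 0} \<subseteq> (\<Union>i\<in>I. {e. coeff (F i j') e \<noteq> 0})"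
        unfolding g_def coeff_sum by (rule subsetI, rule ccontr) (auto simp: sum.neutral)
      moreover have "finite {e. coeff p e \<noteq> 0}" for p :: "'a poly"
        by (rule finite_subset[of _ "{..degree p}"]) (auto simp: le_degree)
      ultimately have "card {e. coeff g e \<noteq> 0} \<le> card (\<Union>i\<in>I. {e. coeff (F i j') e \<noteq> 0})"
        using fin by (intro card_mono) auto
      also have "\<dots> \<le> (\<Sum>i\<in>I. card {e. coeff (F i j') e \<noteq> 0})" using fin by (rule card_UN_le)
      also have "\<dots> \<le> card I * s" using sum_bounded_above[of I _ s] sparse by simp
      finally show ?thesis .
    qed
    then have "card {e. coeff (G t) e \<noteq> 0} \<le> m" for t
      using sparse[of i1 t] m by (auto simp: G_def)
    then have "\<exists>y\<in>tuples U q. \<forall>t\<in>{j'..<n'}. poly (G t) (peval ((!) y) (L t)) \<noteq> 0"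
      using G_nz G_deg \<open>n' \<le> n\<close> by (intro L_hits_product) auto
    then obtain y where y: "y \<in> tuples U q" "\<And>t. t \<in> {j'..<n'} \<Longrightarrow> poly (G t) (peval ((!) y) (L t)) \<noteq> 0"
      by auto
    have "(\<Sum>i\<in>I. \<alpha> i * (\<Prod>t<n'. poly (F i t) (if t < j' then S_gen W L k t ys zs else peval ((!) y) (L t))))
      = (\<Sum>i\<in>I. \<alpha> i * (a i * (\<Prod>t=j'..<n'. poly (F i t) (peval ((!) y) (L t)))))"
      unfolding split(1) a_def
      by (subst prod.union_disjoint) (auto intro!: sum.cong prod.cong arg_cong2[of _ _ _ _ "(*)"])
    also have "\<dots> = (\<Sum>i\<in>I. \<alpha> i * a i * \<rho> i * poly (F i j') (peval ((!) y) (L j'))) *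
        (\<Prod>t=j..<n'. poly (F i1 t) (peval ((!) y) (L t)))"
      using T \<rho> unfolding sum_distrib_right R_def
      by (auto intro!: sum.cong simp: prod_poly_proportional[of "{j..<n'}" _ "\<rho> _" "F i1"])
    also have "\<dots> = (\<Prod>t=j'..<n'. poly (G t) (peval ((!) y) (L t)))"
      using T unfolding G_def g_def by (auto simp: poly_sum intro!: prod.cong)
    also have "\<dots> \<noteq> 0" using y(2) by simp
    \<comment> \<open>The node is \<open>c j'\<close>: variables before \<open>j'\<close> keep the
      values of the inner layers, the others read the new block \<open>y\<close>.\<close>
    finally show ?thesis
      using \<open>n' \<le> n\<close> \<open>j' < n'\<close> by (intro S_gen_extend[OF ys zs y(1) _ _ fin deg]) auto
  qed
qed

end

section \<open>Sums of few monomials\<close>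

definition monomial_sum :: "nat \<Rightarrow> (nat \<Rightarrow> nat) set \<Rightarrow> ((nat \<Rightarrow> nat) \<Rightarrow> 'a::field) \<Rightarrow> (nat \<Rightarrow> 'a) \<Rightarrow> 'a" where
  "monomial_sum n K a x = (\<Sum>\<kappa>\<in>K. a \<kappa> * (\<Prod>i<n. x i ^ \<kappa> i))"

lemma poly_fun_monomial_sum:
  assumes "\<And>i. i < n \<Longrightarrow> poly_fun D (x i)" "\<And>\<kappa>. \<kappa> \<in> K \<Longrightarrow> (\<Sum>i<n. \<kappa> i) \<le> d"
  shows "poly_fun (D * d) (\<lambda>z. monomial_sum n K a (\<lambda>i. x i z))"
  unfolding monomial_sum_def using assms
  by (intro poly_fun_sum poly_fun_cmult poly_fun_monomial) auto

lemma monomial_sum_cong: "(\<And>i. i < n \<Longrightarrow> x i = y i) \<Longrightarrow> monomial_sum n K a x = monomial_sum n K a y"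
  unfolding monomial_sum_def by simp

text \<open>Padding with 0 keeps truncations in the same type, so a set of truncations can again
  serve as the exponent set \<open>K\<close>.\<close>

definition trunc :: "nat \<Rightarrow> (nat \<Rightarrow> nat) \<Rightarrow> nat \<Rightarrow> nat" where
  "trunc j \<kappa> i = (if i < j then \<kappa> i else 0)"

lemma trunc_Suc_eq_iff: "trunc (Suc p) \<kappa> = trunc (Suc p) \<eta> \<longleftrightarrow> trunc p \<kappa> = trunc p \<eta> \<and> \<kappa> p = \<eta> p"
  unfolding trunc_def fun_eq_iff by (auto simp: less_Suc_eq)

text \<open>The coefficient of the monomial \<open>M\<close> in the variables below \<open>p\<close> after the variables
  above \<open>p\<close> have been set to 1.\<close>

definition fibre_poly :: "nat \<Rightarrow> (nat \<Rightarrow> nat) set \<Rightarrow> ((nat \<Rightarrow> nat) \<Rightarrow> 'a::field) \<Rightarrow> (nat \<Rightarrow> nat) \<Rightarrow> 'a poly" where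
  "fibre_poly p K a M = (\<Sum>\<kappa>\<in>{\<kappa>\<in>K. trunc p \<kappa> = M}. monom (a \<kappa>) (\<kappa> p))"

lemma coeff_fibre_poly:
  assumes "finite K"
  shows "coeff (fibre_poly p K a M) e = (\<Sum>\<kappa>\<in>{\<kappa>\<in>K. trunc p \<kappa> = M \<and> \<kappa> p = e}. a \<kappa>)"
proof -
  have "coeff (fibre_poly p K a M) e = (\<Sum>\<kappa>\<in>{\<kappa>\<in>{\<kappa>\<in>K. trunc p \<kappa> = M}. \<kappa> p = e}. a \<kappa>)"
    unfolding fibre_poly_def coeff_sum coeff_monom using assms by (subst sum.inter_filter) auto
  then show ?thesis by (simp add: conj_assoc)
qed

text \<open>With the variables above \<open>p\<close> at 1, a term depends only on
  \<open>trunc p \<kappa>\<close> and \<open>\<kappa> p\<close>. Zero groups are dropped, so that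
  each remaining one has a meaningful order of vanishing at 1.\<close>

lemma monomial_sum_fibre_poly:
  assumes "finite K" "p < n" "\<And>i. p < i \<Longrightarrow> i < n \<Longrightarrow> x i = 1"
  shows "monomial_sum n K a x =
    (\<Sum>M\<in>{M\<in>trunc p ` K. fibre_poly p K a M \<noteq> 0}. (\<Prod>i<n. x i ^ M i) * poly (fibre_poly p K a M) (x p))"
proof -
  have mon: "(\<Prod>i<n. x i ^ \<kappa> i) = (\<Prod>i<n. x i ^ trunc p \<kappa> i) * x p ^ \<kappa> p" for \<kappa>
  proof -
    have "(\<Prod>i<n. x i ^ \<kappa> i) = (\<Prod>i<n. x i ^ trunc p \<kappa> i * (if i = p then x p ^ \<kappa> p else 1))"
      using assms(3) by (intro prod.cong refl) (auto simp: trunc_def not_less_iff_gr_or_eq)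
    then show ?thesis using assms(2) by (simp add: prod.distrib prod.delta)
  qed
  have "monomial_sum n K a x = (\<Sum>M\<in>trunc p ` K. \<Sum>\<kappa>\<in>{\<kappa>\<in>K. trunc p \<kappa> = M}. a \<kappa> * (\<Prod>i<n. x i ^ \<kappa> i))"
    unfolding monomial_sum_def by (rule sum.image_gen[OF assms(1)])
  also have "\<dots> = (\<Sum>M\<in>trunc p ` K. (\<Prod>i<n. x i ^ M i) * poly (fibre_poly p K a M) (x p))"
  proof (intro sum.cong refl)
    fix M
    show "(\<Sum>\<kappa>\<in>{\<kappa>\<in>K. trunc p \<kappa> = M}. a \<kappa> * (\<Prod>i<n. x i ^ \<kappa> i)) =
      (\<Prod>i<n. x i ^ M i) * poly (fibre_poly p K a M) (x p)"
      unfolding fibre_poly_def poly_sum poly_monom sum_distrib_left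
    proof (intro sum.cong refl)
      fix \<kappa> assume "\<kappa> \<in> {\<kappa>\<in>K. trunc p \<kappa> = M}"
      then show "a \<kappa> * (\<Prod>i<n. x i ^ \<kappa> i) = (\<Prod>i<n. x i ^ M i) * (a \<kappa> * x p ^ \<kappa> p)"
        using mon[of \<kappa>] by simp
    qed
  qed
  also have "\<dots> = (\<Sum>M\<in>{M\<in>trunc p ` K. fibre_poly p K a M \<noteq> 0}. (\<Prod>i<n. x i ^ M i) * poly (fibre_poly p K a M) (x p))"
    using assms(1) by (intro sum.mono_neutral_right) auto
  finally show ?thesis .
qed

context S_generator
begin

definition W_prod :: "'a list \<Rightarrow> nat \<Rightarrow> 'a" where
  "W_prod zs i = (\<Prod>z\<leftarrow>zs. poly (W i) z)"

lemma W_prod_simps [simp]: "W_prod [] i = 1" "W_prod (z # zs) i = poly (W i) z * W_prod zs i"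
  "W_prod (zs @ zs') i = W_prod zs i * W_prod zs' i"
  by (simp_all add: W_prod_def)

lemma W_prod_last_node: "i < n \<Longrightarrow> W_prod (replicate r (c n)) i = 1"
  by (induction r) (auto simp: W_node)

lemma poly_fun_W_prod: "i < n \<Longrightarrow> poly_fun n (\<lambda>z. 1 - W_prod (xs @ z # ys) i)"
proof -
  assume "i < n"
  have "poly_fun n (\<lambda>z. 1 - (W_prod xs i * W_prod ys i) * poly (W i) z)"
    by (intro poly_fun_diff poly_fun_const poly_fun_cmult poly_fun_W \<open>i < n\<close>)
  then show ?thesis by (simp add: mult_ac)
qed

text \<open>Prepending \<open>c j\<close> leaves \<open>W_prod\<close> unchanged below
  \<open>j\<close> and makes it 0 from \<open>j\<close> on, which sets those variables to 1; the
  node is then exchanged for an element of \<open>U\<close>.\<close>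

lemma add_layer:
  assumes "j \<le> n" "\<And>\<kappa>. \<kappa> \<in> K \<Longrightarrow> (\<Sum>i<n. \<kappa> i) \<le> D" "D \<le> d"
    and "monomial_sum n K a (\<lambda>i. 1 - (if i < j then W_prod zs i else 0)) \<noteq> 0"
  obtains z where "z \<in> U" "monomial_sum n K a (\<lambda>i. 1 - W_prod (z # zs) i) \<noteq> 0"
proof -
  have "poly_fun (n * D) (\<lambda>z. monomial_sum n K a (\<lambda>i. 1 - W_prod (z # zs) i))"
    using poly_fun_W_prod[of _ "[]" zs] assms(2) by (intro poly_fun_monomial_sum) auto
  moreover have "monomial_sum n K a (\<lambda>i. 1 - W_prod (c j # zs) i) \<noteq> 0"
    using assms(4) by (subst monomial_sum_cong[where y = "\<lambda>i. 1 - (if i < j then W_prod zs i else 0)"])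
      (auto simp: W_node assms(1))
  moreover have "n * D < card U" using U(2) \<open>D \<le> d\<close> by (meson le_less_trans mult_le_mono2)
  ultimately show thesis using poly_fun_nonzero[OF _ _ U(1)] that by blast
qed

text \<open>Let \<open>p\<close> be the first position at which setting the variables above it to 1 keeps the sum
  nonzero, while setting \<open>x p\<close> to 1 as well makes it vanish. Then every nonzero coefficient with
  respect to the variables below \<open>p\<close> has a root at 1, hence comes from at least two monomials.
  Dividing by the power of \<open>x p - 1\<close> and setting \<open>x p\<close> to 1 leaves at most half as many
  monomials, at the cost of two layers.\<close>

lemma W_prod_hits_monomial_sum:
  assumes "finite K" "K \<noteq> {}" "card K \<le> k" "\<And>\<kappa>. \<kappa> \<in> K \<Longrightarrow> a \<kappa> \<noteq> 0"
    and "\<And>\<kappa> i. \<kappa> \<in> K \<Longrightarrow> n \<le> i \<Longrightarrow> \<kappa> i = 0" "\<And>\<kappa>. \<kappa> \<in> K \<Longrightarrow> (\<Sum>i<n. \<kappa> i) \<le> D" "D \<le> d"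
  shows "\<exists>zs\<in>tuples U k. monomial_sum n K a (\<lambda>i. 1 - W_prod zs i) \<noteq> 0"
  using assms
proof (induction k arbitrary: K a D rule: less_induct)
  case (less k)
  note fin = less.prems(1) and deg = less.prems(6)
  have card_pos: "0 < card K" using less.prems(1,2) by (simp add: card_gt_0_iff)
  have cardU: "n * D < card U" using U(2) \<open>D \<le> d\<close> by (meson le_less_trans mult_le_mono2)
  then obtain u where "u \<in> U" by fastforce
  \<comment> \<open>\<open>Z j\<close> says that the sum vanishes formally once all variables from
    \<open>j\<close> on are set to 1.\<close>
  define Z where "Z j \<longleftrightarrow> (\<forall>M. (\<Sum>\<kappa>\<in>{\<kappa>\<in>K. trunc j \<kappa> = M}. a \<kappa>) = 0)" for j
  have "\<not> Z n"
  proof -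
    obtain \<kappa>0 where "\<kappa>0 \<in> K" using less.prems(2) by blast
    have "trunc n \<kappa> = \<kappa>" if "\<kappa> \<in> K" for \<kappa>
      using less.prems(5)[OF that] by (auto simp: trunc_def fun_eq_iff)
    then have "{\<kappa>\<in>K. trunc n \<kappa> = \<kappa>0} = {\<kappa>0}" using \<open>\<kappa>0 \<in> K\<close> by auto
    then show ?thesis unfolding Z_def using less.prems(4)[OF \<open>\<kappa>0 \<in> K\<close>] by (auto intro!: exI[of _ \<kappa>0])
  qed
  show ?case
  proof (cases "Z 0")
    case False
    \<comment> \<open>Here all variables can be set to 1: one layer at \<open>c 0\<close> does so,
      and the other \<open>k - 1\<close> are filled arbitrarily.\<close>
    have "(\<Sum>\<kappa>\<in>K. a \<kappa>) \<noteq> 0"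
    proof -
      obtain M where M: "(\<Sum>\<kappa>\<in>{\<kappa>\<in>K. trunc 0 \<kappa> = M}. a \<kappa>) \<noteq> 0" using False by (auto simp: Z_def)
      then obtain \<kappa> where "trunc 0 \<kappa> = M"
        by (metis (mono_tags, lifting) mem_Collect_eq sum.not_neutral_contains_not_neutral)
      then have "{\<kappa>\<in>K. trunc 0 \<kappa> = M} = K" by (auto simp: trunc_def)
      then show ?thesis using M by simp
    qed
    then have "monomial_sum n K a (\<lambda>i. 1 - (if i < 0 then W_prod (replicate (k - 1) u) i else 0)) \<noteq> 0"
      by (simp add: monomial_sum_def)
    then obtain z where "z \<in> U" "monomial_sum n K a (\<lambda>i. 1 - W_prod (z # replicate (k - 1) u) i) \<noteq> 0"
      using add_layer[OF _ deg \<open>D \<le> d\<close>] by blast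
    then show ?thesis
      using \<open>u \<in> U\<close> card_pos less.prems(3)
      by (intro bexI[of _ "z # replicate (k - 1) u"]) (auto simp: tuples_def)
  next
    case True
    then obtain p where p: "p < n" "Z p" "\<not> Z (Suc p)"
      using ex_least_nat_less[of "\<lambda>j. \<not> Z j" n] \<open>\<not> Z n\<close> by auto
    define G where "G = fibre_poly p K a"
    define \<M> where "\<M> = {M\<in>trunc p ` K. G M \<noteq> 0}"
    have fin\<M>: "finite \<M>" using fin by (simp add: \<M>_def)
    have expand: "monomial_sum n K a x = (\<Sum>M\<in>\<M>. (\<Prod>i<n. x i ^ M i) * poly (G M) (x p))"
      if "\<And>i. p < i \<Longrightarrow> i < n \<Longrightarrow> x i = 1" for x
      unfolding \<M>_def G_def using monomial_sum_fibre_poly[OF fin \<open>p < n\<close> that] .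
    have "\<M> \<noteq> {}"
    proof -
      obtain M where M: "(\<Sum>\<kappa>\<in>{\<kappa>\<in>K. trunc (Suc p) \<kappa> = M}. a \<kappa>) \<noteq> 0" using p(3) by (auto simp: Z_def)
      then obtain \<kappa>1 where \<kappa>1: "\<kappa>1 \<in> K" "M = trunc (Suc p) \<kappa>1"
        by (metis (mono_tags, lifting) mem_Collect_eq sum.not_neutral_contains_not_neutral)
      have "coeff (G (trunc p \<kappa>1)) (\<kappa>1 p) \<noteq> 0"
        using M unfolding G_def coeff_fibre_poly[OF fin] \<kappa>1(2) trunc_Suc_eq_iff by simp
      then have "G (trunc p \<kappa>1) \<noteq> 0" by auto
      then show ?thesis using \<kappa>1(1) by (auto simp: \<M>_def)
    qed
    have root: "poly (G M) 1 = 0" for M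
      using p(2) by (simp add: Z_def G_def fibre_poly_def poly_sum poly_monom)
    have "2 * card \<M> \<le> card K"
    proof -
      have fibre: "2 \<le> card {\<kappa>\<in>K. trunc p \<kappa> = M}" if "M \<in> \<M>" for M
      proof (rule ccontr)
        assume "\<not> 2 \<le> card {\<kappa>\<in>K. trunc p \<kappa> = M}"
        moreover have "card {\<kappa>\<in>K. trunc p \<kappa> = M} \<noteq> 0"
          using that fin by (auto simp: \<M>_def)
        ultimately have "card {\<kappa>\<in>K. trunc p \<kappa> = M} = 1" by linarith
        then obtain \<kappa> where \<kappa>: "{\<kappa>\<in>K. trunc p \<kappa> = M} = {\<kappa>}" by (auto simp: card_1_singleton_iff)
        then have "poly (G M) 1 = a \<kappa>" by (simp add: G_def fibre_poly_def poly_monom)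
        then show False using root less.prems(4)[of \<kappa>] \<kappa> by auto
      qed
      have "2 * card \<M> \<le> (\<Sum>M\<in>\<M>. card {\<kappa>\<in>K. trunc p \<kappa> = M})"
        using sum_bounded_below[of \<M> "2::nat" "\<lambda>M. card {\<kappa>\<in>K. trunc p \<kappa> = M}"] fibre by (simp add: mult.commute)
      also have "\<dots> = card (\<Union>M\<in>\<M>. {\<kappa>\<in>K. trunc p \<kappa> = M})"
        using fin fin\<M> by (intro card_UN_disjoint[symmetric]) auto
      also have "\<dots> \<le> card K" using fin by (intro card_mono) auto
      finally show ?thesis .
    qed
    moreover have "0 < card \<M>" using \<open>\<M> \<noteq> {}\<close> fin\<M> by (simp add: card_gt_0_iff)
    ultimately have "2 \<le> k" and half: "card \<M> \<le> k div 2" using less.prems(3) by linarith+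
    \<comment> \<open>The leading exponent of \<open>G M\<close> is attained by some
      \<open>\<kappa>\<close> in the fibre, and \<open>M\<close> together with this exponent is part
      of \<open>\<kappa>\<close>.\<close>
    have G_deg: "(\<Sum>i<n. M i) + degree (G M) \<le> D" if "M \<in> \<M>" for M
    proof -
      have "coeff (G M) (degree (G M)) \<noteq> 0" using that by (simp add: \<M>_def)
      then obtain \<kappa> where \<kappa>: "\<kappa> \<in> K" "trunc p \<kappa> = M" "\<kappa> p = degree (G M)"
        unfolding G_def coeff_fibre_poly[OF fin]
        by (metis (mono_tags, lifting) mem_Collect_eq sum.not_neutral_contains_not_neutral)
      have "(\<Sum>i<n. M i) + degree (G M) = (\<Sum>i<n. M i + (if i = p then \<kappa> p else 0))"
        using p(1) \<kappa>(3) by (simp add: sum.distrib sum.delta)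
      also have "\<dots> \<le> (\<Sum>i<n. \<kappa> i)"
        using \<kappa>(2) by (intro sum_mono) (auto simp: trunc_def)
      finally show ?thesis using deg[OF \<kappa>(1)] by simp
    qed
    have "\<exists>zs\<in>tuples U (k - 2). \<exists>z\<in>U. monomial_sum n K a
        (\<lambda>i. 1 - (if i < Suc p then W_prod (z # zs) i else 0)) \<noteq> 0"
    proof (cases "k = 2")
      case True
      \<comment> \<open>For \<open>k = 2\<close> no layer would be left for the remaining nonempty
        set, so the induction hypothesis is out of reach. But only one group \<open>M\<close>
        exists, and the sum is a single product that can be treated directly.\<close>
      then have "card \<M> = 1"
        using half \<open>\<M> \<noteq> {}\<close> fin\<M> by (simp add: le_Suc_eq)
      then obtain M where M: "\<M> = {M}" by (auto simp: card_1_singleton_iff)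
      define x where "x z i = 1 - (if i < Suc p then poly (W i) z else 0)" for z i
      \<comment> \<open>\<open>W p\<close> is 0 at \<open>c 0\<close> and 1 at \<open>c n\<close>.
        Composing the nonzero \<open>G M\<close> with a nonconstant polynomial gives a nonzero
        one.\<close>
      have "0 < degree (1 - W p)"
      proof (rule ccontr)
        assume "\<not> 0 < degree (1 - W p)"
        then obtain b where "1 - W p = [:b:]" by (auto elim: degree_eq_zeroE)
        then have "poly (1 - W p) (c 0) = poly (1 - W p) (c n)" by simp
        then show False using p(1) by (simp add: W_node)
      qed
      then have nz: "pcompose (G M) (1 - W p) \<noteq> 0"
        using M pcompose_eq_0[of "G M" "1 - W p"] by (auto simp: \<M>_def)
      have deg1: "degree (1 - W p) \<le> n" using degree_diff_le[of 1 n "W p"] degree_W[OF p(1)] by simp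
      have d2: "degree (pcompose (G M) (1 - W p)) \<le> n * degree (G M)"
        by (metis deg1 degree_pcompose mult.commute mult_le_mono2)
      have cd: "n * (\<Sum>i<n. M i) + n * degree (G M) < card U"
        using G_deg[of M] M cardU by (simp flip: distrib_left) (meson le_less_trans mult_le_mono2)
      obtain t where t: "poly (pcompose (G M) (1 - W p)) t \<noteq> 0"
        using poly_nonzero_point[OF nz U(1)] d2 cd by auto
      have "poly_fun n (\<lambda>z. x z i)" if "i < n" for i
        unfolding x_def using that by (cases "i < Suc p") (auto intro: poly_fun_diff poly_fun_const poly_fun_W)
      then have "poly_fun (n * (\<Sum>i<n. M i)) (\<lambda>z. \<Prod>i<n. x z i ^ M i)"
        by (intro poly_fun_monomial) auto
      \<comment> \<open>The two factors need different witnesses: at \<open>c 0\<close> the monomial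
        is 1, but \<open>G M\<close> vanishes.\<close>
      moreover have "(\<Prod>i<n. x (c 0) i ^ M i) \<noteq> 0" using p(1) by (simp add: x_def W_node)
      ultimately obtain z where z: "z \<in> U" "(\<Prod>i<n. x z i ^ M i) \<noteq> 0"
        "poly (pcompose (G M) (1 - W p)) z \<noteq> 0"
        using poly_fun_nonzero2[OF _ _ poly_fun_poly[OF d2] t U(1) cd] by blast
      have "monomial_sum n K a (x z) \<noteq> 0"
        using z by (subst expand) (auto simp: x_def M poly_pcompose)
      moreover have "x z = (\<lambda>i. 1 - (if i < Suc p then W_prod [z] i else 0))"
        by (auto simp: x_def)
      ultimately show ?thesis
        using z(1) True by (intro bexI[of _ "[]"] bexI[of _ z]) (auto simp: tuples_def)
    next
      case False
      \<comment> \<open>The largest power of \<open>[:-1, 1:]\<close> dividing all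
        \<open>G M\<close>; after division at least one quotient is nonzero at 1.\<close>
      define v where "v = Min ((\<lambda>M. order 1 (G M)) ` \<M>)"
      have "v \<in> (\<lambda>M. order 1 (G M)) ` \<M>"
        unfolding v_def using fin\<M> \<open>\<M> \<noteq> {}\<close> by (intro Min_in) auto
      then obtain M0 where M0: "M0 \<in> \<M>" "v = order 1 (G M0)" by blast
      define G' where "G' M = G M div [:-1, 1:] ^ v" for M
      have G': "G M = [:-1, 1:] ^ v * G' M" if "M \<in> \<M>" for M
      proof -
        have "v \<le> order 1 (G M)" unfolding v_def using that fin\<M> by (intro Min_le) auto
        then have "[:-1, 1:] ^ v dvd G M" by (simp add: order_divides)
        then show ?thesis by (simp add: G'_def)
      qed
      have G'0: "poly (G' M0) 1 \<noteq> 0"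
      proof
        assume "poly (G' M0) 1 = 0"
        then have "[:-1, 1:] dvd G' M0" by (simp add: poly_eq_0_iff_dvd)
        then have "[:-1, 1:] ^ Suc v dvd G M0"
          unfolding G'[OF M0(1)] power_Suc2 by (rule mult_dvd_mono[OF dvd_refl])
        moreover have "G M0 \<noteq> 0" using M0(1) by (simp add: \<M>_def)
        ultimately show False using order_2[of "G M0" 1] M0(2) by blast
      qed
      have G'_deg: "(\<Sum>i<n. M i) + degree (G' M) + v \<le> D" if "M \<in> \<M>" for M
      proof -
        have "G' M \<noteq> 0" using G'[OF that] that by (auto simp: \<M>_def)
        then have "degree (G M) = v + degree (G' M)"
          using G'[OF that] by (simp add: degree_mult_eq degree_power_eq)
        then show ?thesis using G_deg[OF that] by simp
      qed
      then have "v \<le> D" using M0(1) by fastforce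
      define K1 where "K1 = {M\<in>\<M>. poly (G' M) 1 \<noteq> 0}"
      \<comment> \<open>Now \<open>k \<ge> 3\<close>, so \<open>k div 2 \<le> k - 2\<close>: the
        halving pays for the two layers spent.\<close>
      have K1: "finite K1" "K1 \<noteq> {}" "card K1 \<le> k - 2"
        using M0(1) G'0 fin\<M> half card_mono[of \<M> K1] \<open>2 \<le> k\<close> False by (auto simp: K1_def)
      have K1_deg: "(\<Sum>i<n. \<kappa> i) \<le> D - v" if "\<kappa> \<in> K1" for \<kappa>
        using G'_deg[of \<kappa>] that by (simp add: K1_def)
      let ?b = "\<lambda>M. poly (G' M) 1"
      have "\<exists>zs\<in>tuples U (k - 2). monomial_sum n K1 ?b (\<lambda>i. 1 - W_prod zs i) \<noteq> 0"
      proof (rule less.IH[OF _ K1, where D = "D - v"])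
        show "\<kappa> i = 0" if "\<kappa> \<in> K1" "n \<le> i" for \<kappa> i
          using that p(1) by (auto simp: K1_def \<M>_def trunc_def)
      qed (use K1_deg \<open>2 \<le> k\<close> \<open>D \<le> d\<close> in \<open>auto simp: K1_def\<close>)
      then obtain zs0 where zs0: "length zs0 = k - 2" "monomial_sum n K1 ?b (\<lambda>i. 1 - W_prod zs0 i) \<noteq> 0"
        by (auto simp: tuples_def)
      \<comment> \<open>The root budget \<open>n * D\<close> splits into \<open>n * (D - v)\<close>
        for the quotient and \<open>n * v\<close> for the power divided out.\<close>
      have cd: "n * (D - v) + n * v < card U" using cardU \<open>v \<le> D\<close> by (simp flip: distrib_left)
      \<comment> \<open>The power divided out becomes
        \<open>(- W_prod zs p * poly (W p) z) ^ v\<close>, so \<open>W_prod zs p\<close> has to stay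
        nonzero too; the node \<open>c n\<close>, where every switch is 1, certifies this.\<close>
      have "\<exists>zs. length zs = k - 2 \<and> set zs \<subseteq> U \<and> monomial_sum n K1 ?b (\<lambda>i. 1 - W_prod zs i) \<noteq> 0 \<and>
        W_prod zs p ^ v \<noteq> 0"
      proof (rule list_fun_nonzero2[where f = "\<lambda>zs. monomial_sum n K1 ?b (\<lambda>i. 1 - W_prod zs i)"
            and g = "\<lambda>zs. W_prod zs p ^ v", OF _ _ zs0(2,1) _ _ U(1) cd])
        show "W_prod (replicate (k - 2) (c n)) p ^ v \<noteq> 0" using p(1) by (simp add: W_prod_last_node)
        fix xs ys :: "'a list"
        show "poly_fun (n * (D - v)) (\<lambda>t. monomial_sum n K1 ?b (\<lambda>i. 1 - W_prod (xs @ t # ys) i))"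
          using K1_deg by (intro poly_fun_monomial_sum poly_fun_W_prod)
        have "poly_fun (n * v) (\<lambda>t. ((W_prod xs p * W_prod ys p) * poly (W p) t) ^ v)"
          by (intro poly_fun_power poly_fun_cmult poly_fun_W p(1))
        then show "poly_fun (n * v) (\<lambda>t. W_prod (xs @ t # ys) p ^ v)" by (simp add: mult_ac)
      qed auto
      then obtain zs where zs: "zs \<in> tuples U (k - 2)" "monomial_sum n K1 ?b (\<lambda>i. 1 - W_prod zs i) \<noteq> 0"
        "W_prod zs p ^ v \<noteq> 0" by (auto simp: tuples_def)
      define x where "x z i = 1 - (if i < Suc p then W_prod (z # zs) i else 0)" for z i
      \<comment> \<open>The sum divided by \<open>(x z p - 1) ^ v\<close>.\<close>
      define \<psi> where "\<psi> z = (\<Sum>M\<in>\<M>. (\<Prod>i<n. x z i ^ M i) * poly (G' M) (x z p))" for z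
      have x_fun: "poly_fun n (\<lambda>z. x z i)" if "i < n" for i
        unfolding x_def using that poly_fun_W_prod[OF that, of "[]" zs]
        by (cases "i < Suc p") (auto intro: poly_fun_const)
      have "poly_fun (n * (D - v)) \<psi>"
        unfolding \<psi>_def
      proof (rule poly_fun_sum)
        fix M assume M: "M \<in> \<M>"
        have "poly_fun (n * degree (G' M)) (\<lambda>z. \<Sum>e\<le>degree (G' M). coeff (G' M) e * x z p ^ e)"
          using x_fun[OF p(1)]
          by (intro poly_fun_sum poly_fun_cmult) (auto intro: poly_fun_mono[OF poly_fun_power])
        then have "poly_fun (n * degree (G' M)) (\<lambda>z. poly (G' M) (x z p))" by (simp add: poly_altdef)
        then have "poly_fun (n * (\<Sum>i<n. M i) + n * degree (G' M))
            (\<lambda>z. (\<Prod>i<n. x z i ^ M i) * poly (G' M) (x z p))"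
          using x_fun by (intro poly_fun_mult poly_fun_monomial) auto
        then show "poly_fun (n * (D - v)) (\<lambda>z. (\<Prod>i<n. x z i ^ M i) * poly (G' M) (x z p))"
          by (rule poly_fun_mono) (use G'_deg[OF M] in \<open>auto simp flip: distrib_left\<close>)
      qed
      \<comment> \<open>At \<open>c p\<close> the switch of \<open>p\<close> is 0, which sets
        variable \<open>p\<close> to 1, while the switches below \<open>p\<close> are 1; the
        exponents \<open>M\<close> vanish from \<open>p\<close> on.\<close>
      moreover have "\<psi> (c p) \<noteq> 0"
      proof -
        have "\<psi> (c p) = (\<Sum>M\<in>\<M>. ?b M * (\<Prod>i<n. (1 - W_prod zs i) ^ M i))"
          unfolding \<psi>_def
        proof (intro sum.cong refl)
          fix M assume "M \<in> \<M>"
          then have "(\<Prod>i<n. x (c p) i ^ M i) = (\<Prod>i<n. (1 - W_prod zs i) ^ M i)"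
            using p(1) by (intro prod.cong refl) (auto simp: x_def W_node \<M>_def trunc_def)
          then show "(\<Prod>i<n. x (c p) i ^ M i) * poly (G' M) (x (c p) p) = ?b M * (\<Prod>i<n. (1 - W_prod zs i) ^ M i)"
            using p(1) by (simp add: x_def W_node)
        qed
        also have "\<dots> = monomial_sum n K1 ?b (\<lambda>i. 1 - W_prod zs i)"
          unfolding monomial_sum_def K1_def using fin\<M> by (intro sum.mono_neutral_right) auto
        finally show ?thesis using zs(2) by simp
      qed
      moreover have "poly_fun (n * v) (\<lambda>z. (- W_prod zs p * poly (W p) z) ^ v)"
        by (intro poly_fun_power poly_fun_cmult poly_fun_W p(1))
      \<comment> \<open>This power vanishes at \<open>c p\<close> when \<open>v > 0\<close>, hence
        the different witness \<open>c n\<close>.\<close>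
      moreover have "(- W_prod zs p * poly (W p) (c n)) ^ v \<noteq> 0"
        using zs(3) p(1) by (simp add: W_node)
      ultimately obtain z where z: "z \<in> U" "\<psi> z \<noteq> 0" "(- W_prod zs p * poly (W p) z) ^ v \<noteq> 0"
        using poly_fun_nonzero2[OF _ _ _ _ U(1) cd] by blast
      have "monomial_sum n K a (x z) = (- W_prod zs p * poly (W p) z) ^ v * \<psi> z"
        unfolding \<psi>_def sum_distrib_left
        by (subst expand) (auto simp: G' x_def mult_ac intro!: sum.cong)
      then have "monomial_sum n K a (x z) \<noteq> 0" using z by simp
      then show ?thesis using z(1) zs(1) unfolding x_def by blast
    qed
    then obtain zs z where zs: "zs \<in> tuples U (k - 2)" "z \<in> U"
      "monomial_sum n K a (\<lambda>i. 1 - (if i < Suc p then W_prod (z # zs) i else 0)) \<noteq> 0" by blast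
    \<comment> \<open>The second layer, from the node \<open>c (Suc p)\<close>, sets the variables
      above \<open>p\<close> to 1.\<close>
    then obtain z' where "z' \<in> U" "monomial_sum n K a (\<lambda>i. 1 - W_prod (z' # z # zs) i) \<noteq> 0"
      using add_layer[OF Suc_leI[OF p(1)] deg \<open>D \<le> d\<close> zs(3)] by blast
    then show ?thesis
      using zs \<open>2 \<le> k\<close> by (intro bexI[of _ "z' # z # zs"]) (auto simp: tuples_def)
  qed
qed

end

section \<open>Results of the timed programs\<close>

lemma result_tick [simp]: "result (tick x) = x" "steps (tick x) = 1"
  by (simp_all add: tick_def)

lemma result_bind [simp]:
  "result (bind_t p f) = result (f (result p))" "steps (bind_t p f) = steps p + steps (f (result p))"
  by (simp_all add: bind_t_def)

lemma result_map_t [simp]: "result (map_t f xs) = map (\<lambda>x. result (f x)) xs"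
  by (induction xs) auto

lemma result_sum_t [simp]: "result (sum_t f xs) = (\<Sum>x\<leftarrow>xs. result (f x))"
  by (induction xs) auto

lemma result_prod_t [simp]: "result (prod_t f xs) = (\<Prod>x\<leftarrow>xs. result (f x))"
  by (induction xs) auto

lemma result_append_t [simp]: "result (append_t xs ys) = xs @ ys"
  by (induction xs) auto

lemma result_concat_map_t [simp]: "result (concat_map_t f xs) = concat (map (\<lambda>x. result (f x)) xs)"
  by (induction xs) auto

lemma result_power_t [simp]: "result (power_t x e) = x ^ e"
  by (induction e) auto

lemma result_enum_t [simp]: "result (enum_t f i r) = map f [i..<i + r]"
proof (induction r arbitrary: i)
  case (Suc r)
  then show ?case by (simp add: upt_conv_Cons del: upt_Suc)
qed simp

lemma tuples_Suc: "tuples A (Suc q) = (\<lambda>(x, xs). x # xs) ` (A \<times> tuples A q)"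
  by (auto simp: tuples_def length_Suc_conv image_iff)

lemma tuples_0 [simp]: "tuples A 0 = {[]}"
  by (auto simp: tuples_def)

text \<open>Matches the recursion of \<open>S_gen\<close>, whose newest block stands at the
  end.\<close>

lemma tuples_Suc_snoc: "tuples A (Suc q) = (\<lambda>(xs, x). xs @ [x]) ` (tuples A q \<times> A)"
proof -
  have "xs \<in> (\<lambda>(xs, x). xs @ [x]) ` (tuples A q \<times> A)" if "xs \<in> tuples A (Suc q)" for xs
    using that by (cases xs rule: rev_cases) (auto simp: tuples_def)
  then show ?thesis by (auto simp: tuples_def)
qed

lemma set_tuples_t [simp]: "set (result (tuples_t us q)) = tuples (set us) q"
  by (induction q) (auto simp: tuples_Suc)

lemma length_tuples_t [simp]: "length (result (tuples_t us q)) = length us ^ q"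
  by (induction q) (auto simp: length_concat comp_def sum_list_triv)

lemma result_monomial_t:
  "length es = length ys \<Longrightarrow> result (monomial_t es ys) = (\<Prod>i<length es. ys ! i ^ (es ! i))"
  by (induction es ys rule: monomial_t.induct) (auto simp: prod.lessThan_Suc_shift simp del: prod.lessThan_Suc)

lemma peval_single_nth:
  assumes "length es = q"
  shows "peval x (Poly_Mapping.single (Poly_Mapping.nth es) a) = a * (\<Prod>i<q. x i ^ (es ! i))"
proof -
  have "Poly_Mapping.keys (Poly_Mapping.nth es) \<subseteq> {..<q}"
    using assms unfolding subset_iff in_keys_iff lookup_nth by (auto simp: nth_default_def split: if_splits)
  then have "(\<Prod>i\<in>Poly_Mapping.keys (Poly_Mapping.nth es). x i ^ Poly_Mapping.lookup (Poly_Mapping.nth es) i)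
    = (\<Prod>i<q. x i ^ Poly_Mapping.lookup (Poly_Mapping.nth es) i)"
    by (intro monomial_superset) auto
  also have "\<dots> = (\<Prod>i<q. x i ^ (es ! i))" using assms by (simp add: nth_default_def)
  finally show ?thesis by (simp add: peval_single)
qed

lemma result_sparse_eval_t:
  assumes "sparse_rep q t p" "length y = q"
  shows "result (sparse_eval_t t y) = peval ((!) y) p"
proof -
  have "peval ((!) y) p = (\<Sum>x\<leftarrow>t. peval ((!) y) (case x of (a, es) \<Rightarrow> Poly_Mapping.single (Poly_Mapping.nth es) a))"
    using assms(1) by (simp add: sparse_rep_def peval_sum_list comp_def)
  also have "\<dots> = result (sparse_eval_t t y)"
    unfolding sparse_eval_t_def result_sum_t using assms
    by (intro arg_cong[of _ _ sum_list] map_cong refl)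
      (auto simp: sparse_rep_def peval_single_nth result_monomial_t)
  finally show ?thesis by simp
qed

text \<open>\<open>Poly_Mapping.nth\<close> pads with 0, so equal lengths are what rules out
  trailing zeros.\<close>

lemma nth_inj: "length es = length es' \<Longrightarrow> Poly_Mapping.nth es = Poly_Mapping.nth es' \<Longrightarrow> es = es'"
  by (rule nth_equalityI) (auto dest!: arg_cong[of _ _ Poly_Mapping.lookup] simp: nth_default_def fun_eq_iff split: if_splits)

text \<open>Distinct exponent vectors of equal length are distinct monomials, so nothing cancels and
  every listed vector is a key of \<open>p\<close>. Its entries are bounded by the individual
  degrees, and counting such vectors bounds the list.\<close>

lemma sparse_rep_length:
  assumes "sparse_rep q t p" "\<And>v. v < q \<Longrightarrow> degree_in v p \<le> D"
  shows "length t \<le> (D + 1) ^ q" "\<And>a es. (a, es) \<in> set t \<Longrightarrow> set es \<subseteq> {..D}"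
proof -
  have dist: "distinct (map snd t)" and len: "\<And>a es. (a, es) \<in> set t \<Longrightarrow> a \<noteq> 0 \<and> length es = q"
    and p: "p = (\<Sum>(a, es)\<leftarrow>t. Poly_Mapping.single (Poly_Mapping.nth es) a)"
    using assms(1) by (auto simp: sparse_rep_def)
  show entries: "set es \<subseteq> {..D}" if "(a, es) \<in> set t" for a es
  proof -
    have "Poly_Mapping.lookup p (Poly_Mapping.nth es) =
      (\<Sum>x\<in>set t. Poly_Mapping.lookup (case x of (a, es) \<Rightarrow> Poly_Mapping.single (Poly_Mapping.nth es) a) (Poly_Mapping.nth es))"
      unfolding p using dist by (simp add: sum_list_distinct_conv_sum_set distinct_map lookup_sum)
    also have "\<dots> = (\<Sum>x\<in>set t. if x = (a, es) then a else 0)"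
    proof (intro sum.cong refl)
      fix x assume x: "x \<in> set t"
      obtain b fs where bf: "x = (b, fs)" by (cases x)
      have "Poly_Mapping.nth fs = Poly_Mapping.nth es \<longleftrightarrow> x = (a, es)"
        using nth_inj[of fs es] len x that bf inj_onD[of snd "set t" x "(a, es)"] dist
        by (auto simp: distinct_map)
      then show "Poly_Mapping.lookup (case x of (a, es) \<Rightarrow> Poly_Mapping.single (Poly_Mapping.nth es) a) (Poly_Mapping.nth es)
          = (if x = (a, es) then a else 0)"
        using bf by (auto simp: lookup_single when_def)
    qed
    also have "\<dots> = a" using that by simp
    finally have "Poly_Mapping.nth es \<in> Poly_Mapping.keys p" using len[OF that] by (simp add: in_keys_iff)
    then have "Poly_Mapping.lookup (Poly_Mapping.nth es) v \<le> D" if "v < q" for v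
      using assms(2)[OF that] unfolding degree_in_le_iff by blast
    then have "es ! v \<le> D" if "v < q" for v using that len[OF \<open>(a, es) \<in> set t\<close>] by (force simp: nth_default_def)
    then show ?thesis using len[OF that] by (auto simp: set_conv_nth)
  qed
  have "set (map snd t) \<subseteq> {es. set es \<subseteq> {..D} \<and> length es = q}"
    using entries len by fastforce
  moreover have "length t = card (set (map snd t))" using distinct_card[OF dist] by simp
  ultimately have "length t \<le> card {es. set es \<subseteq> {..D} \<and> length es = q}"
    by (metis card_mono finite_lists_length_eq finite_atMost)
  also have "\<dots> = (D + 1) ^ q" by (simp add: card_lists_length_eq)
  finally show "length t \<le> (D + 1) ^ q" .
qed

text \<open>\<open>lg j\<close> is the Lagrange basis polynomial of node \<open>j\<close>. The
  interpolant and \<open>W i\<close> have degree at most \<open>n\<close> and agree at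
  \<open>n + 1\<close> nodes. The program compares nodes by value, which injectivity of
  \<open>c\<close> turns into comparing indices.\<close>

lemma result_switch_t:
  assumes W: "switch_polys n c W" and c: "inj_on c {..n}" and "i < n"
  shows "result (switch_t (map c [0..<Suc n]) (map c [Suc i..<Suc n]) z) = poly (W i) z"
proof -
  define lg where "lg j = (\<Prod>j'\<in>{..n} - {j}. smult (1 / (c j - c j')) [:- c j', 1:])" for j
  define p where "p = (\<Sum>j\<in>{Suc i..n}. lg j)"
  have poly_lg: "poly (lg j) x = (\<Prod>j'\<in>{..n} - {j}. (x - c j') / (c j - c j'))" for j x
    unfolding lg_def poly_prod by (intro prod.cong) (auto simp: diff_divide_distrib)
  have deg_lg: "degree (lg j) \<le> n" if "j \<le> n" for j
  proof -
    have "degree (lg j) \<le> (\<Sum>j'\<in>{..n} - {j}. 1)"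
      unfolding lg_def by (rule order_trans[OF degree_prod_sum_le sum_mono]) auto
    also have "\<dots> = n" using that by (simp add: card_Diff_singleton)
    finally show ?thesis .
  qed
  have "p = W i"
  proof (rule poly_eqI_degree[of "c ` {..n}"])
    show "poly p x = poly (W i) x" if x: "x \<in> c ` {..n}" for x
    proof -
      obtain j where j: "j \<le> n" "x = c j" using x by auto
      have "poly (lg j') x = (if j' = j then 1 else 0)" if "j' \<le> n" for j'
      proof (cases "j' = j")
        case True
        then show ?thesis
          using c j by (auto simp: poly_lg inj_on_eq_iff intro!: prod.neutral)
      next
        case False
        then have "j \<in> {..n} - {j'}" using j by auto
        then show ?thesis using j False by (auto simp: poly_lg intro!: bexI[of _ j])
      qed
      then have "poly p x = (\<Sum>j'\<in>{Suc i..n}. if j' = j then 1 else 0)"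
        unfolding p_def poly_sum by (intro sum.cong) auto
      then show ?thesis using W j \<open>i < n\<close> by (auto simp: switch_polys_def)
    qed
    have card: "card (c ` {..n}) = Suc n" using c by (simp add: card_image)
    have "degree p \<le> n" unfolding p_def by (intro degree_sum_le) (auto intro: deg_lg)
    then show "card (c ` {..n}) > degree p" using card by simp
    show "card (c ` {..n}) > degree (W i)"
      using W \<open>i < n\<close> card by (simp add: switch_polys_def less_Suc_eq_le)
  qed
  have "result (switch_t (map c [0..<Suc n]) (map c [Suc i..<Suc n]) z) =
    (\<Sum>j\<in>{Suc i..n}. \<Prod>j'\<in>{..n}. if c j' = c j then 1 else (z - c j') / (c j - c j'))"
    unfolding switch_t_def result_sum_t result_prod_t result_tick map_map comp_def
    by (subst sum_list_distinct_conv_sum_set, simp, subst prod.distinct_set_conv_list[symmetric], simp)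
      (simp add: atLeastLessThanSuc_atLeastAtMost atLeast0AtMost del: upt_Suc)
  also have "\<dots> = (\<Sum>j\<in>{Suc i..n}. poly (lg j) z)"
  proof (intro sum.cong refl)
    fix j assume "j \<in> {Suc i..n}"
    then have "(\<Prod>j'\<in>{..n}. if c j' = c j then 1 else (z - c j') / (c j - c j'))
      = (\<Prod>j'\<in>insert j ({..n} - {j}). if j' = j then 1 else (z - c j') / (c j - c j'))"
      using c by (intro prod.cong) (auto simp: inj_on_eq_iff)
    also have "\<dots> = poly (lg j) z" unfolding poly_lg by (subst prod.insert) (auto intro!: prod.cong)
    finally show "(\<Prod>j'\<in>{..n}. if c j' = c j then 1 else (z - c j') / (c j - c j')) = poly (lg j) z" .
  qed
  also have "\<dots> = poly (W i) z" using \<open>p = W i\<close> by (simp add: p_def poly_sum[symmetric])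
  finally show ?thesis .
qed

lemma length_S_step_t [simp]: "length (result (S_step_t cs ds z y ts vs)) = min (length ts) (length vs)"
  by (induction cs ds z y ts vs rule: S_step_t.induct) auto

text \<open>The program drops one node of \<open>ds\<close> per component.\<close>

lemma nth_S_step_t:
  "i < length ts \<Longrightarrow> i < length vs \<Longrightarrow> result (S_step_t cs ds z y ts vs) ! i =
    vs ! i * result (switch_t cs (drop i ds) z)
    + result (sparse_eval_t (ts ! i) y) * (1 - result (switch_t cs (drop i ds) z))"
proof (induction cs ds z y ts vs arbitrary: i rule: S_step_t.induct)
  case (1 cs ds z y t ts v vs)
  then show ?case by (cases i) (auto simp: drop_Suc)
qed auto

lemma result_S_step_t:
  assumes W: "switch_polys n c W" and c: "inj_on c {..n}"
    and ts: "length ts = n" "\<And>i. i < n \<Longrightarrow> sparse_rep q (ts ! i) (L i)"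
    and y: "length y = q" and ys: "length ys = l" "length zs = l"
  shows "result (S_step_t (map c [0..<Suc n]) (tl (map c [0..<Suc n])) z y ts (map (\<lambda>i. S_gen W L l i ys zs) [0..<n]))
    = map (\<lambda>i. S_gen W L (Suc l) i (ys @ [y]) (zs @ [z])) [0..<n]"
proof (rule nth_equalityI)
  fix i assume "i < length (result (S_step_t (map c [0..<Suc n]) (tl (map c [0..<Suc n])) z y ts
    (map (\<lambda>i. S_gen W L l i ys zs) [0..<n])))"
  then have i: "i < n" using ts by simp
  have "drop i (tl (map c [0..<Suc n])) = map c [Suc i..<Suc n]"
    by (simp add: drop_map map_tl[symmetric] tl_upt del: upt_Suc)
  then have "result (switch_t (map c [0..<Suc n]) (drop i (tl (map c [0..<Suc n]))) z) = poly (W i) z"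
    using result_switch_t[OF W c i] by simp
  then show "result (S_step_t (map c [0..<Suc n]) (tl (map c [0..<Suc n])) z y ts
      (map (\<lambda>i. S_gen W L l i ys zs) [0..<n])) ! i = map (\<lambda>i. S_gen W L (Suc l) i (ys @ [y]) (zs @ [z])) [0..<n] ! i"
    using i ts y ys
    by (subst nth_S_step_t) (auto simp: result_sparse_eval_t[OF ts(2)] S_gen_snoc simp del: upt_Suc S_gen.simps)
qed (use ts in simp)

lemma set_S_points_t:
  assumes W: "switch_polys n c W" and c: "inj_on c {..n}"
    and ts: "length ts = n" "\<And>i. i < n \<Longrightarrow> sparse_rep q (ts ! i) (L i)"
    and yss: "\<And>y. y \<in> set yss \<Longrightarrow> length y = q"
  shows "set (result (S_points_t (map c [0..<Suc n]) ts yss us l)) =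
    (\<lambda>(ys, zs). map (\<lambda>i. S_gen W L l i ys zs) [0..<n]) ` (tuples (set yss) l \<times> tuples (set us) l)"
proof (induction l)
  case 0
  have "map (\<lambda>_. 0) ts = map (\<lambda>i. 0) [0..<n]" using ts(1) by (auto intro: nth_equalityI)
  then show ?case by simp
next
  case (Suc l)
  have "set (result (S_points_t (map c [0..<Suc n]) ts yss us (Suc l))) =
    (\<Union>vs\<in>set (result (S_points_t (map c [0..<Suc n]) ts yss us l)). \<Union>y\<in>set yss. \<Union>z\<in>set us.
      {result (S_step_t (map c [0..<Suc n]) (tl (map c [0..<Suc n])) z y ts vs)})"
    by (auto simp del: upt_Suc)
  also have "\<dots> = (\<Union>(ys, zs)\<in>tuples (set yss) l \<times> tuples (set us) l. \<Union>y\<in>set yss. \<Union>z\<in>set us.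
      {map (\<lambda>i. S_gen W L (Suc l) i (ys @ [y]) (zs @ [z])) [0..<n]})"
    unfolding Suc.IH UN_simps(10)
  proof (rule SUP_cong[OF refl])
    fix p assume p: "p \<in> tuples (set yss) l \<times> tuples (set us) l"
    obtain ys zs where yz: "p = (ys, zs)" by (cases p)
    have "result (S_step_t (map c [0..<Suc n]) (tl (map c [0..<Suc n])) z y ts (map (\<lambda>i. S_gen W L l i ys zs) [0..<n]))
      = map (\<lambda>i. S_gen W L (Suc l) i (ys @ [y]) (zs @ [z])) [0..<n]" if "y \<in> set yss" for y z
      using that p yz yss by (intro result_S_step_t[where q = q] W c ts) (auto simp: tuples_def)
    then show "(\<Union>y\<in>set yss. \<Union>z\<in>set us. {result (S_step_t (map c [0..<Suc n]) (tl (map c [0..<Suc n])) z y ts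
        (case p of (ys, zs) \<Rightarrow> map (\<lambda>i. S_gen W L l i ys zs) [0..<n]))}) =
      (case p of (ys, zs) \<Rightarrow> \<Union>y\<in>set yss. \<Union>z\<in>set us.
        {map (\<lambda>i. S_gen W L (Suc l) i (ys @ [y]) (zs @ [z])) [0..<n]})"
      unfolding yz by (simp del: upt_Suc S_gen.simps)
  qed
  also have "\<dots> = (\<lambda>(ys, zs). map (\<lambda>i. S_gen W L (Suc l) i ys zs) [0..<n]) `
      (tuples (set yss) (Suc l) \<times> tuples (set us) (Suc l))"
    unfolding tuples_Suc_snoc by (force simp del: S_gen.simps)
  finally show ?case .
qed

section \<open>Running time\<close>

lemma steps_map_t:
  "(\<And>x. x \<in> set xs \<Longrightarrow> steps (f x) \<le> B) \<Longrightarrow> steps (map_t f xs) \<le> length xs * (B + 1) + 1"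
proof (induction xs)
  case (Cons x xs)
  then have "steps (f x) \<le> B" "steps (map_t f xs) \<le> length xs * (B + 1) + 1" by auto
  then show ?case by simp
qed simp

lemma steps_sum_t:
  "(\<And>x. x \<in> set xs \<Longrightarrow> steps (f x) \<le> B) \<Longrightarrow> steps (sum_t f xs) \<le> length xs * (B + 1) + 1"
proof (induction xs)
  case (Cons x xs)
  then have "steps (f x) \<le> B" "steps (sum_t f xs) \<le> length xs * (B + 1) + 1" by auto
  then show ?case by simp
qed simp

lemma steps_prod_t:
  "(\<And>x. x \<in> set xs \<Longrightarrow> steps (f x) \<le> B) \<Longrightarrow> steps (prod_t f xs) \<le> length xs * (B + 1) + 1"
proof (induction xs)
  case (Cons x xs)
  then have "steps (f x) \<le> B" "steps (prod_t f xs) \<le> length xs * (B + 1) + 1" by auto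
  then show ?case by simp
qed simp

lemma steps_append_t [simp]: "steps (append_t xs ys) = length xs + 1"
  by (induction xs) auto

text \<open>Appending costs the length of its first argument, so \<open>B\<close> has to cover
  result lengths as well.\<close>

lemma steps_concat_map_t:
  "(\<And>x. x \<in> set xs \<Longrightarrow> steps (f x) + length (result (f x)) \<le> B) \<Longrightarrow>
    steps (concat_map_t f xs) \<le> length xs * (B + 1) + 1"
proof (induction xs)
  case (Cons x xs)
  then have "steps (f x) + length (result (f x)) \<le> B" "steps (concat_map_t f xs) \<le> length xs * (B + 1) + 1"
    by auto
  then show ?case by simp
qed simp

lemma steps_power_t [simp]: "steps (power_t x e) = e + 1"
  by (induction e) auto

lemma steps_enum_t [simp]: "steps (enum_t f i r) = r + 1"
  by (induction r arbitrary: i) auto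

text \<open>Geometric growth, as there are at least two elements: the bound for \<open>q\<close> is
  at most half of that for \<open>Suc q\<close>, and the other half absorbs the new level.\<close>

lemma steps_tuples_t:
  assumes "2 \<le> length us"
  shows "steps (tuples_t us q) \<le> 12 * length us ^ Suc q"
proof (induction q)
  case (Suc q)
  let ?N = "length us"
  have N: "1 \<le> ?N ^ q" "2 * ?N ^ Suc q \<le> ?N ^ Suc (Suc q)" "?N \<le> ?N ^ Suc q"
    using assms by auto
  have "steps (map_t (\<lambda>ys. tick (u # ys)) (result (tuples_t us q))) \<le> ?N ^ q * 2 + 1" for u
    using steps_map_t[of "result (tuples_t us q)" "\<lambda>ys. tick (u # ys)" 1] by (simp add: mult_2)
  then have "steps (concat_map_t (\<lambda>u. map_t (\<lambda>ys. tick (u # ys)) (result (tuples_t us q))) us)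
    \<le> ?N * ((?N ^ q * 2 + 1 + ?N ^ q) + 1) + 1"
    by (intro steps_concat_map_t) (simp add: mult.commute)
  also have "\<dots> = 3 * ?N ^ Suc q + 2 * ?N + 1" by (simp add: algebra_simps)
  finally have "steps (tuples_t us (Suc q)) \<le> steps (tuples_t us q) + (3 * ?N ^ Suc q + 2 * ?N + 1)"
    by simp
  then show ?case using Suc N(2,3) assms by linarith
qed (use assms in simp)

lemma steps_monomial_t: "set es \<subseteq> {..<n} \<Longrightarrow> steps (monomial_t es ys) \<le> length es * (n + 1) + 1"
  by (induction es ys rule: monomial_t.induct) auto

lemma steps_sparse_eval_t:
  assumes "length t \<le> N" "\<And>a es. (a, es) \<in> set t \<Longrightarrow> length es = q \<and> set es \<subseteq> {..<n}"
  shows "steps (sparse_eval_t t y) \<le> N * (q * (n + 1) + 3) + 1"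
proof -
  have "steps (sparse_eval_t t y) \<le> length t * ((q * (n + 1) + 2) + 1) + 1"
    unfolding sparse_eval_t_def
    by (rule steps_sum_t) (use assms(2) steps_monomial_t[of _ n y] in fastforce)
  also have "\<dots> \<le> N * (q * (n + 1) + 3) + 1" using mult_le_mono1[OF assms(1), of "q * (n + 1) + 3"]
    by (simp add: algebra_simps)
  finally show ?thesis .
qed

lemma steps_switch_t: "steps (switch_t cs ds z) \<le> length ds * (2 * length cs + 2) + 1"
proof -
  have "steps (prod_t (\<lambda>c'. tick (if c' = c then 1 else (z - c') / (c - c'))) cs) \<le> length cs * (1 + 1) + 1" for c
    by (rule steps_prod_t) simp
  then show ?thesis
    unfolding switch_t_def
    using steps_sum_t[of ds "\<lambda>c. prod_t (\<lambda>c'. tick (if c' = c then 1 else (z - c') / (c - c'))) cs"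
      "length cs * (1 + 1) + 1"] by (simp add: mult_2 algebra_simps)
qed

lemma steps_S_step_t:
  assumes "\<And>t. t \<in> set ts \<Longrightarrow> steps (sparse_eval_t t y) \<le> E" "length ds \<le> r"
  shows "steps (S_step_t cs ds z y ts vs) \<le> length ts * (r * (2 * length cs + 2) + E + 2) + 1"
  using assms
proof (induction cs ds z y ts vs rule: S_step_t.induct)
  case (1 cs ds z y t ts v vs)
  have "steps (switch_t cs ds z) \<le> r * (2 * length cs + 2) + 1"
    using steps_switch_t[of cs ds z] 1(3) by (meson add_le_mono1 mult_le_mono1 order_trans)
  moreover have "steps (S_step_t cs (tl ds) z y ts vs) \<le> length ts * (r * (2 * length cs + 2) + E + 2) + 1"
    using 1 by (intro 1(1)) auto
  moreover have "steps (sparse_eval_t t y) \<le> E" using 1(2) by simp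
  ultimately show ?case by simp
qed auto

lemma length_S_points_t:
  "length (result (S_points_t cs ts yss us l)) = (length yss * length us) ^ l"
  by (induction l) (auto simp: length_concat comp_def sum_list_triv)

text \<open>\<open>X\<close> bounds the branching per layer. A new layer costs at most
  \<open>X ^ l * X * X ^ 2\<close>, as much as the bound for all earlier ones, and the doubling is
  absorbed by one more factor \<open>X\<close>.\<close>

lemma steps_S_points_t:
  assumes step: "\<And>ds z y vs. length ds \<le> length cs - 1 \<Longrightarrow> y \<in> set yss \<Longrightarrow> steps (S_step_t cs ds z y ts vs) \<le> E"
    and P: "P = length yss * length us" "P \<le> X" "0 < length us" "E + 7 \<le> X ^ 2" "2 * length ts + 2 \<le> X" "2 \<le> X"
  shows "steps (S_points_t cs ts yss us l) \<le> X ^ (l + 3)"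
proof (induction l)
  case 0
  have "steps (S_points_t cs ts yss us 0) \<le> 2 * length ts + 2"
    using steps_map_t[of ts "\<lambda>_. tick 0" 1] by (simp add: mult_2)
  also have "\<dots> \<le> X ^ 1" using P by simp
  also have "\<dots> \<le> X ^ (0 + 3)" using P(6) by (intro power_increasing) auto
  finally show ?case .
next
  case (Suc l)
  let ?N = "length us" and ?Y = "length yss"
  let ?V = "result (S_points_t cs ts yss us l)"
  have m: "steps (map_t (\<lambda>z. S_step_t cs (tl cs) z y ts vs) us) \<le> ?N * (E + 1) + 1" if "y \<in> set yss" for y vs
    using that by (intro steps_map_t step) auto
  have c: "steps (concat_map_t (\<lambda>y. map_t (\<lambda>z. S_step_t cs (tl cs) z y ts vs) us) yss)
      \<le> ?Y * ((?N * (E + 1) + 1 + ?N) + 1) + 1" for vs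
    by (rule steps_concat_map_t) (use m in \<open>simp add: algebra_simps\<close>)
  have "steps (concat_map_t (\<lambda>vs. concat_map_t (\<lambda>y. map_t (\<lambda>z. S_step_t cs (tl cs) z y ts vs) us) yss) ?V)
      \<le> length ?V * ((?Y * ((?N * (E + 1) + 1 + ?N) + 1) + 1 + P) + 1) + 1"
    by (rule steps_concat_map_t) (use c in \<open>simp add: length_concat comp_def sum_list_triv P(1)\<close>)
  also have "\<dots> \<le> X ^ l * (X * (E + 7)) "
  proof -
    have "?Y * 1 \<le> P" unfolding P(1) using P(3) by (intro mult_le_mono2) linarith
    moreover have "(?Y * ((?N * (E + 1) + 1 + ?N) + 1) + 1 + P) + 1 = P * (E + 3) + 2 * ?Y + 2"
      by (simp add: P(1) algebra_simps)
    ultimately have "(?Y * ((?N * (E + 1) + 1 + ?N) + 1) + 1 + P) + 1 \<le> P * (E + 5) + 2"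
      by (simp add: distrib_left)
    also have "\<dots> \<le> X * (E + 5) + 2" using P(2) by simp
    also have "\<dots> + 1 \<le> X * (E + 7)" using P(6) by (simp add: algebra_simps)
    finally have *: "((?Y * ((?N * (E + 1) + 1 + ?N) + 1) + 1 + P) + 1) + 1 \<le> X * (E + 7)" by simp
    have V: "length ?V \<le> X ^ l" unfolding length_S_points_t using P(1,2) by (simp add: power_mono)
    have "length ?V * ((?Y * ((?N * (E + 1) + 1 + ?N) + 1) + 1 + P) + 1) + 1
      \<le> X ^ l * ((?Y * ((?N * (E + 1) + 1 + ?N) + 1) + 1 + P) + 1) + X ^ l"
      using V P(6) by (intro add_mono mult_le_mono1) auto
    also have "\<dots> = X ^ l * (((?Y * ((?N * (E + 1) + 1 + ?N) + 1) + 1 + P) + 1) + 1)"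
      by (simp add: algebra_simps)
    also have "\<dots> \<le> X ^ l * (X * (E + 7))" using * by (rule mult_le_mono2)
    finally show ?thesis .
  qed
  also have "\<dots> \<le> X ^ l * (X * X ^ 2)" using P(4) by (intro mult_le_mono2)
  also have "\<dots> = X ^ (l + 3)" by (simp add: power_add power_numeral_reduce)
  finally have "steps (S_points_t cs ts yss us (Suc l)) \<le> X ^ (l + 3) + X ^ (l + 3)" using Suc by simp
  also have "\<dots> \<le> X * X ^ (l + 3)" using P(6) mult_le_mono1[of 2 X] by (simp add: mult_2[symmetric])
  also have "\<dots> = X ^ (Suc l + 3)" by (simp only: add_Suc power_Suc)
  finally show ?case .
qed

section \<open>Size of the hitting set\<close>

lemma card_tuples: "finite A \<Longrightarrow> card (tuples A r) = card A ^ r"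
  unfolding tuples_def using card_lists_length_eq[of A r] by (simp add: conj_commute)

lemma finite_tuples: "finite A \<Longrightarrow> finite (tuples A r)"
  unfolding tuples_def using finite_lists_length_eq[of A r] by (simp add: conj_commute)

lemma card_S_image: "finite U \<Longrightarrow> card (S_image W L n q k U) \<le> card U ^ ((q + 1) * k)"
proof -
  assume fin: "finite U"
  have "card (S_image W L n q k U) \<le> card (tuples (tuples U q) k \<times> tuples U k)"
    unfolding S_image_def using fin by (intro card_image_le finite_cartesian_product finite_tuples)
  also have "\<dots> = card U ^ ((q + 1) * k)"
    using fin by (simp add: card_cartesian_product card_tuples finite_tuples power_mult[symmetric] power_add[symmetric] algebra_simps)
  finally show ?thesis .
qed

text \<open>\<open>n\<close> to the power \<open>log n m\<close> is \<open>m\<close>; the maximum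
  with 1 covers \<open>m \<le> n\<close>, where \<open>q \<le> C\<close>.\<close>

lemma power_le_of_log_bound:
  fixes n m q C :: nat
  assumes "2 \<le> n" "1 \<le> m" "real q \<le> real C * max 1 (log (real n) (real m))"
  shows "n ^ q \<le> n ^ C * m ^ C"
proof -
  have *: "real n ^ q = real n powr real q" using assms(1) by (simp add: powr_realpow)
  have "real (n ^ q) \<le> real (n ^ C * m ^ C)"
  proof (cases "log (real n) (real m) \<le> 1")
    case True
    then have "q \<le> C" using assms(3) by simp
    then have "n ^ q * 1 \<le> n ^ C * m ^ C" using assms by (intro mult_mono power_increasing) auto
    then show ?thesis by (simp only: of_nat_le_iff mult_1_right)
  next
    case False
    then have "real n ^ q \<le> real n powr (real C * log (real n) (real m))"
      unfolding * using assms by (intro powr_mono) auto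
    also have "\<dots> = real m ^ C"
      using assms by (simp add: mult.commute[of "real C"] powr_powr[symmetric] powr_realpow)
    also have "\<dots> \<le> real n ^ C * real m ^ C" using assms by (simp add: mult_le_cancel_right1)
    finally show ?thesis by simp
  qed
  then show ?thesis by (simp only: of_nat_le_iff)
qed

lemma U_size_bounds:
  assumes "2 \<le> n" "2 \<le> e" "d \<le> n ^ e"
  shows "U_size n d \<le> n ^ (e + 2)" "n * d < U_size n d" "n ^ 3 < U_size n d"
proof -
  have "n ^ 3 \<le> n ^ (e + 1)" using assms by (intro power_increasing) auto
  moreover have "n * d \<le> n ^ (e + 1)" using assms(3) by simp
  ultimately have "U_size n d \<le> n ^ (e + 1) + 1" by (simp add: U_size_def)
  also have "\<dots> \<le> n ^ (e + 1) * 2" using assms(1) by simp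
  also have "\<dots> \<le> n ^ (e + 1) * n" using assms(1) by (intro mult_le_mono2)
  finally show "U_size n d \<le> n ^ (e + 2)" by (simp add: mult.commute)
qed (simp_all add: U_size_def)

section \<open>Unmixed circuits\<close>

lemma embed_poly_as_sum:
  fixes g :: "'a::comm_ring_1 poly"
  assumes "degree g \<le> N"
  shows "embed_poly t g = (\<Sum>e\<le>N. Poly_Mapping.single (Poly_Mapping.single t e) (coeff g e))"
proof (rule poly_mapping_eqI)
  fix \<mu>
  have "Poly_Mapping.lookup (\<Sum>e\<le>N. Poly_Mapping.single (Poly_Mapping.single t e) (coeff g e)) \<mu>
    = (\<Sum>e\<le>N. if e = Poly_Mapping.lookup \<mu> t \<and> Poly_Mapping.keys \<mu> \<subseteq> {t} then coeff g e else 0)"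
    unfolding lookup_sum lookup_single when_def
    by (intro sum.cong refl) (auto simp: keys_subset_singleton single_eq_single_iff simp del: keys_single)
  also have "\<dots> = Poly_Mapping.lookup (embed_poly t g) \<mu>"
    using assms by (cases "Poly_Mapping.keys \<mu> \<subseteq> {t}") (auto simp: lookup_embed_poly coeff_eq_0)
  finally show "Poly_Mapping.lookup (embed_poly t g) \<mu> =
    Poly_Mapping.lookup (\<Sum>e\<le>N. Poly_Mapping.single (Poly_Mapping.single t e) (coeff g e)) \<mu>" by simp
qed

lemma peval_embed_poly: "peval x (embed_poly t g) = poly g (x t)"
proof -
  have "peval x (Poly_Mapping.single (Poly_Mapping.single t e) a) = a * x t ^ e" for e a
    by (simp add: peval_single)
  then show ?thesis
    by (simp add: embed_poly_as_sum[OF order_refl] peval_sum poly_altdef)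
qed

lemma embed_poly_exists:
  assumes "vars f \<subseteq> {t}"
  obtains g where "f = embed_poly t g"
proof -
  have "finite {e. Poly_Mapping.lookup f (Poly_Mapping.single t e) \<noteq> 0}"
    using finite_vimageI[OF finite_keys[of f] inj_on_single[of t UNIV]] by (simp add: vimage_def in_keys_iff)
  then obtain N where N: "\<And>e. Poly_Mapping.lookup f (Poly_Mapping.single t e) \<noteq> 0 \<Longrightarrow> e \<le> N"
    using finite_nat_set_iff_bounded_le by auto
  define g where "g = Abs_poly (\<lambda>e. Poly_Mapping.lookup f (Poly_Mapping.single t e))"
  have g: "coeff g e = Poly_Mapping.lookup f (Poly_Mapping.single t e)" for e
    unfolding g_def using N by (subst coeff_Abs_poly[of N]) (auto simp: not_less[symmetric])
  have "f = embed_poly t g"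
  proof (rule poly_mapping_eqI)
    fix \<mu>
    show "Poly_Mapping.lookup f \<mu> = Poly_Mapping.lookup (embed_poly t g) \<mu>"
    proof (cases "Poly_Mapping.keys \<mu> \<subseteq> {t}")
      case True
      then obtain e where "\<mu> = Poly_Mapping.single t e" by (auto simp: keys_subset_singleton)
      then show ?thesis by (auto simp: lookup_embed_poly g)
    next
      case False
      then have "\<mu> \<notin> Poly_Mapping.keys f" using assms by (auto simp: vars_def)
      then show ?thesis using False by (simp add: lookup_embed_poly in_keys_iff)
    qed
  qed
  then show thesis by (rule that)
qed

lemma prod_single:
  fixes a :: "'i \<Rightarrow> 'a::comm_semiring_1" and \<mu> :: "'i \<Rightarrow> 'b::comm_monoid_add"
  shows "(\<Prod>i\<in>I. Poly_Mapping.single (\<mu> i) (a i)) = Poly_Mapping.single (\<Sum>i\<in>I. \<mu> i) (\<Prod>i\<in>I. a i)"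
  by (induction I rule: infinite_finite_induct) (auto simp: mult_single)

lemma lookup_sum_single:
  assumes "finite T"
  shows "Poly_Mapping.lookup (\<Sum>t\<in>T. Poly_Mapping.single t (\<kappa> t :: nat)) i = (if i \<in> T then \<kappa> i else 0)"
proof -
  have "Poly_Mapping.lookup (\<Sum>t\<in>T. Poly_Mapping.single t (\<kappa> t)) i = (\<Sum>t\<in>T. if t = i then \<kappa> i else 0)"
    unfolding lookup_sum by (intro sum.cong) (auto simp: lookup_single when_def)
  then show ?thesis using assms by simp
qed

text \<open>Each \<open>\<mu>\<close> supported in \<open>T\<close> arises from exactly one choice
  of exponents, its restriction to \<open>T\<close>. If that leaves the box, some coefficient is 0
  and both sides vanish.\<close>

lemma lookup_prod_embed_poly:
  fixes g :: "nat \<Rightarrow> 'a::comm_ring_1 poly"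
  assumes "finite T"
  shows "Poly_Mapping.lookup (\<Prod>t\<in>T. embed_poly t (g t)) \<mu> =
    (if Poly_Mapping.keys \<mu> \<subseteq> T then \<Prod>t\<in>T. coeff (g t) (Poly_Mapping.lookup \<mu> t) else 0)"
proof -
  obtain N where N: "\<And>i t. i \<in> {g} \<Longrightarrow> t \<in> T \<Longrightarrow> degree (i t) \<le> N"
    using degree_bound_exists[OF assms, of "{g}" "\<lambda>i. i"] by auto
  have "(\<Prod>t\<in>T. embed_poly t (g t)) =
    (\<Prod>t\<in>T. \<Sum>e\<le>N. Poly_Mapping.single (Poly_Mapping.single t e) (coeff (g t) e))"
    using N by (intro prod.cong refl embed_poly_as_sum) auto
  also have "\<dots> = (\<Sum>\<kappa>\<in>PiE T (\<lambda>_. {..N}). \<Prod>t\<in>T. Poly_Mapping.single (Poly_Mapping.single t (\<kappa> t)) (coeff (g t) (\<kappa> t)))"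
    using assms by (intro prod_sum_PiE) auto
  also have "\<dots> = (\<Sum>\<kappa>\<in>PiE T (\<lambda>_. {..N}).
      Poly_Mapping.single (\<Sum>t\<in>T. Poly_Mapping.single t (\<kappa> t)) (\<Prod>t\<in>T. coeff (g t) (\<kappa> t)))"
    by (simp add: prod_single)
  finally have "Poly_Mapping.lookup (\<Prod>t\<in>T. embed_poly t (g t)) \<mu> = (\<Sum>\<kappa>\<in>PiE T (\<lambda>_. {..N}).
      if (\<Sum>t\<in>T. Poly_Mapping.single t (\<kappa> t)) = \<mu> then \<Prod>t\<in>T. coeff (g t) (\<kappa> t) else 0)"
    by (simp add: lookup_sum lookup_single when_def)
  also have "\<dots> = (\<Sum>\<kappa>\<in>PiE T (\<lambda>_. {..N}).
      if \<kappa> = restrict (Poly_Mapping.lookup \<mu>) T then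
        if Poly_Mapping.keys \<mu> \<subseteq> T then \<Prod>t\<in>T. coeff (g t) (Poly_Mapping.lookup \<mu> t) else 0 else 0)"
  proof (intro sum.cong refl)
    fix \<kappa> assume \<kappa>: "\<kappa> \<in> PiE T (\<lambda>_. {..N})"
    have "(\<Sum>t\<in>T. Poly_Mapping.single t (\<kappa> t)) = \<mu> \<longleftrightarrow>
        (\<forall>i. (if i \<in> T then \<kappa> i else 0) = Poly_Mapping.lookup \<mu> i)"
      unfolding poly_mapping_eq_iff fun_eq_iff lookup_sum_single[OF assms] ..
    also have "\<dots> \<longleftrightarrow> \<kappa> = restrict (Poly_Mapping.lookup \<mu>) T \<and> Poly_Mapping.keys \<mu> \<subseteq> T"
    proof (intro iffI conjI)
      assume *: "\<forall>i. (if i \<in> T then \<kappa> i else 0) = Poly_Mapping.lookup \<mu> i"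
      show "\<kappa> = restrict (Poly_Mapping.lookup \<mu>) T"
      proof
        fix i show "\<kappa> i = restrict (Poly_Mapping.lookup \<mu>) T i"
          using *[rule_format, of i] PiE_arb[OF \<kappa>, of i] by (cases "i \<in> T") auto
      qed
      show "Poly_Mapping.keys \<mu> \<subseteq> T"
      proof
        fix i assume "i \<in> Poly_Mapping.keys \<mu>"
        then show "i \<in> T" using *[rule_format, of i] by (cases "i \<in> T") (auto simp: in_keys_iff)
      qed
    next
      assume "\<kappa> = restrict (Poly_Mapping.lookup \<mu>) T \<and> Poly_Mapping.keys \<mu> \<subseteq> T"
      then show "\<forall>i. (if i \<in> T then \<kappa> i else 0) = Poly_Mapping.lookup \<mu> i"
        by (auto simp: in_keys_iff subset_iff)
    qed
    finally have "(\<Sum>t\<in>T. Poly_Mapping.single t (\<kappa> t)) = \<mu> \<longleftrightarrow>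
      \<kappa> = restrict (Poly_Mapping.lookup \<mu>) T \<and> Poly_Mapping.keys \<mu> \<subseteq> T" .
    then show "(if (\<Sum>t\<in>T. Poly_Mapping.single t (\<kappa> t)) = \<mu> then \<Prod>t\<in>T. coeff (g t) (\<kappa> t) else 0) =
      (if \<kappa> = restrict (Poly_Mapping.lookup \<mu>) T then
        if Poly_Mapping.keys \<mu> \<subseteq> T then \<Prod>t\<in>T. coeff (g t) (Poly_Mapping.lookup \<mu> t) else 0 else 0)"
      by auto
  qed
  also have "\<dots> = (if restrict (Poly_Mapping.lookup \<mu>) T \<in> PiE T (\<lambda>_. {..N}) \<and> Poly_Mapping.keys \<mu> \<subseteq> T
      then \<Prod>t\<in>T. coeff (g t) (Poly_Mapping.lookup \<mu> t) else 0)"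
    using assms by (auto simp: finite_PiE)
  also have "\<dots> = (if Poly_Mapping.keys \<mu> \<subseteq> T then \<Prod>t\<in>T. coeff (g t) (Poly_Mapping.lookup \<mu> t) else 0)"
  proof (cases "restrict (Poly_Mapping.lookup \<mu>) T \<in> PiE T (\<lambda>_. {..N})")
    case False
    then obtain t where "t \<in> T" "N < Poly_Mapping.lookup \<mu> t" by (auto simp: PiE_def Pi_def not_le)
    then have "coeff (g t) (Poly_Mapping.lookup \<mu> t) = 0" using N[of g t] by (intro coeff_eq_0) auto
    then have "(\<Prod>t\<in>T. coeff (g t) (Poly_Mapping.lookup \<mu> t)) = 0" using assms \<open>t \<in> T\<close> by (intro prod_zero) auto
    then show ?thesis using False by simp
  qed simp
  finally show ?thesis .
qed

lemma unmixed_circuit_polys: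
  fixes \<Phi> :: "'a::comm_ring_1 circuit"
  assumes "SPSP_circuit k s \<Phi>" "unmixed n \<Phi>"
  obtains F :: "nat \<Rightarrow> nat \<Rightarrow> 'a poly"
  where "computed_poly \<Phi> = (\<Sum>i<k. \<Prod>t<n. embed_poly t (F i t))"
    and "\<And>i t. card {e. coeff (F i t) e \<noteq> 0} \<le> s"
proof -
  have "\<exists>g. \<Phi> ! i ! t = embed_poly t g \<and> card {e. coeff g e \<noteq> 0} \<le> s" if "i < k" "t < n" for i t
  proof -
    have mem: "\<Phi> ! i \<in> set \<Phi>" "\<Phi> ! i ! t \<in> set (\<Phi> ! i)" "vars (\<Phi> ! i ! t) \<subseteq> {t}"
      using assms that by (auto simp: SPSP_circuit_def unmixed_def)
    obtain g where g: "\<Phi> ! i ! t = embed_poly t g" using embed_poly_exists[OF mem(3)] .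
    have "num_monomials (\<Phi> ! i ! t) = card {e. coeff g e \<noteq> 0}"
      unfolding num_monomials_def g keys_embed_poly by (rule card_image[OF inj_on_single])
    moreover have "num_monomials (\<Phi> ! i ! t) \<le> s"
      using mem(1,2) assms(1) unfolding SPSP_circuit_def by blast
    ultimately show ?thesis using g by auto
  qed
  \<comment> \<open>Out of range the zero polynomial witnesses the sparsity bound, which is wanted
    for all indices.\<close>
  then have "\<exists>g. (i < k \<and> t < n \<longrightarrow> \<Phi> ! i ! t = embed_poly t g) \<and> card {e. coeff g e \<noteq> 0} \<le> s" for i t
    by (cases "i < k \<and> t < n") (auto intro!: exI[of _ 0])
  then obtain F where F: "\<And>i t. i < k \<Longrightarrow> t < n \<Longrightarrow> \<Phi> ! i ! t = embed_poly t (F i t)"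
    "\<And>i t. card {e. coeff (F i t) e \<noteq> 0} \<le> s" by metis
  have "computed_poly \<Phi> = (\<Sum>i<k. prod_list (\<Phi> ! i))"
    using assms(1) by (simp add: computed_poly_def SPSP_circuit_def sum_list_sum_nth atLeast0LessThan)
  also have "\<dots> = (\<Sum>i<k. \<Prod>t<n. embed_poly t (F i t))"
  proof (intro sum.cong refl)
    fix i assume "i \<in> {..<k}"
    then have "length (\<Phi> ! i) = n" using assms by (auto simp: SPSP_circuit_def unmixed_def)
    then show "prod_list (\<Phi> ! i) = (\<Prod>t<n. embed_poly t (F i t))"
      using F(1) \<open>i \<in> {..<k}\<close> by (simp add: prod.list_conv_set_nth atLeast0LessThan)
  qed
  finally show thesis using that F(2) by blast
qed

lemma num_monomials_mult: "num_monomials (p * r) \<le> num_monomials p * num_monomials r"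
proof -
  have "Poly_Mapping.keys (p * r) \<subseteq> (\<lambda>(a, b). a + b) ` (Poly_Mapping.keys p \<times> Poly_Mapping.keys r)"
    using keys_mult[of p r] by auto
  then have "card (Poly_Mapping.keys (p * r)) \<le> card (Poly_Mapping.keys p \<times> Poly_Mapping.keys r)"
    by (meson card_image_le card_mono finite_SigmaI finite_imageI finite_keys order_trans)
  then show ?thesis by (simp add: num_monomials_def card_cartesian_product)
qed

lemma num_monomials_prod_le_1:
  fixes f :: "'i \<Rightarrow> 'a::comm_semiring_1 mpoly"
  shows "(\<And>i. i \<in> I \<Longrightarrow> num_monomials (f i) \<le> 1) \<Longrightarrow> num_monomials (\<Prod>i\<in>I. f i) \<le> 1"
proof (induction I rule: infinite_finite_induct)
  case (insert i I)
  then have "num_monomials (f i) * num_monomials (\<Prod>i\<in>I. f i) \<le> 1 * 1" by (intro mult_mono) auto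
  then show ?case using insert num_monomials_mult[of "f i" "\<Prod>i\<in>I. f i"] by simp
qed (simp_all add: num_monomials_def)

lemma num_monomials_sum_le:
  assumes "finite I" "\<And>i. i \<in> I \<Longrightarrow> num_monomials (f i) \<le> 1"
  shows "num_monomials (\<Sum>i\<in>I. f i) \<le> card I"
proof -
  have "num_monomials (\<Sum>i\<in>I. f i) \<le> card (\<Union>i\<in>I. Poly_Mapping.keys (f i))"
    unfolding num_monomials_def using assms(1) by (intro card_mono keys_sum_subset) auto
  also have "\<dots> \<le> (\<Sum>i\<in>I. card (Poly_Mapping.keys (f i)))" using assms(1) by (rule card_UN_le)
  also have "\<dots> \<le> (\<Sum>i\<in>I. 1)" using assms(2) by (intro sum_mono) (auto simp: num_monomials_def)
  finally show ?thesis by simp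
qed

context S_generator
begin

text \<open>The recursion telescopes:
  \<open>a * (1 - w) * W + a * (1 - W) = a * (1 - w * W)\<close>.\<close>

lemma S_gen_equal_blocks:
  "length zs = l \<Longrightarrow> S_gen W L l i (replicate l y) zs = peval ((!) y) (L i) * (1 - W_prod zs i)"
proof (induction l arbitrary: zs)
  case (Suc l)
  obtain zs' z where zs: "zs = zs' @ [z]" "length zs' = l" using Suc.prems by (cases zs rule: rev_cases) auto
  have "replicate (Suc l) y = replicate l y @ [y]" by (simp add: replicate_append_same)
  then have "S_gen W L (Suc l) i (replicate (Suc l) y) zs =
      S_gen W L l i (replicate l y) zs' * poly (W i) z + peval ((!) y) (L i) * (1 - poly (W i) z)"
    using zs by (simp only: S_gen_snoc length_replicate)
  then show ?case using Suc.IH[OF zs(2)] zs(1) by (simp add: algebra_simps)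
qed simp

lemma S_gen_hits_few_monomials:
  fixes P :: "'a mpoly"
  assumes "P \<noteq> 0" "vars P \<subseteq> {..<n}" "num_monomials P \<le> k" "total_degree P \<le> d"
    and "1 \<le> m" "(n - 1) * n < card U"
  shows "\<exists>ys\<in>tuples (tuples U q) k. \<exists>zs\<in>tuples U k. peval (\<lambda>i. S_gen W L k i ys zs) P \<noteq> 0"
proof -
  \<comment> \<open>Single variables are 1-sparse of degree 1, so \<open>L\<close> hits all of them
    at one \<open>y\<close>; the product of \<open>n\<close> components has individual degrees at
    most \<open>(n - 1) * n\<close>. For \<open>d = 0\<close> no variable occurs and any
    \<open>y\<close> does.\<close>
  have "\<exists>y\<in>tuples U q. 1 \<le> d \<longrightarrow> (\<forall>i<n. peval ((!) y) (L i) \<noteq> 0)"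
  proof (cases "1 \<le> d")
    case True
    have "{e. coeff (monom (1 :: 'a) 1) e \<noteq> 0} = {1}" by auto
    then have "\<exists>y\<in>tuples U q. \<forall>t\<in>{..<n}. poly (monom 1 1) (peval ((!) y) (L t)) \<noteq> 0"
      using True assms(5,6)
      by (intro generator_hits_product[OF gen L_degree _ _ _ _ U(1)]) (auto simp: monom_eq_0_iff degree_monom_eq)
    then show ?thesis by (auto simp: poly_monom)
  next
    case False
    obtain u where "u \<in> U" using U by fastforce
    then show ?thesis using False by (intro bexI[of _ "replicate q u"]) (auto simp: tuples_def)
  qed
  then obtain y where y: "y \<in> tuples U q" "\<And>i. 1 \<le> d \<Longrightarrow> i < n \<Longrightarrow> peval ((!) y) (L i) \<noteq> 0" by blast
  define K where "K = Poly_Mapping.lookup ` Poly_Mapping.keys P"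
  \<comment> \<open>The values of \<open>L\<close> at \<open>y\<close> are absorbed into the
    coefficients, leaving monomials in \<open>1 - W_prod zs i\<close>.\<close>
  define a where "a \<kappa> = Poly_Mapping.lookup P (Abs_poly_mapping \<kappa>) * (\<Prod>i<n. peval ((!) y) (L i) ^ \<kappa> i)" for \<kappa>
  have inj: "inj_on Poly_Mapping.lookup (Poly_Mapping.keys P)" by (intro inj_onI poly_mapping_eqI) simp
  have keys: "Poly_Mapping.keys \<mu> \<subseteq> {..<n}" if "\<mu> \<in> Poly_Mapping.keys P" for \<mu>
    using assms(2) that by (auto simp: vars_def)
  have deg: "(\<Sum>i<n. Poly_Mapping.lookup \<mu> i) \<le> d" if "\<mu> \<in> Poly_Mapping.keys P" for \<mu>
  proof -
    have "(\<Sum>i<n. Poly_Mapping.lookup \<mu> i) = (\<Sum>i\<in>Poly_Mapping.keys \<mu>. Poly_Mapping.lookup \<mu> i)"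
      using keys[OF that] by (intro sum.mono_neutral_right) (auto simp: in_keys_iff)
    then show ?thesis using assms(4) that unfolding total_degree_le_iff by simp
  qed
  have "\<exists>zs\<in>tuples U k. monomial_sum n K a (\<lambda>i. 1 - W_prod zs i) \<noteq> 0"
  proof (rule W_prod_hits_monomial_sum[where D = d])
    show "K \<noteq> {}" using assms(1) by (simp add: K_def)
    show "card K \<le> k" using assms(3) by (simp add: K_def card_image[OF inj] num_monomials_def)
    show "a \<kappa> \<noteq> 0" if \<kappa>: "\<kappa> \<in> K" for \<kappa>
    proof -
      obtain \<mu> where \<mu>: "\<mu> \<in> Poly_Mapping.keys P" "\<kappa> = Poly_Mapping.lookup \<mu>"
        using \<kappa> unfolding K_def by blast
      have "peval ((!) y) (L i) ^ \<kappa> i \<noteq> 0" if "i < n" for i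
      proof (cases "\<kappa> i = 0")
        case False
        then have "1 \<le> d" using deg[OF \<mu>(1)] member_le_sum[of i "{..<n}" \<kappa>] that \<mu>(2) by simp
        then show ?thesis using y(2) that by simp
      qed simp
      then show ?thesis using \<mu> by (simp add: a_def in_keys_iff)
    qed
    show "\<kappa> i = 0" if \<kappa>: "\<kappa> \<in> K" and i: "n \<le> i" for \<kappa> i
    proof -
      obtain \<mu> where \<mu>: "\<mu> \<in> Poly_Mapping.keys P" "\<kappa> = Poly_Mapping.lookup \<mu>"
        using \<kappa> unfolding K_def by blast
      then have "i \<notin> Poly_Mapping.keys \<mu>" using keys[OF \<mu>(1)] i by auto
      then show ?thesis using \<mu>(2) by (simp add: in_keys_iff)
    qed
  qed (auto simp: K_def deg)
  then obtain zs where zs: "zs \<in> tuples U k" "monomial_sum n K a (\<lambda>i. 1 - W_prod zs i) \<noteq> 0" by blast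
  have "peval (\<lambda>i. S_gen W L k i (replicate k y) zs) P =
    (\<Sum>\<mu>\<in>Poly_Mapping.keys P. Poly_Mapping.lookup P \<mu> *
      (\<Prod>i<n. (peval ((!) y) (L i) * (1 - W_prod zs i)) ^ Poly_Mapping.lookup \<mu> i))"
    unfolding peval_def using zs(1)
    by (intro sum.cong refl)
      (simp add: monomial_superset[OF finite_lessThan keys] S_gen_equal_blocks tuples_def peval_def[symmetric])
  also have "\<dots> = monomial_sum n K a (\<lambda>i. 1 - W_prod zs i)"
    unfolding monomial_sum_def K_def a_def sum.reindex[OF inj]
    by (simp add: power_mult_distrib prod.distrib mult.assoc)
  finally have "peval (\<lambda>i. S_gen W L k i (replicate k y) zs) P \<noteq> 0" using zs(2) by simp
  moreover have "replicate k y \<in> tuples (tuples U q) k" using y(1) by (auto simp: tuples_def)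
  ultimately show ?thesis using zs(1) by blast
qed

lemma S_image_hits_unmixed_class:
  assumes m: "m = s ^ (5 * k ^ 2 + 2)" and "1 \<le> s" "(n - 1) * n < card U"
  shows "hitting_set n (unmixed_class n k s d) (S_image W L n q k U)"
  unfolding hitting_set_def
proof (intro conjI ballI impI)
  show "S_image W L n q k U \<subseteq> {a. length a = n}" by (auto simp: S_image_def)
next
  fix P :: "'a mpoly" assume P: "P \<in> unmixed_class n k s d" "P \<noteq> 0"
  then obtain \<Phi> where \<Phi>: "SPSP_circuit k s \<Phi>" "unmixed n \<Phi>" "P = computed_poly \<Phi>" "total_degree P \<le> d"
    by (auto simp: unmixed_class_def)
  obtain F where F: "P = (\<Sum>i<k. \<Prod>t<n. embed_poly t (F i t))" "\<And>i t. card {e. coeff (F i t) e \<noteq> 0} \<le> s"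
    by (rule unmixed_circuit_polys[OF \<Phi>(1,2), folded \<Phi>(3)], rule that)
  have lookup: "Poly_Mapping.lookup P \<mu> = (if Poly_Mapping.keys \<mu> \<subseteq> {..<n} then
      \<Sum>i<k. 1 * (\<Prod>t<n. coeff (F i t) (Poly_Mapping.lookup \<mu> t)) else 0)" for \<mu>
    unfolding F(1) lookup_sum by (simp add: lookup_prod_embed_poly)
  have "Poly_Mapping.keys \<mu> \<subseteq> {..<n}" if "\<mu> \<in> Poly_Mapping.keys P" for \<mu>
    using that lookup[of \<mu>] by (cases "Poly_Mapping.keys \<mu> \<subseteq> {..<n}") (auto simp: in_keys_iff[of \<mu>])
  then have vars: "vars P \<subseteq> {..<n}" by (auto simp: vars_def)
  have peval: "peval x P = (\<Sum>i<k. 1 * (\<Prod>t<n. poly (F i t) (x t)))" for x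
    unfolding F(1) by (simp add: peval_sum peval_prod peval_embed_poly)
  have "\<exists>ys\<in>tuples (tuples U q) k. \<exists>zs\<in>tuples U k. peval (\<lambda>i. S_gen W L k i ys zs) P \<noteq> 0"
  proof (cases "s = 1")
    case True
    have "num_monomials (embed_poly t (F i t)) \<le> 1" for i t
      using F(2)[of i t] True by (simp add: num_monomials_def keys_embed_poly card_image[OF inj_on_single])
    then have "num_monomials P \<le> card {..<k}"
      unfolding F(1) by (intro num_monomials_sum_le num_monomials_prod_le_1) auto
    then show ?thesis
      using True m assms(3) by (intro S_gen_hits_few_monomials[OF P(2) vars _ \<Phi>(4)]) auto
  next
    case False
    \<comment> \<open>Of the exponent in \<open>m\<close> one factor \<open>s\<close> is set aside;
      the rest dominates \<open>k\<close> because \<open>s \<ge> 2\<close>.\<close>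
    have "k \<le> 2 ^ (5 * k ^ 2 + 1)"
    proof -
      have "k \<le> 5 * k ^ 2 + 1" using self_le_power[of k 2] by (cases k) auto
      also have "\<dots> \<le> 2 ^ (5 * k ^ 2 + 1)" using less_exp[of "5 * k ^ 2 + 1"] by (rule less_imp_le)
      finally show ?thesis .
    qed
    also have "\<dots> \<le> s ^ (5 * k ^ 2 + 1)" using False \<open>1 \<le> s\<close> by (intro power_mono) auto
    finally have "k * s \<le> m" unfolding m by simp
    have "\<exists>ys\<in>tuples (tuples U q) k. \<exists>zs\<in>tuples U k.
      (\<Sum>i<k. 1 * (\<Prod>t<n. poly (F i t) (S_gen W L k t ys zs))) \<noteq> 0"
    proof (rule S_gen_hits_sum_prod[OF F(2) \<open>k * s \<le> m\<close>])
      obtain \<mu> where "Poly_Mapping.lookup P \<mu> \<noteq> 0" using P(2) by (auto simp: poly_mapping_eq_iff fun_eq_iff)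
      then show "\<exists>\<kappa>. (\<Sum>i<k. 1 * (\<Prod>t<n. coeff (F i t) (\<kappa> t))) \<noteq> 0"
        unfolding lookup by (auto split: if_splits)
      \<comment> \<open>A tuple with nonzero combined coefficient is a monomial of \<open>P\<close>;
        here the total degree bound becomes the condition on tuples.\<close>
      show "(\<Sum>t<n. \<kappa> t) \<le> d" if nz: "(\<Sum>i<k. 1 * (\<Prod>t<n. coeff (F i t) (\<kappa> t))) \<noteq> 0" for \<kappa>
      proof -
        define \<mu> where "\<mu> = (\<Sum>t<n. Poly_Mapping.single t (\<kappa> t))"
        have \<mu>: "Poly_Mapping.lookup \<mu> i = (if i < n then \<kappa> i else 0)" for i
          unfolding \<mu>_def by (simp add: lookup_sum_single)
        then have keys: "Poly_Mapping.keys \<mu> \<subseteq> {..<n}" by (auto simp: in_keys_iff split: if_splits)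
        then have "\<mu> \<in> Poly_Mapping.keys P" using nz by (simp add: in_keys_iff lookup \<mu>)
        then have "(\<Sum>i\<in>Poly_Mapping.keys \<mu>. Poly_Mapping.lookup \<mu> i) \<le> d"
          using \<Phi>(4) unfolding total_degree_le_iff by blast
        moreover have "(\<Sum>i\<in>Poly_Mapping.keys \<mu>. Poly_Mapping.lookup \<mu> i) = (\<Sum>i<n. Poly_Mapping.lookup \<mu> i)"
          using keys by (intro sum.mono_neutral_left) (auto simp: in_keys_iff)
        ultimately show ?thesis by (simp add: \<mu>)
      qed
    qed auto
    then show ?thesis by (simp add: peval)
  qed
  then obtain ys zs where yz: "ys \<in> tuples (tuples U q) k" "zs \<in> tuples U k"
    "peval (\<lambda>i. S_gen W L k i ys zs) P \<noteq> 0" by blast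
  let ?a = "map (\<lambda>i. S_gen W L k i ys zs) [0..<n]"
  have "peval ((!) ?a) P = peval (\<lambda>i. S_gen W L k i ys zs) P" by (simp add: peval)
  moreover have "?a \<in> S_image W L n q k U" unfolding S_image_def using yz(1,2) by force
  ultimately show "\<exists>a\<in>S_image W L n q k U. peval ((!) a) P \<noteq> 0" using yz(3) by metis
qed

end

section \<open>The hitting set algorithm\<close>

text \<open>As \<open>q \<le> n ^ q\<close>, every factor is bounded by powers of \<open>B\<close>.
  The constant 9 is absorbed by \<open>B ^ 4\<close>, and
  \<open>2 * C + 7 \<le> 2 * (e + 2) * (C + 1)\<close> since \<open>e \<ge> 2\<close>.\<close>

lemma step_cost_le_power:
  fixes n q C B X e :: nat
  assumes "n \<le> B" "2 \<le> n" "n ^ q \<le> B ^ C" "2 \<le> e" "X = B ^ ((e + 2) * (C + 1))"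
  shows "n * (n * (2 * (n + 1) + 2) + (n ^ q * (q * (n + 1) + 3) + 1) + 2) + 1 + 7 \<le> X ^ 2"
proof -
  let ?\<beta> = "B ^ C"
  have B: "2 \<le> B" using assms by simp
  have \<beta>: "1 \<le> ?\<beta>" using B by simp
  have "q \<le> 2 ^ q" by (rule less_imp_le[OF less_exp])
  also have "2 ^ q \<le> n ^ q" using assms(2) by (rule power_mono) simp
  finally have q: "q \<le> ?\<beta>" using assms(3) by simp
  have "n * (n * (2 * (n + 1) + 2)) \<le> B * (B * (2 * (B + 1) + 2))"
    using assms(1) by (intro mult_mono add_mono) auto
  also have "\<dots> \<le> B * (B * (4 * B))" using B by (intro mult_le_mono2) simp
  finally have 1: "n * (n * (2 * (n + 1) + 2)) \<le> 4 * B ^ 3" by (simp add: power3_eq_cube)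
  have "n * (n ^ q * (q * (n + 1) + 3)) \<le> B * (?\<beta> * (?\<beta> * (B + 1) + ?\<beta> * 3))"
    using assms q \<beta> by (intro mult_mono add_mono) auto
  also have "?\<beta> * (B + 1) + ?\<beta> * 3 \<le> ?\<beta> * (3 * B)"
    unfolding distrib_left[symmetric] using B by (intro mult_le_mono2) simp
  finally have 2: "n * (n ^ q * (q * (n + 1) + 3)) \<le> 3 * (?\<beta> ^ 2 * B ^ 2)"
    by (simp add: power2_eq_square mult_ac)
  have 3: "n * 3 + 8 \<le> 2 * B ^ 3"
  proof -
    have "n * 3 + 8 \<le> 2 * (2 * (2 * B))" using assms(1) B by simp
    also have "\<dots> \<le> 2 * (B * (B * B))" using B by (intro mult_le_mono) auto
    finally show ?thesis by (simp add: power3_eq_cube)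
  qed
  have "n * (n * (2 * (n + 1) + 2) + (n ^ q * (q * (n + 1) + 3) + 1) + 2) + 1 + 7
    = n * (n * (2 * (n + 1) + 2)) + n * (n ^ q * (q * (n + 1) + 3)) + (n * 3 + 8)"
    by (simp add: algebra_simps)
  also have "\<dots> \<le> 6 * B ^ 3 + 3 * (?\<beta> ^ 2 * B ^ 2)" using 1 2 3 by linarith
  also have "\<dots> \<le> 6 * (?\<beta> ^ 2 * B ^ 3) + 3 * (?\<beta> ^ 2 * B ^ 3)"
    using \<beta> B by (intro add_mono mult_le_mono2 power_increasing) auto
  also have "\<dots> \<le> 2 ^ 4 * (?\<beta> ^ 2 * B ^ 3)" by simp
  also have "\<dots> \<le> B ^ 4 * (?\<beta> ^ 2 * B ^ 3)" using B by (intro mult_le_mono1 power_mono) auto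
  also have "\<dots> = B ^ (2 * C + 7)" by (simp add: power_mult[symmetric] power_add[symmetric] ac_simps)
  also have "\<dots> \<le> X ^ 2"
  proof -
    have "2 * C + 7 \<le> 4 * (C + 1) * 2" by simp
    also have "\<dots> \<le> (e + 2) * (C + 1) * 2" using assms(4) by (intro mult_le_mono1) auto
    finally show ?thesis
      unfolding assms(5) power_mult[symmetric] using B by (intro power_increasing) auto
  qed
  finally show ?thesis .
qed

lemma hitting_set_t_unfold:
  fixes u c :: "nat \<Rightarrow> 'a::field" and n d :: nat
  assumes "result (L_alg (s ^ (5 * k ^ 2 + 2))) = (q, ts)"
  defines "us \<equiv> map u [0..<U_size n d]"
  shows "result (hitting_set_t L_alg u c n k s d)
      = result (S_points_t (map c [0..<Suc n]) ts (result (tuples_t us q)) us k)"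
    and "steps (hitting_set_t L_alg u c n k s d) =
      (5 * k ^ 2 + 2 + 1) + (steps (L_alg (s ^ (5 * k ^ 2 + 2))) + ((U_size n d + 1) + ((n + 1 + 1) +
      (steps (tuples_t us q) + steps (S_points_t (map c [0..<Suc n]) ts (result (tuples_t us q)) us k)))))"
  unfolding hitting_set_t_def us_def
  by (simp_all only: result_bind result_power_t steps_power_t assms(1) prod.case result_enum_t
      steps_enum_t add_0 Suc_eq_plus1)

lemma steps_hitting_set_t:
  fixes L :: "nat \<Rightarrow> 'a::field mpoly" and c u :: "nat \<Rightarrow> 'a"
  assumes "2 \<le> n" "1 \<le> s" "2 \<le> e" "d \<le> n ^ e" and m: "m = s ^ (5 * k ^ 2 + 2)"
    and L_degree: "\<And>i t. i < n \<Longrightarrow> t < q \<Longrightarrow> degree_in t (L i) \<le> n - 1"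
    and nq: "n ^ q \<le> n ^ C * m ^ C"
    and ts: "result (L_alg m) = (q, ts)" "length ts = n" "\<And>i. i < n \<Longrightarrow> sparse_rep q (ts ! i) (L i)"
    and time: "steps (L_alg m) \<le> (n * m) ^ D"
  shows "steps (hitting_set_t L_alg u c n k s d) \<le> (n * m) ^ (D + 10 * (e + 2) * (C + 1) * (k + 1))"
proof -
  define B where "B = n * m"
  \<comment> \<open>Chosen to dominate \<open>N ^ Suc q\<close>, the number of pairs of a block and
    a switch value in one layer.\<close>
  define X where "X = B ^ ((e + 2) * (C + 1))"
  define N where "N = U_size n d"
  define us where "us = map u [0..<N]"
  define cs where "cs = map c [0..<Suc n]"
  define yss where "yss = result (tuples_t us q)"
  have "1 \<le> m" using \<open>1 \<le> s\<close> by (simp add: m)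
  then have B: "n \<le> B" "2 \<le> B" using \<open>2 \<le> n\<close> by (auto simp: B_def intro: order_trans[of 2 n])
  have nq: "n ^ q \<le> B ^ C" using nq by (simp add: B_def power_mult_distrib)
  have N: "N \<le> n ^ (e + 2)" "n ^ 3 < N" using U_size_bounds[of n e d] assms(1,3,4) by (auto simp: N_def)
  have "2 ^ 3 \<le> n ^ 3" using \<open>2 \<le> n\<close> by (rule power_mono) simp
  then have "2 \<le> N" using N(2) by simp
  have NX: "N ^ Suc q \<le> X"
  proof -
    have "N ^ Suc q \<le> (n ^ (e + 2)) ^ Suc q" using N(1) by (rule power_mono) simp
    also have "\<dots> = (n ^ q * n) ^ (e + 2)"
      by (simp only: power_mult[symmetric] power_Suc2[symmetric]) (simp only: mult.commute)
    also have "\<dots> \<le> (B ^ C * B) ^ (e + 2)" using nq B(1) by (intro power_mono mult_le_mono) auto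
    also have "\<dots> = X" unfolding X_def
      by (simp only: power_mult[symmetric] power_Suc2[symmetric] Suc_eq_plus1) (simp only: mult.commute)
    finally show ?thesis .
  qed
  have X16: "16 \<le> X" and nX: "n ^ 4 \<le> X"
  proof -
    have "n ^ 4 \<le> B ^ 4" using B(1) by (rule power_mono) simp
    also have "\<dots> \<le> X" unfolding X_def
    proof (rule power_increasing)
      have "4 * 1 \<le> (e + 2) * (C + 1)" using \<open>2 \<le> e\<close> by (intro mult_le_mono) auto
      then show "4 \<le> (e + 2) * (C + 1)" by simp
    qed (use B in simp)
    finally show "n ^ 4 \<le> X" .
    moreover have "2 ^ 4 \<le> n ^ 4" using \<open>2 \<le> n\<close> by (rule power_mono) simp
    ultimately show "16 \<le> X" by simp
  qed
  have nX: "4 * n \<le> X"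
  proof -
    have "2 ^ 2 * n \<le> n ^ 3 * n" using \<open>2 ^ 3 \<le> n ^ 3\<close> by (intro mult_le_mono1) simp
    also have "\<dots> = n ^ 4" by (simp add: power_numeral_reduce)
    finally show ?thesis using nX by simp
  qed
  define E where "E = n * (n * (2 * (n + 1) + 2) + (n ^ q * (q * (n + 1) + 3) + 1) + 2) + 1"
  have len: "length us = N" "length yss = N ^ q" "length cs = n + 1" by (auto simp: us_def yss_def cs_def)
  have S: "steps (S_points_t cs ts yss us k) \<le> X ^ (k + 3)"
  proof (rule steps_S_points_t[where P = "N ^ Suc q" and E = E])
    fix ds y vs :: "'a list" and z :: 'a assume ds: "length ds \<le> length cs - 1"
    have "steps (sparse_eval_t t y) \<le> n ^ q * (q * (n + 1) + 3) + 1" if t: "t \<in> set ts" for t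
    proof (rule steps_sparse_eval_t)
      obtain i where i: "i < n" "t = ts ! i" using t ts(2) by (auto simp: in_set_conv_nth)
      note rep = sparse_rep_length[OF ts(3)[OF i(1)] L_degree[OF i(1)]]
      show "length t \<le> n ^ q" using rep(1) i \<open>2 \<le> n\<close> by simp
      show "length es = q \<and> set es \<subseteq> {..<n}" if "(a, es) \<in> set t" for a es
        using rep(2)[of a es] ts(3)[OF i(1)] that i(2) \<open>2 \<le> n\<close> by (fastforce simp: sparse_rep_def)
    qed
    then show "steps (S_step_t cs ds z y ts vs) \<le> E"
      using steps_S_step_t[of ts y _ ds n cs z vs] ds len ts(2) by (simp only: E_def)
  next
    show "E + 7 \<le> X ^ 2"
      unfolding E_def by (rule step_cost_le_power[OF B(1) \<open>2 \<le> n\<close> nq \<open>2 \<le> e\<close> X_def])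
    show "2 * length ts + 2 \<le> X" using ts(2) nX \<open>2 \<le> n\<close> by simp
  qed (use len NX X16 \<open>2 \<le> N\<close> in \<open>auto simp: mult.commute\<close>)
  have T: "steps (tuples_t us q) \<le> 12 * X"
    using steps_tuples_t[of us q] len \<open>2 \<le> N\<close> NX by simp
  have "N * 1 \<le> N ^ Suc q" using \<open>2 \<le> N\<close> unfolding power_Suc by (intro mult_le_mono2) simp
  then have "N \<le> X" using NX by linarith
  have k: "5 * k ^ 2 + 3 \<le> X ^ (k + 1)"
  proof -
    have "5 * k ^ 2 + 3 \<le> 16 ^ (k + 1)"
    proof (induction k)
      case (Suc k)
      have "5 * Suc k ^ 2 + 3 = 5 * k ^ 2 + 3 + 10 * k + 5" by (simp add: power2_eq_square)
      also have "\<dots> \<le> 16 * (5 * k ^ 2 + 3)" using self_le_power[of k 2] by (cases k) auto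
      also have "\<dots> \<le> 16 * 16 ^ (k + 1)" using Suc by (intro mult_le_mono2)
      finally show ?case by simp
    qed simp
    also have "\<dots> \<le> X ^ (k + 1)" using X16 by (rule power_mono) simp
    finally show ?thesis .
  qed
  have X_mono: "X ^ r \<le> X ^ r'" if "r \<le> r'" for r r'
    using that X16 by (intro power_increasing) auto
  have "steps (hitting_set_t L_alg u c n k s d) =
    (5 * k ^ 2 + 3) + steps (L_alg m) + (N + 1) + (n + 2) + steps (tuples_t us q) + steps (S_points_t cs ts yss us k)"
    using hitting_set_t_unfold(2)[of L_alg s k q ts u c n d] ts(1)
    unfolding m[symmetric] N_def[symmetric] us_def[symmetric] cs_def[symmetric] yss_def[symmetric] by simp
  also have "\<dots> \<le> X ^ (k + 1) + B ^ D + (15 * X) + X ^ (k + 3)"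
    using k time[folded B_def] \<open>N \<le> X\<close> nX \<open>2 \<le> n\<close> T S X16 by linarith
  also have "\<dots> \<le> B ^ D + X ^ (k + 5)"
  proof -
    have "15 * X \<le> X ^ 2" using X16 by (simp add: power2_eq_square)
    also have "\<dots> \<le> X ^ (k + 4)" by (rule X_mono) simp
    finally have "15 * X \<le> X ^ (k + 4)" .
    moreover have "X ^ (k + 1) \<le> X ^ (k + 4)" "X ^ (k + 3) \<le> X ^ (k + 4)"
      by (rule X_mono, simp)+
    moreover have "X ^ (k + 5) = X * X ^ (k + 4)" by (simp add: numeral_eq_Suc)
    then have "16 * X ^ (k + 4) \<le> X ^ (k + 5)" using X16 by (simp only: mult_le_mono1)
    ultimately show ?thesis by linarith
  qed
  also have "\<dots> \<le> B ^ D * X ^ (k + 6)"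
  proof -
    have "1 \<le> B ^ D" "1 \<le> X ^ (k + 5)" using B X16 by auto
    then have "B ^ D + X ^ (k + 5) \<le> B ^ D * X ^ (k + 5) + B ^ D * X ^ (k + 5)"
      by (intro add_mono) auto
    also have "\<dots> = B ^ D * (2 * X ^ (k + 5))" by simp
    also have "\<dots> \<le> B ^ D * (X * X ^ (k + 5))" using X16 by (intro mult_le_mono2 mult_le_mono1) simp
    finally show ?thesis by (simp add: numeral_eq_Suc)
  qed
  also have "\<dots> \<le> B ^ D * X ^ (10 * (k + 1))"
    by (intro mult_le_mono2 X_mono) simp
  also have "\<dots> = B ^ (D + 10 * (e + 2) * (C + 1) * (k + 1))"
    unfolding X_def power_mult[symmetric] power_add[symmetric] by (simp only: mult_ac)
  finally show ?thesis by (simp add: B_def)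
qed

theorem theorem4p1:
  fixes n k s d e m q C D :: nat
    and c u :: "nat \<Rightarrow> 'a::field"
    and W :: "nat \<Rightarrow> 'a poly"
    and L :: "nat \<Rightarrow> 'a mpoly"
    and L_alg :: "nat \<Rightarrow> (nat \<times> 'a sparse list) timed"
    and U :: "'a set" and H :: "'a list set"
  assumes "n \<ge> 2" and "s \<ge> 1"
    and low_degree: "e \<ge> 2" "d \<le> n ^ e"
    and m_def: "m = s ^ (5 * k ^ 2 + 2)"
    and L_gen: "generator q n (sparse_class n m d) L"
    and L_degree: "\<forall>i<n. \<forall>t<q. degree_in t (L i) \<le> n - 1"
    and q_bound: "real q \<le> real C * max 1 (log (real n) (real m))"
    and L_alg_correct: "\<exists>ts. result (L_alg m) = (q, ts) \<and> length ts = n \<and>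
           (\<forall>i<n. sparse_rep q (ts ! i) (L i))"
    and L_alg_time: "steps (L_alg m) \<le> (n * m) ^ D"
    and c_distinct: "inj_on c {..n}"
    and W: "switch_polys n c W"
    and u_distinct: "inj_on u {..<U_size n d}"
    and U_def: "U = u ` {..<U_size n d}"
    and H_def: "H = S_image W L n q k U"
  shows "set (result (hitting_set_t L_alg u c n k s d)) = H \<and>
    steps (hitting_set_t L_alg u c n k s d)
      \<le> (n * s ^ (5 * k ^ 2 + 2)) ^ (D + 10 * (e + 2) * (C + 1) * (k + 1)) \<and>
    hitting_set n (unmixed_class n k s d) H \<and>
    card H \<le> n ^ ((e + 2) * (C + 1) * k) * s ^ (7 * (e + 2) * C * k ^ 3)"
proof -
  obtain ts where ts: "result (L_alg m) = (q, ts)" "length ts = n" "\<And>i. i < n \<Longrightarrow> sparse_rep q (ts ! i) (L i)"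
    using L_alg_correct by blast
  have "1 \<le> m" using \<open>s \<ge> 1\<close> by (simp add: m_def)
  note bounds = U_size_bounds[OF \<open>n \<ge> 2\<close> low_degree]
  have nq: "n ^ q \<le> n ^ C * m ^ C" by (rule power_le_of_log_bound[OF \<open>n \<ge> 2\<close> \<open>1 \<le> m\<close> q_bound])
  have card_U: "finite U" "card U = U_size n d" using u_distinct by (auto simp: U_def card_image)
  interpret S_generator n q m d c W L U
    by unfold_locales (use L_gen L_degree W card_U bounds in auto)
  have "set (result (hitting_set_t L_alg u c n k s d)) = H"
  proof -
    have us: "set (map u [0..<U_size n d]) = U" by (auto simp: U_def)
    show ?thesis
      unfolding H_def S_image_def hitting_set_t_unfold(1)[of L_alg s k, OF ts(1)[unfolded m_def]]
      by (subst set_S_points_t[OF W c_distinct ts(2,3)]) (auto simp: us tuples_def simp del: set_map)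
  qed
  moreover have "steps (hitting_set_t L_alg u c n k s d)
      \<le> (n * s ^ (5 * k ^ 2 + 2)) ^ (D + 10 * (e + 2) * (C + 1) * (k + 1))"
    unfolding m_def[symmetric]
    by (rule steps_hitting_set_t[where L = L, OF \<open>n \<ge> 2\<close> \<open>s \<ge> 1\<close> low_degree m_def _ nq])
      (use L_degree ts L_alg_time in auto)
  moreover have "hitting_set n (unmixed_class n k s d) H"
    unfolding H_def
  proof (rule S_image_hits_unmixed_class[OF m_def \<open>s \<ge> 1\<close>])
    \<comment> \<open>The part \<open>n ^ 3\<close> of \<open>U_size\<close> serves the case
      \<open>s = 1\<close>, where a product of \<open>n\<close> components of \<open>L\<close> has
      to be nonzero.\<close>
    have "(n - 1) * n \<le> n * n" by simp
    also have "\<dots> \<le> n ^ 3" using \<open>n \<ge> 2\<close> by (simp add: power3_eq_cube)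
    finally show "(n - 1) * n < card U" using bounds(3) card_U(2) by simp
  qed
  \<comment> \<open>The exponent of \<open>s\<close> is cubic in \<open>k\<close>:
    \<open>5 * k ^ 2 + 2\<close> from \<open>m\<close>, times \<open>k\<close> layers.\<close>
  moreover have "card H \<le> n ^ ((e + 2) * (C + 1) * k) * s ^ (7 * (e + 2) * C * k ^ 3)"
  proof -
    have "card H \<le> U_size n d ^ ((q + 1) * k)" using card_S_image[OF card_U(1)] card_U(2) by (simp add: H_def)
    also have "\<dots> \<le> (n ^ (e + 2)) ^ ((q + 1) * k)" using bounds(1) by (rule power_mono) simp
    also have "\<dots> = (n ^ q * n) ^ ((e + 2) * k)"
      by (simp add: power_mult_distrib power_mult[symmetric] power_add[symmetric] algebra_simps)
    also have "\<dots> \<le> (n ^ C * m ^ C * n) ^ ((e + 2) * k)" using nq by (intro power_mono mult_le_mono1) auto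
    also have "\<dots> = n ^ ((e + 2) * (C + 1) * k) * s ^ ((5 * k ^ 2 + 2) * C * ((e + 2) * k))"
      unfolding m_def by (simp add: power_mult_distrib power_mult[symmetric] power_add[symmetric] algebra_simps)
    also have "\<dots> \<le> n ^ ((e + 2) * (C + 1) * k) * s ^ (7 * (e + 2) * C * k ^ 3)"
    proof (intro mult_le_mono2 power_increasing)
      have "(5 * k ^ 2 + 2) * k \<le> 7 * k ^ 3"
        using self_le_power[of k 3] by (cases "k = 0") (auto simp: power2_eq_square power3_eq_cube algebra_simps)
      then have "(5 * k ^ 2 + 2) * k * (C * (e + 2)) \<le> 7 * k ^ 3 * (C * (e + 2))" by (rule mult_le_mono1)
      then show "(5 * k ^ 2 + 2) * C * ((e + 2) * k) \<le> 7 * (e + 2) * C * k ^ 3" by (simp only: mult_ac)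
    qed (use \<open>s \<ge> 1\<close> in simp)
    finally show ?thesis .
  qed
  ultimately show ?thesis by blast
qed

end
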